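(* Let $n\ge 1$, let $P(x)\in\mathbb{R}[ix]$ be a polynomial of degree $n$, and let $\mathcal{A}$ be the corresponding deformation of $\mathbb{C}[x,y]^{C_n}$. (1) Suppose that $P(x)$ has at least three roots $\alpha$, counted with multiplicities, with $|\operatorname{Re}\alpha|<1$. Then the regular bimodule $\mathcal{A}$ is unitarizable. (2) Suppose that $n=2m$ and $P(x)$ has leading coefficient $(-1)^m$. Then: (a) if $P(x)$ has a root $\alpha$ with $|\operatorname{Re}\alpha|<1$, then the regular bimodule $\mathcal{A}$ is unitarizable; (b) if all roots $\alpha$ of $P(x)$ satisfy $|\operatorname{Re}\alpha|>1$, then the regular bimodule $\mathcal{A}$ is not unitarizable.
   Context: For a polynomial $P$ of degree $n$, the deformation $\mathcal{A}$ of $\mathbb{C}[x,y]^{C_n}$ with parameter $P$ is the associative unital $\mathbb{C}$-algebra generated by $e,f,h$ with relations $[h,e]=2e$, $[h,f]=-2f$, $ef=P(h-1)$, $fe=P(h+1)$. $\mathbb{R}[ix]$ is the set of polynomials in $ix$ with real coefficients; $P\in\mathbb{R}[ix]$ iff $\overline{P}(-x)=P(x)$, where $\overline{P}$ is $P$ with complex-conjugated coefficients. For $P\in\mathbb{R}[ix]$ there is an antilinear involutive ring automorphism $a\mapsto\overline{a}$ of $\mathcal{A}$ with $\overline{e}=-f$, $\overline{f}=-e$, $\overline{h}=-h$. The regular bimodule is $\mathcal{A}$ as a bimodule over itself. It is called unitarizable if there is a positive definite Hermitian form $(\cdot,\cdot)$ on $\mathcal{A}$ (linear in the first argument) with $(au,v)=(u,v\overline{a})$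 and $(ua,v)=(u,\overline{a}v)$ for all $a,u,v\in\mathcal{A}$. *)

theory Defs
  imports
    "HOL-Library.Poly_Mapping"
    "HOL-Computational_Algebra.Polynomial"
    "HOL-Algebra.QuotRing"
    "HOL-Algebra.Algebraic_Closure_Type"
begin

section \<open>The free algebra on \<open>e\<close>, \<open>f\<close>, \<open>h\<close>\<close>

text \<open>
  The monoid structure on words is written additively because the product on
  \<open>Poly_Mapping\<close> is the convolution product over an additive monoid.
\<close>

datatype 'a free_monoid = Word (letters: "'a list")

instantiation free_monoid :: (type) monoid_add
begin
definition "0 = Word []"
definition "u + v = Word (letters u @ letters v)"
instance by standard (auto simp: zero_free_monoid_def plus_free_monoid_def)
end

datatype gen = Gen_e | Gen_f | Gen_h

type_synonym free_alg = "gen free_monoid \<Rightarrow>\<^sub>0 complex"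

definition scal :: "complex \<Rightarrow> free_alg" where
  "scal c = Poly_Mapping.single 0 c"

definition fgen :: "gen \<Rightarrow> free_alg" where
  "fgen g = Poly_Mapping.single (Word [g]) 1"

text \<open>Substitution of an element of the (noncommutative) free algebra into a polynomial.\<close>

definition poly_at :: "complex poly \<Rightarrow> free_alg \<Rightarrow> free_alg" where
  "poly_at P a = (\<Sum>i\<le>Polynomial.degree P. scal (Polynomial.coeff P i) * a ^ i)"


section \<open>The deformation with parameter \<open>P\<close>\<close>

definition relators :: "complex poly \<Rightarrow> free_alg set" where
  "relators P = (let e = fgen Gen_e; f = fgen Gen_f; h = fgen Gen_h in
     {(h * e - e * h) - 2 * e,
      (h * f - f * h) - (- 2 * f),
      e * f - poly_at P (h - 1),
      f * e - poly_at P (h + 1)})"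

definition rel_ideal :: "complex poly \<Rightarrow> free_alg set" where
  "rel_ideal P = genideal ring_of_type_algebra (relators P)"

text \<open>Elements of the carrier are cosets in the free algebra.\<close>

definition deformation :: "complex poly \<Rightarrow> free_alg set ring" where
  "deformation P = ring_of_type_algebra Quot rel_ideal P"

definition cls :: "complex poly \<Rightarrow> free_alg \<Rightarrow> free_alg set" where
  "cls P x = rel_ideal P +>\<^bsub>ring_of_type_algebra\<^esub> x"

definition scale :: "complex poly \<Rightarrow> complex \<Rightarrow> free_alg set \<Rightarrow> free_alg set" where
  "scale P c u = cls P (scal c) \<otimes>\<^bsub>deformation P\<^esub> u"


section \<open>The real form and the conjugation\<close>

definition real_ix_polys :: "complex poly set" where
  "real_ix_polys = {map_poly complex_of_real Q \<circ>\<^sub>p [:0, \<i>:] | Q. True}"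

fun conj_gen :: "gen \<Rightarrow> free_alg" where
  "conj_gen Gen_e = - fgen Gen_f"
| "conj_gen Gen_f = - fgen Gen_e"
| "conj_gen Gen_h = - fgen Gen_h"

text \<open>The antilinear multiplicative extension of \<^const>\<open>conj_gen\<close> to the free algebra.\<close>

definition free_conj :: "free_alg \<Rightarrow> free_alg" where
  "free_conj x = (\<Sum>w\<in>Poly_Mapping.keys x.
     scal (cnj (Poly_Mapping.lookup x w)) * prod_list (map conj_gen (letters w)))"

text \<open>
  For \<open>P\<close> in \<^const>\<open>real_ix_polys\<close> the map \<^const>\<open>free_conj\<close> preserves \<open>rel_ideal P\<close>, so the
  image of the coset of \<open>x\<close> is the coset of \<open>free_conj x\<close> and the following is the induced map on
  the quotient (see \<open>alg_conj_cls\<close> and the lemmas after it). For other \<open>P\<close> it has no meaning.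
\<close>

definition alg_conj :: "free_alg set \<Rightarrow> free_alg set" where
  "alg_conj u = free_conj ` u"


subsection \<open>Well-definedness\<close>

lemma ring_free: "ring (ring_of_type_algebra :: 'a :: ring_1 ring)"
proof -
  have "\<exists>y. x + y = 0" "\<exists>y. y + x = 0" for x :: 'a
    using add.right_inverse by (blast, metis add.left_inverse)
  thus ?thesis
    unfolding ring_of_type_algebra_def
    by unfold_locales (auto simp: algebra_simps Units_def add_eq_0_iff)
qed

lemma free_simps [simp]:
  "carrier (ring_of_type_algebra :: 'a :: ring_1 ring) = UNIV"
  "x \<otimes>\<^bsub>ring_of_type_algebra\<^esub> y = x * (y :: 'a)"
  "x \<oplus>\<^bsub>ring_of_type_algebra\<^esub> y = x + (y :: 'a)"
  "\<one>\<^bsub>ring_of_type_algebra\<^esub> = (1 :: 'a)"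
  "\<zero>\<^bsub>ring_of_type_algebra\<^esub> = (0 :: 'a)"
  by (simp_all add: ring_of_type_algebra_def)

lemma ideal_rel_ideal: "ideal (rel_ideal P) ring_of_type_algebra"
  unfolding rel_ideal_def by (rule ring.genideal_ideal [OF ring_free]) simp

lemma ring_deformation: "ring (deformation P)"
  unfolding deformation_def by (rule ideal.quotient_is_ring [OF ideal_rel_ideal])

lemma cls_eq: "cls P x = {r + x | r. r \<in> rel_ideal P}"
  by (auto simp: cls_def a_r_coset_def' )

lemma carrier_deformation: "carrier (deformation P) = range (cls P)"
  by (auto simp: deformation_def FactRing_def A_RCOSETS_def' cls_def a_r_coset_def')

lemma deformation_simps:
  "cls P x \<oplus>\<^bsub>deformation P\<^esub> cls P y = cls P (x + y)"
  "cls P x \<otimes>\<^bsub>deformation P\<^esub> cls P y = cls P (x * y)"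
  "\<one>\<^bsub>deformation P\<^esub> = cls P 1"
  "\<zero>\<^bsub>deformation P\<^esub> = cls P 0"
  using ring_hom_memE [OF ideal.rcos_ring_hom [OF ideal_rel_ideal [of P]]]
    ring_hom_zero [OF ideal.rcos_ring_hom [OF ideal_rel_ideal [of P]] ring_free
      ideal.quotient_is_ring [OF ideal_rel_ideal]]
  by (simp_all add: deformation_def cls_def)

lemma cls_relators:
  fixes P :: "complex poly"
  defines "e \<equiv> fgen Gen_e" and "f \<equiv> fgen Gen_f" and "h \<equiv> fgen Gen_h"
  shows "cls P (h * e - e * h) = cls P (2 * e)" "cls P (h * f - f * h) = cls P (- 2 * f)"
    "cls P (e * f) = cls P (poly_at P (h - 1))" "cls P (f * e) = cls P (poly_at P (h + 1))"
proof -
  have rel: "cls P x = cls P y" if "x - y \<in> relators P" for x y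
  proof -
    interpret ideal "rel_ideal P" ring_of_type_algebra by (rule ideal_rel_ideal)
    have "x - y \<in> rel_ideal P"
      using that ring.genideal_self [OF ring_free, of "relators P"] by (auto simp: rel_ideal_def)
    then have "x \<in> cls P y" unfolding cls_eq by (auto intro!: exI [of _ "x - y"])
    then show ?thesis using a_repr_independence' by (simp add: cls_def)
  qed
  show "cls P (h * e - e * h) = cls P (2 * e)" "cls P (h * f - f * h) = cls P (- 2 * f)"
    "cls P (e * f) = cls P (poly_at P (h - 1))" "cls P (f * e) = cls P (poly_at P (h + 1))"
    by (rule rel, simp add: relators_def Let_def e_def f_def h_def)+
qed

lemma scal_simps:
  "scal (a + b) = scal a + scal b" "scal (a * b) = scal a * scal b" "scal 0 = 0" "scal 1 = 1"
  "scal (- a) = - scal a"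
  by (simp_all add: scal_def single_add mult_single single_uminus)

lemma scal_power: "scal (a ^ i) = scal a ^ i"
  by (induction i) (simp_all add: scal_simps)

lemma scal_central: "scal c * x = x * (scal c :: free_alg)"
proof (induction x rule: update_induct)
  case const
  then show ?case by simp
next
  case (update x k v)
  have "Poly_Mapping.update k v x = x + Poly_Mapping.single k v"
    using update by (intro poly_mapping_eqI)
      (auto simp: lookup_update lookup_add lookup_single when_def in_keys_iff)
  then show ?case using update by (simp add: algebra_simps scal_def mult_single)
qed

lemma free_induct [case_names single add]:
  fixes x :: "'a \<Rightarrow>\<^sub>0 'b :: monoid_add"
  assumes "\<And>w c. Q (Poly_Mapping.single w c)" "\<And>x y. Q x \<Longrightarrow> Q y \<Longrightarrow> Q (x + y)"
  shows "Q x"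
proof (induction x rule: update_induct)
  case const
  then show ?case using assms(1) [of undefined 0] by simp
next
  case (update x k v)
  have "Poly_Mapping.update k v x = x + Poly_Mapping.single k v"
    using update by (intro poly_mapping_eqI)
      (auto simp: lookup_update lookup_add lookup_single when_def in_keys_iff)
  then show ?case using update assms by simp
qed

lemma free_conj_superset:
  assumes "finite S" "Poly_Mapping.keys x \<subseteq> S"
  shows "free_conj x = (\<Sum>w\<in>S.
     scal (cnj (Poly_Mapping.lookup x w)) * prod_list (map conj_gen (letters w)))"
  unfolding free_conj_def using assms
  by (intro sum.mono_neutral_left) (auto simp: in_keys_iff scal_simps)

lemma free_conj_add: "free_conj (x + y) = free_conj x + free_conj y"
proof -
  let ?S = "Poly_Mapping.keys x \<union> Poly_Mapping.keys y"
  have "Poly_Mapping.keys (x + y) \<subseteq> ?S" by (rule Poly_Mapping.keys_add)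
  then show ?thesis
    by (simp add: free_conj_superset [of ?S] lookup_add scal_simps algebra_simps sum.distrib)
qed

lemma free_conj_single:
  "free_conj (Poly_Mapping.single w c) = scal (cnj c) * prod_list (map conj_gen (letters w))"
  by (simp add: free_conj_superset [of "{w}"])

lemma free_conj_mult: "free_conj (x * y) = free_conj x * free_conj y"
proof (induction x rule: free_induct)
  case (single w c)
  show ?case
  proof (induction y rule: free_induct)
    case (single v d)
    let ?p = "\<lambda>w. prod_list (map conj_gen (letters w))"
    have "scal (cnj c) * scal (cnj d) * (?p w * ?p v) = scal (cnj c) * (scal (cnj d) * ?p w) * ?p v"
      by (simp add: mult.assoc)
    also have "\<dots> = scal (cnj c) * (?p w * scal (cnj d)) * ?p v"
      by (simp only: scal_central)
    finally show ?case
      by (simp add: mult_single free_conj_single scal_simps plus_free_monoid_def mult.assoc)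
  qed (simp add: free_conj_add algebra_simps)
qed (simp add: free_conj_add algebra_simps)

lemma free_conj_scal: "free_conj (scal c) = scal (cnj c)"
  by (simp add: scal_def [of c] free_conj_single zero_free_monoid_def)

lemma free_conj_fgen: "free_conj (fgen g) = conj_gen g"
  by (simp add: fgen_def free_conj_single scal_simps)

lemma free_conj_0: "free_conj 0 = 0" and free_conj_1: "free_conj 1 = 1"
  using free_conj_scal [of 0] free_conj_scal [of 1] by (simp_all add: scal_simps)

lemma free_conj_uminus: "free_conj (- x) = - free_conj x"
  by (metis add.right_inverse add_eq_0_iff free_conj_0 free_conj_add)

lemma free_conj_diff: "free_conj (x - y) = free_conj x - free_conj y"
  using free_conj_add [of x "- y"] by (simp add: free_conj_uminus)

lemma free_conj_power: "free_conj (x ^ i) = free_conj x ^ i"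
  by (induction i) (simp_all add: free_conj_1 free_conj_mult)

lemma free_conj_sum: "free_conj (sum g S) = (\<Sum>i\<in>S. free_conj (g i))"
  by (induction S rule: infinite_finite_induct) (simp_all add: free_conj_0 free_conj_add)

lemma free_conj_free_conj: "free_conj (free_conj x) = x"
proof (induction x rule: free_induct)
  case (single w c)
  have gen: "free_conj (conj_gen g) = fgen g" for g
    by (cases g) (simp_all add: free_conj_uminus free_conj_fgen)
  have prod: "free_conj (prod_list (map conj_gen gs)) = Poly_Mapping.single (Word gs) 1" for gs
  proof (induction gs)
    case Nil
    then show ?case by (simp add: free_conj_1 flip: zero_free_monoid_def)
  next
    case (Cons g gs)
    then show ?case
      by (simp add: free_conj_mult gen fgen_def mult_single plus_free_monoid_def)
  qed
  show ?case
    by (simp add: free_conj_single free_conj_mult free_conj_scal prod)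
      (simp add: scal_def mult_single)
qed (simp add: free_conj_add)

lemma coeff_real_ix:
  assumes "P \<in> real_ix_polys"
  shows "cnj (Polynomial.coeff P i) * (- 1) ^ i = Polynomial.coeff P i"
proof -
  have lin: "Polynomial.coeff (Q \<circ>\<^sub>p [:0, c:]) i = Polynomial.coeff Q i * c ^ i" for Q and c :: complex
    by (induction Q arbitrary: i)
      (auto simp: pcompose_pCons coeff_pCons split: nat.splits)
  from assms obtain Q where "P = map_poly complex_of_real Q \<circ>\<^sub>p [:0, \<i>:]"
    by (auto simp: real_ix_polys_def)
  then have "Polynomial.coeff P i = complex_of_real (Polynomial.coeff Q i) * \<i> ^ i"
    by (simp add: lin coeff_map_poly)
  moreover have "cnj (\<i> ^ i) * (- 1) ^ i = \<i> ^ i"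
    by (simp flip: power_mult_distrib)
  ultimately show ?thesis by (simp add: mult.assoc)
qed

lemma free_conj_poly_at:
  assumes "P \<in> real_ix_polys"
  shows "free_conj (poly_at P x) = poly_at P (- free_conj x)"
  unfolding poly_at_def free_conj_sum
proof (rule sum.cong [OF refl])
  fix i
  have "scal (Polynomial.coeff P i) * (- free_conj x) ^ i
      = scal (cnj (Polynomial.coeff P i)) * (scal ((- 1) ^ i) * (- free_conj x) ^ i)"
    by (subst coeff_real_ix [OF assms, symmetric]) (simp add: scal_simps mult.assoc)
  also have "scal ((- 1) ^ i) * (- free_conj x) ^ i = free_conj x ^ i"
    by (cases "even i") (simp_all add: scal_simps)
  finally show "free_conj (scal (Polynomial.coeff P i) * x ^ i)
      = scal (Polynomial.coeff P i) * (- free_conj x) ^ i"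
    by (simp add: free_conj_mult free_conj_scal free_conj_power)
qed

lemma free_conj_relators:
  assumes "P \<in> real_ix_polys" "x \<in> relators P"
  shows "free_conj x \<in> relators P"
proof -
  have two: "free_conj 2 = 2"
    using free_conj_add [of 1 1] by (simp add: free_conj_1)
  define e f h where efh: "e = fgen Gen_e" "f = fgen Gen_f" "h = fgen Gen_h"
  have conj: "free_conj e = - f" "free_conj f = - e" "free_conj h = - h"
    by (simp_all add: efh free_conj_fgen)
  note simps = free_conj_diff free_conj_add free_conj_mult two free_conj_uminus free_conj_1
    free_conj_poly_at [OF assms(1)] conj
  have "free_conj ((h * e - e * h) - 2 * e) = (h * f - f * h) - (- 2 * f)"
    "free_conj ((h * f - f * h) - (- 2 * f)) = (h * e - e * h) - 2 * e"
    "free_conj (e * f - poly_at P (h - 1)) = f * e - poly_at P (h + 1)"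
    "free_conj (f * e - poly_at P (h + 1)) = e * f - poly_at P (h - 1)"
    by (simp_all add: simps add.commute)
  then show ?thesis using assms(2)
    unfolding relators_def Let_def efh [symmetric] by (elim insertE) auto
qed

lemma free_conj_rel_ideal:
  assumes P: "P \<in> real_ix_polys" and x: "x \<in> rel_ideal P"
  shows "free_conj x \<in> rel_ideal P"
proof -
  interpret I: ideal "rel_ideal P" ring_of_type_algebra by (rule ideal_rel_ideal)
  have uminus: "\<ominus>\<^bsub>ring_of_type_algebra\<^esub> a = - a" for a :: free_alg
    by (rule I.minus_equality) auto
  have minus: "- a \<in> rel_ideal P" if "a \<in> rel_ideal P" for a
    using I.I_l_closed [OF that, of "- 1"] by simp
  have "ideal {x. free_conj x \<in> rel_ideal P} (ring_of_type_algebra :: free_alg ring)"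
  proof (rule idealI [OF ring_free])
    have plus: "a + b \<in> rel_ideal P" if "a \<in> rel_ideal P" "b \<in> rel_ideal P" for a b
      using additive_subgroup.a_closed [OF I.additive_subgroup_axioms that] by simp
    have zero: "0 \<in> rel_ideal P"
      using additive_subgroup.zero_closed [OF I.additive_subgroup_axioms] by simp
    show "subgroup {x. free_conj x \<in> rel_ideal P} (add_monoid (ring_of_type_algebra :: free_alg ring))"
    proof (rule subgroup.intro)
      fix x :: free_alg
      assume x: "x \<in> {x. free_conj x \<in> rel_ideal P}"
      have "inv\<^bsub>add_monoid ring_of_type_algebra\<^esub> x = - x"
        using uminus [of x] by (simp only: a_inv_def)
      with x show "inv\<^bsub>add_monoid ring_of_type_algebra\<^esub> x \<in> {x. free_conj x \<in> rel_ideal P}"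
        by (simp only: mem_Collect_eq free_conj_uminus minus)
    qed (simp_all add: free_conj_add free_conj_0 plus zero)
  next
    fix a x :: free_alg
    assume "a \<in> {x. free_conj x \<in> rel_ideal P}"
    then show "x \<otimes>\<^bsub>ring_of_type_algebra\<^esub> a \<in> {x. free_conj x \<in> rel_ideal P}"
      "a \<otimes>\<^bsub>ring_of_type_algebra\<^esub> x \<in> {x. free_conj x \<in> rel_ideal P}"
      using I.I_l_closed [of "free_conj a" "free_conj x"] I.I_r_closed [of "free_conj a" "free_conj x"]
      by (auto simp: free_conj_mult)
  qed
  moreover have "relators P \<subseteq> {x. free_conj x \<in> rel_ideal P}"
    using free_conj_relators [OF P] ring.genideal_self [OF ring_free, of "relators P"]
    by (auto simp: rel_ideal_def)
  ultimately show ?thesis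
    using x ring.genideal_minimal [OF ring_free, of "{x. free_conj x \<in> rel_ideal P}" "relators P"]
    by (auto simp: rel_ideal_def)
qed

lemma alg_conj_cls:
  assumes "P \<in> real_ix_polys"
  shows "alg_conj (cls P x) = cls P (free_conj x)"
  unfolding alg_conj_def cls_eq
  using free_conj_rel_ideal [OF assms]
  by (force simp: free_conj_add free_conj_free_conj image_iff
      intro: exI [of _ "free_conj _"] bexI [of _ "free_conj _"])

lemma alg_conj_fgen:
  assumes "P \<in> real_ix_polys"
  shows "alg_conj (cls P (fgen Gen_e)) = cls P (- fgen Gen_f)"
    "alg_conj (cls P (fgen Gen_f)) = cls P (- fgen Gen_e)"
    "alg_conj (cls P (fgen Gen_h)) = cls P (- fgen Gen_h)"
  by (simp_all add: alg_conj_cls assms free_conj_fgen)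

lemma alg_conj_hom: "P \<in> real_ix_polys \<Longrightarrow> alg_conj \<in> ring_hom (deformation P) (deformation P)"
  by (rule ring_hom_memI)
    (auto simp: carrier_deformation alg_conj_cls deformation_simps free_conj_mult free_conj_add
      free_conj_1)

lemma alg_conj_scale:
  assumes "P \<in> real_ix_polys" "u \<in> carrier (deformation P)"
  shows "alg_conj (scale P c u) = scale P (cnj c) (alg_conj u)"
  using assms
  by (auto simp: carrier_deformation scale_def alg_conj_cls deformation_simps free_conj_mult
      free_conj_scal)

lemma alg_conj_alg_conj:
  assumes "P \<in> real_ix_polys" "u \<in> carrier (deformation P)"
  shows "alg_conj (alg_conj u) = u"
  using assms by (auto simp: carrier_deformation alg_conj_cls free_conj_free_conj)


section \<open>Unitarizability of the regular bimodule\<close>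

definition pos_def_hermitian ::
  "complex poly \<Rightarrow> (free_alg set \<Rightarrow> free_alg set \<Rightarrow> complex) \<Rightarrow> bool" where
  "pos_def_hermitian P B \<longleftrightarrow> (let A = deformation P in
     (\<forall>u\<in>carrier A. \<forall>v\<in>carrier A. \<forall>w\<in>carrier A. B (u \<oplus>\<^bsub>A\<^esub> v) w = B u w + B v w) \<and>
     (\<forall>c. \<forall>u\<in>carrier A. \<forall>v\<in>carrier A. B (scale P c u) v = c * B u v) \<and>
     (\<forall>u\<in>carrier A. \<forall>v\<in>carrier A. B v u = cnj (B u v)) \<and>
     (\<forall>u\<in>carrier A. u \<noteq> \<zero>\<^bsub>A\<^esub> \<longrightarrow> B u u \<in> \<real> \<and> Re (B u u) > 0))"

definition regular_unitarizable :: "complex poly \<Rightarrow> bool" where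
  "regular_unitarizable P \<longleftrightarrow> (let A = deformation P in
     \<exists>B. pos_def_hermitian P B \<and>
       (\<forall>a\<in>carrier A. \<forall>u\<in>carrier A. \<forall>v\<in>carrier A.
          B (a \<otimes>\<^bsub>A\<^esub> u) v = B u (v \<otimes>\<^bsub>A\<^esub> alg_conj a) \<and>
          B (u \<otimes>\<^bsub>A\<^esub> a) v = B u (alg_conj a \<otimes>\<^bsub>A\<^esub> v)))"

end

theory Submission
  imports Defs "HOL-Complex_Analysis.Complex_Analysis" "HOL-Probability.Sinc_Integral" "HOL-Real_Asymp.Real_Asymp"
begin

text \<open>
  An invariant form on the regular bimodule is \<open>(u, v) = T (u * conj v)\<close> for a linear functional \<open>T\<close>, and
  invariance on both sides forces \<open>T (x * y) = T (y * x)\<close>. So \<open>T\<close> kills every nonzero weight of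
  \<open>ad h\<close> and is determined by the functional \<open>\<tau> R = T (R (h))\<close> on polynomials; the trace property
  becomes \<open>\<tau> ((S * P)(x - 1)) = \<tau> ((S * P)(x + 1))\<close>. Distinct weights are orthogonal, and moving two
  factors \<open>e\<close> round the trace turns \<open>T (u * conj u)\<close> for \<open>u\<close> of weight \<open>k + 2\<close> into the same expression
  for an element of weight \<open>k\<close>. Hence positivity only has to be required for \<open>k = 0\<close> and \<open>k = 1\<close>, which are
  \<open>\<tau> (R * star R) > 0\<close> and \<open>\<tau> ((R * star R * P)(x - 1)) < 0\<close>. Here \<open>R * star R\<close> is \<open>|R|\<^sup>2\<close> on the
  imaginary axis. The locale \<open>positive_trace\<close> with \<open>unitarizable\<close> gives one direction of this dictionary,
  \<open>trace_of_unitarizable\<close> the other. That \<open>T\<close> is well defined on the quotient is seen in the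
  representation where \<open>h\<close> multiplies by \<open>x\<close>, \<open>e\<close> shifts by \<open>2\<close> and \<open>f\<close> shifts back and multiplies by
  \<open>P (x + 1)\<close>.

  Existence. Let \<open>M\<close> be the multiset of roots of \<open>P\<close> in the open strip \<open>|Re x| < 1\<close>, \<open>N\<close> its size,
  \<open>z = exp (\<i> \<pi> x)\<close>, and \<open>W = c * z ^ j / (\<Prod>\<alpha>\<in>M. z - z \<alpha>)\<close>. Integrate \<open>R\<close> against \<open>W (x + 1)\<close> along the
  imaginary axis. Since \<open>W\<close> has period \<open>2\<close> and \<open>P * W\<close> is holomorphic in the closed strip, the trace
  property is a shift of the line of integration from \<open>-1\<close> to \<open>1\<close>; convergence needs \<open>0 < j < N\<close>.
  A shift to the imaginary axis shows that the second positivity condition says \<open>- P * W > 0\<close> there,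
  which fixes the sign of \<open>c\<close>; the first one, \<open>W (x + 1) > 0\<close>, then fixes the parity of \<open>j\<close>. If \<open>N \<ge> 3\<close>
  both parities are available. If \<open>N = 2\<close> then \<open>j = 1\<close>, and the sign of the leading coefficient of \<open>P\<close>
  is what makes both conditions compatible; \<open>N = 1\<close> is excluded for \<open>P\<close> of even degree because the roots
  off the strip come in mirror pairs (\<open>positive_trace_exists\<close>, \<open>integral_vertical_line_shift\<close>).

  Non-existence. Now \<open>P > 0\<close> on the imaginary axis. It is enough to find a multiple \<open>Q = P * F\<close> with \<open>Q > 0\<close>
  on the imaginary axis and \<open>Re Q > 0\<close> on the line \<open>Re x = 1\<close>: then \<open>F\<close> and \<open>D = Q (x - 1) + Q (x + 1)\<close> are
  positive on the axis, so both have the form \<open>R * star R\<close>, and \<open>0 < \<tau> D = 2 * \<tau> (Q (x - 1)) \<le> 0\<close>.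
  Such a \<open>Q\<close> is a product over the roots \<open>\<alpha>\<close> of \<open>P\<close> of polynomials that vanish at \<open>\<alpha>\<close> and have small
  argument on the line \<open>Re x = 1\<close> (\<open>cone_polynomial_real_root\<close>). As \<open>|Re \<alpha>| > 1\<close>, a function like
  \<open>1 - cosh (K * x) / cosh (K * Re \<alpha>)\<close> with large \<open>K\<close> is close to \<open>1\<close> on the strip and vanishes at
  \<open>Re \<alpha>\<close>. It is imitated by polynomials on dyadic scales, so that the arguments of the
  factors at every height are dominated by a convergent geometric series, however many scales are used.
\<close>

section \<open>The involution on polynomials and the imaginary axis\<close>

text \<open>
  On the imaginary axis \<open>star R\<close> is the complex conjugate of \<open>R\<close>; the conjugation of the algebra sends
  \<open>R (h)\<close> to \<open>(star R) (h)\<close>, see \<open>free_conj_hpoly\<close>.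
\<close>

definition star :: "complex poly \<Rightarrow> complex poly" where
  "star R = map_poly cnj R \<circ>\<^sub>p [:0, -1:]"

abbreviation translate :: "complex \<Rightarrow> complex poly \<Rightarrow> complex poly" where
  "translate c R \<equiv> R \<circ>\<^sub>p [:c, 1:]"

lemma cnj_poly: "poly (map_poly cnj R) (cnj z) = cnj (poly R z)"
  by (induction R) (auto simp: map_poly_pCons)

lemma poly_star: "poly (star R) z = cnj (poly R (- cnj z))"
  using cnj_poly [of R "- cnj z"] by (simp add: star_def poly_pcompose)

lemma complex_poly_eqI: "(\<And>z. poly p z = poly q z) \<Longrightarrow> p = (q :: complex poly)"
  by (simp add: poly_eq_poly_eq_iff [symmetric] fun_eq_iff)

lemma translate_translate [simp]: "translate a (translate b R) = translate (b + a) R"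
  by (rule complex_poly_eqI) (simp add: poly_pcompose add.assoc)

lemma translate_eq_0_iff [simp]: "translate c R = 0 \<longleftrightarrow> R = 0"
  using translate_translate [where a = "- c" and b = c and R = R] by (metis add.right_inverse pcompose_0 pcompose_idR)

lemma star_simps [simp]:
  "star (R * S) = star R * star S" "star (R + S) = star R + star S" "star (R - S) = star R - star S"
  "star (- R) = - star R" "star 0 = 0" "star 1 = 1"
  "star (smult c R) = smult (cnj c) (star R)" "star (star R) = R"
  "star (translate c R) = translate (- cnj c) (star R)"
  by (rule complex_poly_eqI; simp add: poly_star poly_pcompose)+

lemma star_pCons: "star (pCons c R) = [:cnj c:] - [:0, 1:] * star R"
  by (rule complex_poly_eqI) (simp add: poly_star)

lemma star_eq_0_iff [simp]: "star R = 0 \<longleftrightarrow> R = 0"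
  by (metis star_simps(5,8))

lemma star_real_ix:
  assumes "P \<in> real_ix_polys" shows "star P = P"
proof -
  from assms obtain Q where "P = map_poly complex_of_real Q \<circ>\<^sub>p [:0, \<i>:]"
    by (auto simp: real_ix_polys_def)
  moreover have "cnj (poly (map_poly complex_of_real Q) z) = poly (map_poly complex_of_real Q) (cnj z)" for z
    by (induction Q) (auto simp: map_poly_pCons)
  ultimately show ?thesis
    by (intro complex_poly_eqI) (simp add: poly_star poly_pcompose)
qed

lemma poly_star_imag: "poly (star R) (\<i> * of_real t) = cnj (poly R (\<i> * of_real t))"
  by (simp add: poly_star)

lemma star_mult_imag:
  "poly (R * star R) (\<i> * of_real t) = of_real ((cmod (poly R (\<i> * of_real t)))\<^sup>2)"
  unfolding poly_mult poly_star_imag by (metis complex_norm_square)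

lemma infinite_imag: "infinite (range (\<lambda>t. \<i> * complex_of_real t))"
  by (simp add: finite_image_iff inj_on_def infinite_UNIV_char_0)

lemma poly_imag_eqI:
  assumes "\<And>t. poly p (\<i> * of_real t) = poly q (\<i> * of_real t)"
  shows "p = q"
proof (rule ccontr)
  assume "p \<noteq> q"
  then have "finite {z. poly (p - q) z = 0}" by (intro poly_roots_finite) auto
  moreover have "range (\<lambda>t. \<i> * complex_of_real t) \<subseteq> {z. poly (p - q) z = 0}"
    using assms by auto
  ultimately show False using infinite_imag finite_subset by blast
qed

text \<open>
  The roots of \<open>F\<close> avoid the axis and come in pairs \<open>\<alpha>\<close>, \<open>- cnj \<alpha>\<close> mirrored in it. Such a pair contributes
  \<open>L * star L\<close> up to sign, where \<open>L\<close> is the linear factor of \<open>\<alpha>\<close>, and the remaining cofactor is again positive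
  on the axis.
\<close>

lemma positive_on_imag_factor:
  assumes "\<And>t. poly F (\<i> * of_real t) \<in> \<real> \<and> Re (poly F (\<i> * of_real t)) > 0"
  shows "\<exists>R. F = R * star R"
  using assms
proof (induction "Polynomial.degree F" arbitrary: F rule: less_induct)
  case less
  have sym: "star F = F"
    by (rule poly_imag_eqI) (metis poly_star_imag less.prems Reals_cnj_iff)
  show ?case
  proof (cases "Polynomial.degree F = 0")
    case True
    then obtain c where F: "F = [:c:]" by (elim degree_eq_zeroE)
    with less.prems [of 0] have "c \<in> \<real>" "Re c > 0" by auto
    then have "F = [:of_real (sqrt (Re c)):] * star [:of_real (sqrt (Re c)):]"
      unfolding F star_pCons by (auto simp: complex_eq_iff complex_is_Real_iff)
    then show ?thesis by blast
  next
    case False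
    then obtain \<alpha> where \<alpha>: "poly F \<alpha> = 0"
      using Fundamental_Theorem_Algebra.fundamental_theorem_of_algebra [of F] by (auto simp: Fundamental_Theorem_Algebra.constant_degree)
    have off: "\<alpha> \<noteq> - cnj \<alpha>"
    proof
      assume "\<alpha> = - cnj \<alpha>"
      then have "\<alpha> = \<i> * of_real (Im \<alpha>)" by (auto simp: complex_eq_iff)
      with less.prems [of "Im \<alpha>"] \<alpha> show False by simp
    qed
    have "poly F (- cnj \<alpha>) = 0"
      using poly_star [of F "- cnj \<alpha>"] by (simp add: sym \<alpha>)
    moreover obtain G where G: "F = [:- \<alpha>, 1:] * G" using \<alpha> by (metis poly_eq_0_iff_dvd dvdE)
    ultimately have "(- cnj \<alpha> - \<alpha>) * poly G (- cnj \<alpha>) = 0"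
      by (simp add: algebra_simps del: mult_pCons_left)
    with off have "poly G (- cnj \<alpha>) = 0" by (metis mult_eq_0_iff right_minus_eq)
    then obtain H where H: "G = [:cnj \<alpha>, 1:] * H" by (metis poly_eq_0_iff_dvd dvdE minus_minus)
    define L where "L = [:- \<alpha>, 1:]"
    have starL: "star L = - [:cnj \<alpha>, 1:]" by (rule complex_poly_eqI) (simp add: L_def poly_star)
    have F: "F = (L * star L) * (- H)" by (simp only: starL G H mult.assoc minus_mult_minus flip: L_def)
    have F0: "F \<noteq> 0" using False by auto
    have "\<exists>R. - H = R * star R"
    proof (rule less.hyps)
      have "H \<noteq> 0" using F F0 by auto
      then show "Polynomial.degree (- H) < Polynomial.degree F"
        unfolding G H by (simp add: degree_mult_eq del: mult_pCons_left)
      fix t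
      have pos: "(cmod (poly L (\<i> * of_real t)))\<^sup>2 > 0"
        using less.prems [of t] F by auto
      have *: "poly F (\<i> * of_real t) = of_real ((cmod (poly L (\<i> * of_real t)))\<^sup>2) * poly (- H) (\<i> * of_real t)"
        by (subst F) (simp only: poly_mult [of "L * star L"] star_mult_imag)
      with pos have "poly (- H) (\<i> * of_real t) = poly F (\<i> * of_real t) / of_real ((cmod (poly L (\<i> * of_real t)))\<^sup>2)"
        by auto
      then show "poly (- H) (\<i> * of_real t) \<in> \<real> \<and> Re (poly (- H) (\<i> * of_real t)) > 0"
        using less.prems [of t] pos by (metis Re_divide_of_real Reals_divide Reals_of_real divide_pos_pos)
    qed
    then obtain R where "- H = R * star R" by blast
    then have "F = (L * R) * star (L * R)" by (simp add: F algebra_simps)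
    then show ?thesis by blast
  qed
qed

section \<open>Polynomials in \<open>h\<close>\<close>

abbreviation "e \<equiv> fgen Gen_e"
abbreviation "f \<equiv> fgen Gen_f"
abbreviation "h \<equiv> fgen Gen_h"

definition hpoly :: "complex poly \<Rightarrow> free_alg" where "hpoly R = poly_at R h"

lemma scal_left: "a * (scal c * x) = scal c * (a * x)"
  by (metis mult.assoc scal_central)

lemma two_eq_scal: "(2 :: free_alg) = scal 2"
  using scal_simps(1) [of 1 1] by (simp add: scal_simps)

lemma poly_at_bound:
  assumes "Polynomial.degree R \<le> n"
  shows "poly_at R a = (\<Sum>i\<le>n. scal (Polynomial.coeff R i) * a ^ i)"
  unfolding poly_at_def using assms
  by (intro sum.mono_neutral_left) (auto simp: coeff_eq_0 scal_simps)

lemma poly_at_pCons: "poly_at (pCons c R) a = scal c + a * poly_at R a"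
proof -
  have "poly_at (pCons c R) a = (\<Sum>i\<le>Suc (Polynomial.degree R). scal (Polynomial.coeff (pCons c R) i) * a ^ i)"
    by (rule poly_at_bound) (rule degree_pCons_le)
  also have "\<dots> = scal c + (\<Sum>i\<le>Polynomial.degree R. a * (scal (Polynomial.coeff R i) * a ^ i))"
    by (subst sum.atMost_Suc_shift) (simp add: mult.assoc scal_left)
  finally show ?thesis by (simp add: poly_at_def sum_distrib_left)
qed

lemma poly_at_0: "poly_at 0 a = 0"
  by (simp add: poly_at_def scal_simps)

lemma poly_at_add: "poly_at (R + S) a = poly_at R a + poly_at S a"
proof -
  let ?n = "max (Polynomial.degree R) (Polynomial.degree S)"
  show ?thesis
    by (simp add: poly_at_bound [of _ ?n] degree_add_le scal_simps algebra_simps sum.distrib)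
qed

lemma poly_at_smult: "poly_at (Polynomial.smult c R) a = scal c * poly_at R a"
proof (induction R)
  case (pCons b R)
  then show ?case by (simp add: poly_at_pCons scal_simps distrib_left scal_left)
qed (simp add: poly_at_0)

lemma poly_at_mult: "poly_at (R * S) a = poly_at R a * poly_at S a"
  by (induction R) (simp_all add: poly_at_0 poly_at_add poly_at_smult poly_at_pCons scal_simps algebra_simps)

lemma poly_at_pcompose: "poly_at (R \<circ>\<^sub>p S) a = poly_at R (poly_at S a)"
  by (induction R) (simp_all add: poly_at_0 pcompose_pCons poly_at_add poly_at_mult poly_at_pCons)

lemma poly_at_translate: "poly_at (translate c R) a = poly_at R (a + scal c)"
  by (simp add: poly_at_pcompose) (simp add: poly_at_pCons poly_at_0 scal_simps add.commute)

lemma hpoly_simps: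
  "hpoly (pCons c R) = scal c + h * hpoly R" "hpoly 0 = 0" "hpoly 1 = 1"
  "hpoly (R + S) = hpoly R + hpoly S" "hpoly (R * S) = hpoly R * hpoly S"
  "hpoly (Polynomial.smult c R) = scal c * hpoly R"
  using poly_at_pCons [of 1 0 h]
  by (simp_all add: hpoly_def poly_at_pCons poly_at_0 poly_at_add poly_at_mult poly_at_smult scal_simps
      one_pCons del: One_nat_def)

lemma free_conj_hpoly: "free_conj (hpoly R) = hpoly (star R)"
proof (induction R)
  case (pCons c R)
  have "hpoly (star (pCons c R)) = hpoly ([:cnj c:] + [:0, - 1:] * star R)"
    by (simp add: star_pCons)
  also have "\<dots> = scal (cnj c) - h * hpoly (star R)"
    unfolding hpoly_simps(4,5) by (simp add: hpoly_simps scal_simps)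
  finally show ?case using pCons
    by (simp add: hpoly_simps free_conj_add free_conj_mult free_conj_scal free_conj_fgen)
qed (simp add: hpoly_simps free_conj_0)


section \<open>Congruence modulo the defining relations\<close>

definition rel_eq :: "complex poly \<Rightarrow> free_alg \<Rightarrow> free_alg \<Rightarrow> bool" where
  "rel_eq P x y \<longleftrightarrow> x - y \<in> rel_ideal P"

lemma rel_ideal_closed:
  "0 \<in> rel_ideal P"
  "x \<in> rel_ideal P \<Longrightarrow> y \<in> rel_ideal P \<Longrightarrow> x + y \<in> rel_ideal P"
  "x \<in> rel_ideal P \<Longrightarrow> a * x \<in> rel_ideal P"
  "x \<in> rel_ideal P \<Longrightarrow> x * a \<in> rel_ideal P"
proof -
  interpret I: ideal "rel_ideal P" ring_of_type_algebra by (rule ideal_rel_ideal)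
  show "0 \<in> rel_ideal P"
    using additive_subgroup.zero_closed [OF I.additive_subgroup_axioms] by simp
  show "x \<in> rel_ideal P \<Longrightarrow> y \<in> rel_ideal P \<Longrightarrow> x + y \<in> rel_ideal P"
    using additive_subgroup.a_closed [OF I.additive_subgroup_axioms, of x y] by simp
  show "x \<in> rel_ideal P \<Longrightarrow> a * x \<in> rel_ideal P" "x \<in> rel_ideal P \<Longrightarrow> x * a \<in> rel_ideal P"
    using I.I_l_closed [of x a] I.I_r_closed [of x a] by simp_all
qed

lemma cls_eq_iff: "cls P x = cls P y \<longleftrightarrow> rel_eq P x y"
proof -
  interpret I: ideal "rel_ideal P" ring_of_type_algebra by (rule ideal_rel_ideal)
  have "x \<in> cls P x" using rel_ideal_closed(1) [of P] unfolding cls_eq by force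
  moreover have "x \<in> cls P y \<Longrightarrow> cls P x = cls P y"
    using I.a_repr_independence' [of x y] by (simp add: cls_def)
  moreover have "x \<in> cls P y \<longleftrightarrow> rel_eq P x y"
    unfolding cls_eq rel_eq_def by (auto simp: algebra_simps) (metis diff_add_cancel)
  ultimately show ?thesis by blast
qed

lemma rel_eq_refl [simp, intro]: "rel_eq P x x"
  by (simp flip: cls_eq_iff)

lemma rel_eq_sym: "rel_eq P x y \<Longrightarrow> rel_eq P y x"
  by (simp flip: cls_eq_iff)

lemma rel_eq_trans [trans]: "rel_eq P x y \<Longrightarrow> rel_eq P y z \<Longrightarrow> rel_eq P x z"
  by (simp flip: cls_eq_iff)

lemma rel_eq_add: "rel_eq P x y \<Longrightarrow> rel_eq P x' y' \<Longrightarrow> rel_eq P (x + x') (y + y')"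
  by (simp flip: cls_eq_iff deformation_simps(1))

lemma rel_eq_mult: "rel_eq P x y \<Longrightarrow> rel_eq P x' y' \<Longrightarrow> rel_eq P (x * x') (y * y')"
  by (simp flip: cls_eq_iff deformation_simps(2))

lemma rel_eq_multl: "rel_eq P x y \<Longrightarrow> rel_eq P (a * x) (a * y)"
  by (simp add: rel_eq_mult)

lemma rel_eq_multr: "rel_eq P x y \<Longrightarrow> rel_eq P (x * a) (y * a)"
  by (simp add: rel_eq_mult)

lemma rel_eq_uminus: "rel_eq P x y \<Longrightarrow> rel_eq P (- x) (- y)"
  using rel_eq_multl [of P x y "- 1"] by simp

lemma rel_eq_free_conj:
  assumes "P \<in> real_ix_polys" "rel_eq P x y"
  shows "rel_eq P (free_conj x) (free_conj y)"
  using assms free_conj_rel_ideal unfolding rel_eq_def by (metis free_conj_diff)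

text \<open>
  The relations in the form used below: \<open>e\<close> and \<open>f\<close> are eigenvectors of \<open>ad h\<close>, and \<open>e * f\<close>, \<open>f * e\<close> are
  polynomials in \<open>h\<close>.
\<close>

lemma rel_eq_relations:
  "rel_eq P (h * e) (e * (h + scal 2))" "rel_eq P (h * f) (f * (h + scal (- 2)))"
  "rel_eq P (e * f) (hpoly (translate (- 1) P))" "rel_eq P (f * e) (hpoly (translate 1 P))"
proof -
  have two: "(2 :: free_alg) = scal 2"
    by (rule two_eq_scal)
  note rel = cls_relators [where P = P, unfolded cls_eq_iff]
  have "rel_eq P (h * e - e * h + e * h) (2 * e + e * h)"
    using rel(1) by (rule rel_eq_add) simp
  then show "rel_eq P (h * e) (e * (h + scal 2))"
    by (simp add: two scal_central algebra_simps)
  have "rel_eq P (h * f - f * h + f * h) (- 2 * f + f * h)"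
    using rel(2) by (rule rel_eq_add) simp
  then show "rel_eq P (h * f) (f * (h + scal (- 2)))"
    by (simp add: two scal_central scal_simps algebra_simps)
  show "rel_eq P (e * f) (hpoly (translate (- 1) P))" "rel_eq P (f * e) (hpoly (translate 1 P))"
    using rel(3,4) by (simp_all add: hpoly_def poly_at_translate scal_simps)
qed


section \<open>The weight grading\<close>

text \<open>
  This is \<open>h * x - x * h = 2 * k * x\<close> in the quotient, written so that \<open>h\<close> moves across \<open>x\<close> at the price of a
  shift; by induction every polynomial in \<open>h\<close> does (\<open>hpoly_weight_commute\<close>).
\<close>

definition weight :: "complex poly \<Rightarrow> free_alg \<Rightarrow> int \<Rightarrow> bool" where
  "weight P x k \<longleftrightarrow> rel_eq P (h * x) (x * (h + scal (2 * of_int k)))"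

lemma weight_mult:
  assumes "weight P x j" "weight P y k"
  shows "weight P (x * y) (j + k)"
proof -
  have "rel_eq P (h * (x * y)) (x * ((h + scal (2 * of_int j)) * y))"
    using rel_eq_multr [OF assms(1) [unfolded weight_def], of y] by (simp add: mult.assoc)
  also have "x * ((h + scal (2 * of_int j)) * y) = x * (h * y + y * scal (2 * of_int j))"
    by (simp add: distrib_right scal_central)
  also have "rel_eq P \<dots> (x * (y * (h + scal (2 * of_int k)) + y * scal (2 * of_int j)))"
    using assms(2) unfolding weight_def by (intro rel_eq_multl rel_eq_add rel_eq_refl)
  also have "\<dots> = x * y * (h + scal (2 * of_int (j + k)))"
    by (simp add: algebra_simps scal_simps)
  finally show ?thesis by (simp add: weight_def)
qed

lemma weight_add: "weight P x k \<Longrightarrow> weight P y k \<Longrightarrow> weight P (x + y) k"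
  unfolding weight_def distrib_left [of h] distrib_right [of x] by (rule rel_eq_add)

lemma weight_gen: "weight P e 1" "weight P f (- 1)"
  using rel_eq_relations [of P] by (simp_all add: weight_def)

lemma weight_scal: "weight P (scal c) 0"
  unfolding weight_def by (simp only: of_int_0 mult_zero_right scal_simps(3) add_0_right scal_central [of c h] rel_eq_refl)

lemma weight_hpoly: "weight P (hpoly R) 0"
proof (induction R)
  case (pCons c R)
  have "weight P h 0" by (simp add: weight_def scal_simps)
  from weight_mult [OF this pCons(2)] show ?case
    by (auto simp: hpoly_simps intro: weight_add weight_scal)
qed (simp add: hpoly_simps weight_def)

lemma weight_power:
  assumes "weight P x k" shows "weight P (x ^ n) (int n * k)"
proof (induction n)
  case 0
  then show ?case by (simp add: weight_def scal_simps)
next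
  case (Suc n)
  with weight_mult [OF assms this] show ?case by (simp add: algebra_simps)
qed

text \<open>
  Together with polynomials in \<open>h\<close> on the left these span the quotient, one for each weight.
\<close>

definition mon :: "int \<Rightarrow> free_alg" where
  "mon k = (if k \<ge> 0 then e ^ nat k else f ^ nat (- k))"

lemma weight_mon: "weight P (mon k) k"
  using weight_power [OF weight_gen(1), of P "nat k"] weight_power [OF weight_gen(2), of P "nat (- k)"]
  by (auto simp: mon_def)

lemma weight_free_conj:
  assumes "P \<in> real_ix_polys" "weight P x k"
  shows "weight P (free_conj x) (- k)"
proof -
  have "rel_eq P (- h * free_conj x) (free_conj x * (- h + scal (2 * of_int k)))"
    using rel_eq_free_conj [OF assms(1) assms(2) [unfolded weight_def]]
    by (simp add: free_conj_mult free_conj_add free_conj_fgen free_conj_scal)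
  from rel_eq_uminus [OF this] show ?thesis
    by (simp add: weight_def scal_simps algebra_simps)
qed

lemma hpoly_weight_commute:
  assumes "weight P x k"
  shows "rel_eq P (hpoly R * x) (x * hpoly (translate (2 * of_int k) R))"
proof (induction R)
  case (pCons c R)
  let ?c = "2 * of_int k :: complex"
  have "hpoly (pCons c R) * x = x * scal c + h * (hpoly R * x)"
    by (simp add: hpoly_simps distrib_right scal_central mult.assoc)
  also have "rel_eq P \<dots> (x * scal c + h * (x * hpoly (translate ?c R)))"
    using pCons by (intro rel_eq_multl rel_eq_add rel_eq_refl)
  also have "\<dots> = x * scal c + (h * x) * hpoly (translate ?c R)"
    by (simp add: mult.assoc)
  also have "rel_eq P \<dots> (x * scal c + (x * (h + scal ?c)) * hpoly (translate ?c R))"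
    using assms unfolding weight_def by (intro rel_eq_multr rel_eq_add rel_eq_refl)
  also have "\<dots> = x * hpoly (translate ?c (pCons c R))"
    by (simp only: pcompose_pCons hpoly_simps(4,5))
      (simp add: hpoly_simps scal_simps algebra_simps)
  finally show ?case .
qed (simp add: hpoly_simps)

lemma weight_hpoly_commute:
  assumes "weight P x k"
  shows "rel_eq P (x * hpoly R) (hpoly (translate (- 2 * of_int k) R) * x)"
proof -
  have "translate (2 * of_int k) (translate (- 2 * of_int k) R) = R"
    by (rule complex_poly_eqI) (simp add: poly_pcompose)
  then show ?thesis
    using hpoly_weight_commute [OF assms, of "translate (- 2 * of_int k) R"] by (simp add: rel_eq_sym)
qed

section \<open>The polynomial representation\<close>

text \<open>
  A family \<open>v\<close> stands for the formal sum of the operators \<open>v k (x) * s ^ k\<close>, where \<open>s\<close> is the shift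
  \<open>x \<mapsto> x - 2\<close> of the argument of a function; a generator acts by left multiplication with
  \<open>e = s\<close>, \<open>f = P (x + 1) * s ^ (-1)\<close> and \<open>h = x\<close>.
\<close>

fun act_gen :: "complex poly \<Rightarrow> gen \<Rightarrow> (int \<Rightarrow> complex poly) \<Rightarrow> int \<Rightarrow> complex poly" where
  "act_gen P Gen_e v = (\<lambda>k. translate (- 2) (v (k - 1)))"
| "act_gen P Gen_f v = (\<lambda>k. translate 1 P * translate 2 (v (k + 1)))"
| "act_gen P Gen_h v = (\<lambda>k. [:0, 1:] * v k)"

definition act :: "complex poly \<Rightarrow> free_alg \<Rightarrow> (int \<Rightarrow> complex poly) \<Rightarrow> int \<Rightarrow> complex poly" where
  "act P x v k = (\<Sum>w\<in>Poly_Mapping.keys x.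
     Polynomial.smult (Poly_Mapping.lookup x w) (foldr (act_gen P) (letters w) v k))"

lemma act_superset:
  assumes "finite S" "Poly_Mapping.keys x \<subseteq> S"
  shows "act P x v k = (\<Sum>w\<in>S.
     Polynomial.smult (Poly_Mapping.lookup x w) (foldr (act_gen P) (letters w) v k))"
  unfolding act_def using assms
  by (intro sum.mono_neutral_left) (auto simp: in_keys_iff)

lemma act_add: "act P (x + y) v k = act P x v k + act P y v k"
proof -
  let ?S = "Poly_Mapping.keys x \<union> Poly_Mapping.keys y"
  have "Poly_Mapping.keys (x + y) \<subseteq> ?S" by (rule Poly_Mapping.keys_add)
  then show ?thesis
    by (simp add: act_superset [of ?S] lookup_add smult_add_left sum.distrib)
qed

lemma act_single:
  "act P (Poly_Mapping.single w c) v k = Polynomial.smult c (foldr (act_gen P) (letters w) v k)"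
  by (simp add: act_superset [of "{w}"])

lemma act_gen_linear:
  "act_gen P g (\<lambda>k. Polynomial.smult c (v k)) = (\<lambda>k. Polynomial.smult c (act_gen P g v k))"
  "act_gen P g (\<lambda>k. v k + v' k) = (\<lambda>k. act_gen P g v k + act_gen P g v' k)"
  by (cases g; simp add: fun_eq_iff pcompose_smult pcompose_add distrib_left)+

lemma act_word_linear:
  "foldr (act_gen P) gs (\<lambda>k. Polynomial.smult c (v k)) = (\<lambda>k. Polynomial.smult c (foldr (act_gen P) gs v k))"
  "foldr (act_gen P) gs (\<lambda>k. v k + v' k) = (\<lambda>k. foldr (act_gen P) gs v k + foldr (act_gen P) gs v' k)"
  by (induction gs) (simp_all add: act_gen_linear)

lemma act_linear:
  "act P x (\<lambda>k. Polynomial.smult c (v k)) k = Polynomial.smult c (act P x v k)"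
  "act P x (\<lambda>k. v k + v' k) k = act P x v k + act P x v' k"
proof -
  have "Polynomial.smult c (sum g S) = (\<Sum>w\<in>S. Polynomial.smult c (g w))" for g :: "gen free_monoid \<Rightarrow> complex poly" and S
    by (induction S rule: infinite_finite_induct) (simp_all add: smult_add_right)
  then show "act P x (\<lambda>k. Polynomial.smult c (v k)) k = Polynomial.smult c (act P x v k)"
    by (simp add: act_def act_word_linear mult.commute)
  show "act P x (\<lambda>k. v k + v' k) k = act P x v k + act P x v' k"
    by (simp add: act_def act_word_linear smult_add_right sum.distrib)
qed

lemma act_mult: "act P (x * y) v k = act P x (act P y v) k"
proof (induction x arbitrary: k rule: free_induct)
  case (single w c)
  show ?case
  proof (induction y arbitrary: k rule: free_induct)
    case (single w' c')
    have "act P (Poly_Mapping.single w' c') v = (\<lambda>k. Polynomial.smult c' (foldr (act_gen P) (letters w') v k))"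
      by (simp add: act_single fun_eq_iff)
    then show ?case
      by (simp add: mult_single act_single plus_free_monoid_def act_word_linear)
  next
    case (add y y')
    have "act P (y + y') v = (\<lambda>k. act P y v k + act P y' v k)"
      by (simp add: act_add fun_eq_iff)
    with add show ?case by (simp add: distrib_left act_add act_linear)
  qed
qed (simp add: distrib_right act_add)

lemma act_scal: "act P (scal c) v k = Polynomial.smult c (v k)"
  by (simp add: scal_def act_single zero_free_monoid_def)

lemma act_fgen: "act P (fgen g) v k = act_gen P g v k"
  by (simp add: fgen_def act_single)

lemma act_0: "act P 0 v k = 0"
  using act_scal [of P 0] by (simp add: scal_simps)

lemma act_uminus: "act P (- x) v k = - act P x v k"
  using act_add [of P x "- x" v k] by (simp add: act_0 eq_neg_iff_add_eq_0 add.commute)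

lemma act_diff: "act P (x - y) v k = act P x v k - act P y v k"
  using act_add [of P x "- y" v k] by (simp add: act_uminus)

lemma act_zero_vector: "act P x (\<lambda>_. 0) k = 0"
  using act_linear(1) [of P x 0 "\<lambda>_. 0" k] by simp

lemma act_poly_at:
  assumes "\<And>v k. act P a v k = L * v k"
  shows "act P (poly_at R a) v k = (R \<circ>\<^sub>p L) * v k"
proof (induction R arbitrary: v k)
  case (pCons c R)
  then show ?case
    by (simp add: poly_at_pCons act_add act_scal act_mult assms pcompose_pCons algebra_simps)
qed (simp add: poly_at_0 act_0)

lemma act_relators:
  assumes "x \<in> relators P"
  shows "act P x v k = 0"
proof -
  have two: "(2 :: free_alg) = scal 2"
    by (rule two_eq_scal)
  have h: "act P (h + scal c) v k = [:c, 1:] * v k" for c v k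
    by (simp add: act_add act_fgen act_scal)
  have poly: "act P (poly_at P (h - 1)) v k = translate (- 1) P * v k"
    "act P (poly_at P (h + 1)) v k = translate 1 P * v k"
    using act_poly_at [OF h, of P "- 1"] act_poly_at [OF h, of P 1] by (simp_all add: scal_simps)
  note act_simps = act_add act_diff act_mult act_fgen act_uminus two act_scal poly
  have "act P (h * e - e * h - 2 * e) v k = 0"
    by (simp add: act_simps) (intro complex_poly_eqI, simp add: poly_pcompose algebra_simps)
  moreover have "act P (h * f - f * h - (- 2 * f)) v k = 0"
    by (simp add: act_simps) (intro complex_poly_eqI, simp add: poly_pcompose algebra_simps)
  moreover have "act P (e * f - poly_at P (h - 1)) v k = 0"
    by (simp add: act_simps pcompose_mult)
  moreover have "act P (f * e - poly_at P (h + 1)) v k = 0"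
    by (simp add: act_simps pcompose_mult)
  ultimately show ?thesis using assms by (auto simp only: relators_def Let_def insert_iff empty_iff)
qed

text \<open>
  The elements acting by zero form a two-sided ideal, and it contains the relators.
\<close>

lemma act_rel_ideal:
  assumes "x \<in> rel_ideal P"
  shows "act P x v k = 0"
proof -
  let ?J = "{x. \<forall>v k. act P x v k = 0}"
  have uminus: "inv\<^bsub>add_monoid ring_of_type_algebra\<^esub> a = - a" for a :: free_alg
  proof -
    interpret ring "ring_of_type_algebra :: free_alg ring" by (rule ring_free)
    have "\<ominus>\<^bsub>ring_of_type_algebra\<^esub> a = - a" by (rule minus_equality) auto
    then show ?thesis by (simp only: a_inv_def)
  qed
  have z: "act P x v = (\<lambda>_. 0)" if "x \<in> ?J" for x v using that by auto
  have "ideal ?J (ring_of_type_algebra :: free_alg ring)"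
  proof (rule idealI [OF ring_free])
    show "subgroup ?J (add_monoid (ring_of_type_algebra :: free_alg ring))"
    proof (rule subgroup.intro)
      fix x assume "x \<in> ?J"
      then show "inv\<^bsub>add_monoid ring_of_type_algebra\<^esub> x \<in> ?J"
        by (simp only: mem_Collect_eq uminus act_uminus) simp
    qed (simp_all add: act_add act_0)
  next
    fix a x :: free_alg
    assume "a \<in> ?J"
    from z [OF this] show "x \<otimes>\<^bsub>ring_of_type_algebra\<^esub> a \<in> ?J" "a \<otimes>\<^bsub>ring_of_type_algebra\<^esub> x \<in> ?J"
      by (simp_all add: act_mult act_zero_vector)
  qed
  moreover have "relators P \<subseteq> ?J" using act_relators by blast
  ultimately have "rel_ideal P \<subseteq> ?J"
    unfolding rel_ideal_def by (rule ring.genideal_minimal [OF ring_free])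
  with assms show ?thesis by blast
qed

definition unit_vector :: "int \<Rightarrow> complex poly" where
  "unit_vector k = (if k = 0 then 1 else 0)"

text \<open>
  Acting on the unit gives the skew Laurent polynomial in the shift that represents \<open>x\<close>; this is its
  coefficient at the zeroth power.
\<close>

definition weight_zero_part :: "complex poly \<Rightarrow> free_alg \<Rightarrow> complex poly" where
  "weight_zero_part P x = act P x unit_vector 0"

lemma weight_zero_part_cong: "rel_eq P x y \<Longrightarrow> weight_zero_part P x = weight_zero_part P y"
  using act_rel_ideal [of "x - y" P] by (simp add: rel_eq_def weight_zero_part_def act_diff)

lemma weight_zero_part_add: "weight_zero_part P (x + y) = weight_zero_part P x + weight_zero_part P y"
  by (simp add: weight_zero_part_def act_add)

lemma weight_zero_part_scal: "weight_zero_part P (scal c * x) = Polynomial.smult c (weight_zero_part P x)"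
  by (simp add: weight_zero_part_def act_mult act_scal)

lemma weight_zero_part_hpoly: "weight_zero_part P (hpoly R) = R"
proof -
  have "act P h v k = [:0, 1:] * v k" for v k by (simp add: act_fgen)
  from act_poly_at [OF this] show ?thesis
    by (simp add: weight_zero_part_def hpoly_def unit_vector_def pcompose_idR)
qed

text \<open>
  The operator in question is right multiplication by \<open>h\<close>, which therefore commutes with the left action.
\<close>

lemma act_right_h:
  "act P x (\<lambda>k. [:- 2 * of_int k, 1:] * v k) k = [:- 2 * of_int k, 1:] * act P x v k"
proof -
  let ?\<rho> = "\<lambda>v k. [:- 2 * of_int k, 1:] * v k"
  have gen: "act_gen P g (?\<rho> v) = ?\<rho> (act_gen P g v)" for g v
    by (cases g; intro ext complex_poly_eqI; simp add: poly_pcompose algebra_simps)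
  have "foldr (act_gen P) gs (?\<rho> v) = ?\<rho> (foldr (act_gen P) gs v)" for gs
    by (induction gs) (simp_all only: foldr.simps comp_def id_def gen)
  then show ?thesis by (simp only: act_def sum_distrib_left mult_smult_right)
qed

lemma weight_zero_part_h_commute: "weight_zero_part P (h * x) = weight_zero_part P (x * h)"
proof -
  have "act P h unit_vector = (\<lambda>k. [:- 2 * of_int k, 1:] * unit_vector k)"
    by (auto simp: fun_eq_iff act_fgen unit_vector_def)
  then have "act P (x * h) unit_vector 0 = [:0, 1:] * act P x unit_vector 0"
    using act_right_h [of P x unit_vector 0] by (simp only: act_mult of_int_0 mult_zero_right)
  then show ?thesis by (simp add: weight_zero_part_def act_mult act_fgen)
qed

text \<open>
  For \<open>x\<close> of weight \<open>k\<close> the relation \<open>h * x - x * h = 2 * k * x\<close> and \<open>weight_zero_part_h_commute\<close> give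
  \<open>2 * k\<close> times the component as zero.
\<close>

lemma weight_zero_part_weight:
  assumes "weight P x k" "k \<noteq> 0"
  shows "weight_zero_part P x = 0"
proof -
  have "weight_zero_part P (h * x) = weight_zero_part P (x * h + scal (2 * of_int k) * x)"
    using weight_zero_part_cong [OF assms(1) [unfolded weight_def]] by (simp add: distrib_left scal_central)
  then have "Polynomial.smult (2 * of_int k) (weight_zero_part P x) = 0"
    by (simp only: weight_zero_part_add weight_zero_part_scal weight_zero_part_h_commute add_cancel_right_right)
  with assms(2) show ?thesis by simp
qed


section \<open>Normal forms\<close>

definition normal_form :: "(int \<Rightarrow> complex poly) \<Rightarrow> free_alg" where
  "normal_form R = (\<Sum>k | R k \<noteq> 0. hpoly (R k) * mon k)"

definition has_normal_form :: "complex poly \<Rightarrow> free_alg \<Rightarrow> bool" where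
  "has_normal_form P x \<longleftrightarrow> (\<exists>R. finite {k. R k \<noteq> 0} \<and> rel_eq P x (normal_form R))"

lemma normal_form_superset:
  assumes "finite S" "{k. R k \<noteq> 0} \<subseteq> S"
  shows "normal_form R = (\<Sum>k\<in>S. hpoly (R k) * mon k)"
  unfolding normal_form_def using assms
  by (intro sum.mono_neutral_left) (auto simp: hpoly_simps)

lemma has_normal_form_cong: "rel_eq P x y \<Longrightarrow> has_normal_form P y \<Longrightarrow> has_normal_form P x"
  unfolding has_normal_form_def by (meson rel_eq_trans)

lemma has_normal_form_single: "has_normal_form P (hpoly S * mon k)"
proof -
  let ?R = "\<lambda>j. if j = k then S else 0"
  have "normal_form ?R = hpoly S * mon k"
    by (subst normal_form_superset [of "{k}"]) auto
  moreover have "finite {j. ?R j \<noteq> 0}" by (rule finite_subset [of _ "{k}"]) auto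
  ultimately show ?thesis unfolding has_normal_form_def by (intro exI [of _ ?R]) simp
qed

lemma has_normal_form_add:
  assumes "has_normal_form P x" "has_normal_form P y"
  shows "has_normal_form P (x + y)"
proof -
  from assms obtain R S where R: "finite {k. R k \<noteq> 0}" "rel_eq P x (normal_form R)"
    and S: "finite {k. S k \<noteq> 0}" "rel_eq P y (normal_form S)"
    unfolding has_normal_form_def by blast
  let ?U = "{k. R k \<noteq> 0} \<union> {k. S k \<noteq> 0}"
  have fin: "finite ?U" using R S by blast
  have "normal_form (\<lambda>k. R k + S k) = normal_form R + normal_form S"
    using fin
    by (subst (1 2 3) normal_form_superset [of ?U])
      (auto simp: hpoly_simps distrib_right sum.distrib)
  moreover have "finite {k. R k + S k \<noteq> 0}" by (rule finite_subset [OF _ fin]) auto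
  ultimately show ?thesis
    unfolding has_normal_form_def using rel_eq_add [OF R(2) S(2)] by metis
qed

lemma has_normal_form_sum:
  "(\<And>i. i \<in> S \<Longrightarrow> has_normal_form P (g i)) \<Longrightarrow> has_normal_form P (sum g S)"
proof (induction S rule: infinite_finite_induct)
  case (insert i S)
  then show ?case by (auto intro: has_normal_form_add)
qed (use has_normal_form_single [of P 0 0] in \<open>simp_all add: hpoly_simps\<close>)

lemma gen_mon:
  "\<exists>S j. rel_eq P (fgen g * mon k) (hpoly S * mon j)"
proof (cases g)
  case Gen_e
  show ?thesis
  proof (cases "k \<ge> 0")
    case True
    then have "fgen g * mon k = hpoly 1 * mon (k + 1)"
      by (simp add: Gen_e mon_def hpoly_simps nat_add_distrib power_commutes)
    then show ?thesis by (metis rel_eq_refl)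
  next
    case False
    then have "nat (- k) = Suc (nat (- (k + 1)))" by simp
    with False have "mon k = f * mon (k + 1)" by (simp add: mon_def)
    then have "fgen g * mon k = e * f * mon (k + 1)" by (simp add: Gen_e mult.assoc)
    then show ?thesis using rel_eq_multr [OF rel_eq_relations(3)] by metis
  qed
next
  case Gen_f
  show ?thesis
  proof (cases "k \<le> 0")
    case True
    then have "nat (1 - k) = Suc (nat (- k))" by simp
    with True have "fgen g * mon k = hpoly 1 * mon (k - 1)"
      by (auto simp add: Gen_f mon_def hpoly_simps)
    then show ?thesis by (metis rel_eq_refl)
  next
    case False
    then have "nat k = Suc (nat (k - 1))" by simp
    with False have "mon k = e * mon (k - 1)" by (simp add: mon_def)
    then have "fgen g * mon k = f * e * mon (k - 1)" by (simp add: Gen_f mult.assoc)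
    then show ?thesis using rel_eq_multr [OF rel_eq_relations(4)] by metis
  qed
next
  case Gen_h
  have "h = hpoly [:0, 1:]" by (simp add: hpoly_simps scal_simps one_pCons [symmetric])
  then show ?thesis unfolding Gen_h by (metis rel_eq_refl)
qed

lemma gen_hpoly: "\<exists>S. rel_eq P (fgen g * hpoly R) (hpoly S * fgen g)"
  using weight_hpoly_commute [OF weight_gen(1), of P R] weight_hpoly_commute [OF weight_gen(2), of P R]
    weight_hpoly_commute [of P h 0 R]
  by (cases g) (auto simp: weight_def scal_simps)

lemma has_normal_form_gen:
  assumes "has_normal_form P x"
  shows "has_normal_form P (fgen g * x)"
proof -
  from assms obtain R where R: "rel_eq P x (normal_form R)"
    unfolding has_normal_form_def by blast
  have "has_normal_form P (fgen g * (hpoly (R k) * mon k))" for k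
  proof -
    obtain S where S: "rel_eq P (fgen g * hpoly (R k)) (hpoly S * fgen g)" using gen_hpoly by blast
    obtain S' j where S': "rel_eq P (fgen g * mon k) (hpoly S' * mon j)" using gen_mon by blast
    have "rel_eq P (fgen g * (hpoly (R k) * mon k)) (hpoly S * (fgen g * mon k))"
      using rel_eq_multr [OF S, of "mon k"] by (simp add: mult.assoc)
    also have "rel_eq P \<dots> (hpoly S * (hpoly S' * mon j))" using S' by (rule rel_eq_multl)
    also have "\<dots> = hpoly (S * S') * mon j" by (simp add: hpoly_simps mult.assoc)
    finally show ?thesis using has_normal_form_cong has_normal_form_single by blast
  qed
  then have "has_normal_form P (fgen g * normal_form R)"
    unfolding normal_form_def sum_distrib_left by (rule has_normal_form_sum)
  then show ?thesis using R rel_eq_multl has_normal_form_cong by blast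
qed

lemma single_Word: "Poly_Mapping.single (Word (g # gs)) c = fgen g * Poly_Mapping.single (Word gs) c"
  by (simp add: fgen_def mult_single plus_free_monoid_def)

text \<open>
  The set of elements with a normal form contains the scalars and is closed under addition and under left
  multiplication by generators: a polynomial in \<open>h\<close> is moved to the left, and \<open>e * f\<close> or \<open>f * e\<close> is replaced by such a
  polynomial.
\<close>

lemma normal_form_exists: "has_normal_form P x"
proof (induction x rule: free_induct)
  case (single w c)
  show ?case
  proof (cases w)
    case (Word gs)
    have "has_normal_form P (Poly_Mapping.single (Word gs) c)"
    proof (induction gs)
      case Nil
      have "Poly_Mapping.single (Word []) c = hpoly [:c:] * mon 0"
        by (simp add: hpoly_simps mon_def scal_def zero_free_monoid_def)
      then show ?case by (metis has_normal_form_single)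
    qed (simp only: single_Word has_normal_form_gen)
    then show ?thesis by (simp only: Word)
  qed
qed (rule has_normal_form_add)

section \<open>Positive traces and unitarizability\<close>

lemma mon_simps: "mon 0 = 1" "mon 1 = e" "mon (- 1) = f" "mon (int k) = e ^ k" "mon (- int k) = f ^ k"
  by (auto simp: mon_def)

lemma weight_hpoly_mon: "weight P (hpoly R * mon k) k"
  using weight_mult [OF weight_hpoly weight_mon] by simp

text \<open>
  The products that occur in the trace property and in the positivity condition of weight one, written
  with a shift by \<open>1\<close> outside.
\<close>

lemma rel_eq_hpoly_ef:
  "rel_eq P (e * (hpoly R * f)) (hpoly (translate (- 1) (translate (- 1) R * P)))"
  "rel_eq P (hpoly R * e * f) (hpoly (translate (- 1) (translate 1 R * P)))"
proof -
  have "rel_eq P (e * hpoly R * f) (hpoly (translate (- 2) R) * e * f)"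
    using rel_eq_multr [OF weight_hpoly_commute [OF weight_gen(1), of P R], of f] by simp
  then have "rel_eq P (e * (hpoly R * f)) (hpoly (translate (- 2) R) * (e * f))"
    by (simp only: mult.assoc)
  also have "rel_eq P \<dots> (hpoly (translate (- 2) R) * hpoly (translate (- 1) P))"
    by (intro rel_eq_multl rel_eq_relations)
  finally show "rel_eq P (e * (hpoly R * f)) (hpoly (translate (- 1) (translate (- 1) R * P)))"
    by (simp add: hpoly_simps(5) pcompose_mult)
  show "rel_eq P (hpoly R * e * f) (hpoly (translate (- 1) (translate 1 R * P)))"
    using rel_eq_multl [OF rel_eq_relations(3), of P "hpoly R"]
    by (simp add: hpoly_simps(5) pcompose_mult mult.assoc)
qed

lemma rel_eq_hpoly_fe:
  "rel_eq P (f * (hpoly R * e)) (hpoly (translate 1 (translate 1 R * P)))"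
  "rel_eq P (hpoly R * f * e) (hpoly (translate 1 (translate (- 1) R * P)))"
proof -
  have "rel_eq P (f * hpoly R * e) (hpoly (translate 2 R) * f * e)"
    using rel_eq_multr [OF weight_hpoly_commute [OF weight_gen(2), of P R], of e] by simp
  then have "rel_eq P (f * (hpoly R * e)) (hpoly (translate 2 R) * (f * e))"
    by (simp only: mult.assoc)
  also have "rel_eq P \<dots> (hpoly (translate 2 R) * hpoly (translate 1 P))"
    by (intro rel_eq_multl rel_eq_relations)
  finally show "rel_eq P (f * (hpoly R * e)) (hpoly (translate 1 (translate 1 R * P)))"
    by (simp add: hpoly_simps(5) pcompose_mult)
  show "rel_eq P (hpoly R * f * e) (hpoly (translate 1 (translate (- 1) R * P)))"
    using rel_eq_multl [OF rel_eq_relations(4), of P "hpoly R"]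
    by (simp add: hpoly_simps(5) pcompose_mult mult.assoc)
qed

lemma rel_eq_square_weight_one:
  fixes R defines "u \<equiv> hpoly R * e"
  shows "rel_eq P (u * free_conj u) (- hpoly (translate (- 1) (translate 1 R * star (translate 1 R) * P)))"
proof -
  have "u * free_conj u = - (hpoly R * (e * (hpoly (star R) * f)))"
    by (simp add: u_def free_conj_mult free_conj_hpoly free_conj_fgen mult.assoc)
  also have "rel_eq P \<dots> (- (hpoly R * hpoly (translate (- 1) (translate (- 1) (star R) * P))))"
    by (intro rel_eq_uminus rel_eq_multl rel_eq_hpoly_ef)
  also have "hpoly R * hpoly (translate (- 1) (translate (- 1) (star R) * P))
      = hpoly (translate (- 1) (translate 1 R * star (translate 1 R) * P))"
    by (simp add: pcompose_mult mult.assoc flip: hpoly_simps(5))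
  finally show ?thesis .
qed

text \<open>
  The functional \<open>\<tau>\<close> is the restriction of a trace to polynomials in \<open>h\<close>. The condition \<open>shift\<close> is the trace
  property, \<open>star\<close> the Hermitian symmetry, and \<open>pos\<close>, \<open>pos_shift\<close> are positivity of the form on the
  components of weight zero and one.
\<close>

locale positive_trace =
  fixes P :: "complex poly" and \<tau> :: "complex poly \<Rightarrow> complex"
  assumes real_ix: "P \<in> real_ix_polys"
    and nonzero: "P \<noteq> 0"
    and add: "\<tau> (R + S) = \<tau> R + \<tau> S"
    and smult: "\<tau> (Polynomial.smult c R) = c * \<tau> R"
    and shift: "\<tau> (translate (- 1) (S * P)) = \<tau> (translate 1 (S * P))"
    and star: "\<tau> (star R) = cnj (\<tau> R)"
    and pos: "R \<noteq> 0 \<Longrightarrow> Re (\<tau> (R * star R)) > 0"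
    and pos_shift: "R \<noteq> 0 \<Longrightarrow> Re (\<tau> (translate (- 1) (R * star R * P))) < 0"
begin

definition tr :: "free_alg \<Rightarrow> complex" where "tr x = \<tau> (weight_zero_part P x)"

lemma tau_0: "\<tau> 0 = 0" using smult [of 0 0] by simp

lemma tr_add: "tr (x + y) = tr x + tr y"
  by (simp add: tr_def weight_zero_part_add add)

lemma tr_scal: "tr (scal c * x) = c * tr x"
  by (simp add: tr_def weight_zero_part_scal smult)

lemma tr_0: "tr 0 = 0" using tr_scal [of 0 0] by simp

lemma tr_uminus: "tr (- x) = - tr x"
  using tr_scal [of "- 1" x] by (simp add: scal_simps)

lemma tr_sum: "tr (sum g S) = (\<Sum>i\<in>S. tr (g i))"
  by (induction S rule: infinite_finite_induct) (simp_all add: tr_add tr_0)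

lemma tr_cong: "rel_eq P x y \<Longrightarrow> tr x = tr y"
  by (simp add: tr_def weight_zero_part_cong)

lemma tr_hpoly: "tr (hpoly R) = \<tau> R"
  by (simp add: tr_def weight_zero_part_hpoly)

lemma tr_weight: "weight P x k \<Longrightarrow> k \<noteq> 0 \<Longrightarrow> tr x = 0"
  by (simp add: tr_def weight_zero_part_weight tau_0)

lemma normal_form_obtain:
  obtains R where "finite {k. R k \<noteq> 0}" "rel_eq P x (\<Sum>k | R k \<noteq> 0. hpoly (R k) * mon k)"
  using normal_form_exists [of P x] unfolding has_normal_form_def normal_form_def by blast

text \<open>
  On normal forms both sides vanish for reasons of weight, except when the generator and the monomial
  have opposite weights; then the claim is the condition \<open>shift\<close>. For \<open>h\<close> it is \<open>weight_zero_part_h_commute\<close>.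
\<close>

lemma tr_gen_commute: "tr (fgen g * x) = tr (x * fgen g)"
proof -
  have base: "tr (fgen g * (hpoly R * mon k)) = tr (hpoly R * mon k * fgen g)" for R k
  proof (cases g)
    case Gen_e
    show ?thesis
    proof (cases "k = - 1")
      case True
      then show ?thesis
        using tr_cong [OF rel_eq_hpoly_ef(1) [of P R]] tr_cong [OF rel_eq_hpoly_fe(2) [of P R]]
          shift [of "translate (- 1) R"] by (simp add: Gen_e mon_simps tr_hpoly)
    next
      case False
      then show ?thesis
        using tr_weight [OF weight_mult [OF weight_gen(1) weight_hpoly_mon [of P R k]]]
          tr_weight [OF weight_mult [OF weight_hpoly_mon [of P R k] weight_gen(1)]] by (simp add: Gen_e)
    qed
  next
    case Gen_f
    show ?thesis
    proof (cases "k = 1")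
      case True
      then show ?thesis
        using tr_cong [OF rel_eq_hpoly_fe(1) [of P R]] tr_cong [OF rel_eq_hpoly_ef(2) [of P R]]
          shift [of "translate 1 R"] by (simp add: Gen_f mon_simps tr_hpoly)
    next
      case False
      then show ?thesis
        using tr_weight [OF weight_mult [OF weight_gen(2) weight_hpoly_mon [of P R k]]]
          tr_weight [OF weight_mult [OF weight_hpoly_mon [of P R k] weight_gen(2)]] by (simp add: Gen_f)
    qed
  next
    case Gen_h
    then show ?thesis by (simp add: tr_def weight_zero_part_h_commute)
  qed
  obtain R where R: "rel_eq P x (\<Sum>k | R k \<noteq> 0. hpoly (R k) * mon k)" by (rule normal_form_obtain)
  show ?thesis
    by (simp only: tr_cong [OF rel_eq_multl [OF R]] tr_cong [OF rel_eq_multr [OF R]]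
        sum_distrib_left sum_distrib_right tr_sum base)
qed

lemma tr_commute: "tr (x * y) = tr (y * x)"
proof (induction y arbitrary: x rule: free_induct)
  case (single w c)
  obtain gs where w: "w = Word gs" by (cases w)
  have "tr (x * Poly_Mapping.single (Word gs) c) = tr (Poly_Mapping.single (Word gs) c * x)"
  proof (induction gs arbitrary: x)
    case Nil
    have "Poly_Mapping.single (Word []) c = scal c" by (simp add: scal_def zero_free_monoid_def)
    then show ?case by (simp add: scal_central)
  next
    case (Cons g gs)
    let ?y = "Poly_Mapping.single (Word gs) c"
    have "tr (x * (fgen g * ?y)) = tr (?y * (x * fgen g))"
      using Cons [of "x * fgen g"] by (simp add: mult.assoc)
    also have "\<dots> = tr (fgen g * ?y * x)"
      using tr_gen_commute [of g "?y * x"] by (simp add: mult.assoc)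
    finally show ?case by (simp only: single_Word)
  qed
  then show ?case by (simp only: w)
qed (simp add: distrib_left distrib_right tr_add)

lemma tr_free_conj: "tr (free_conj x) = cnj (tr x)"
proof -
  have base: "tr (free_conj (hpoly R * mon k)) = cnj (tr (hpoly R * mon k))" for R k
  proof (cases "k = 0")
    case True
    then show ?thesis by (simp add: mon_simps free_conj_hpoly tr_hpoly star)
  next
    case False
    then show ?thesis
      using tr_weight [OF weight_hpoly_mon [of P R k]]
        tr_weight [OF weight_free_conj [OF real_ix weight_hpoly_mon [of P R k]]] by simp
  qed
  obtain R where R: "rel_eq P x (\<Sum>k | R k \<noteq> 0. hpoly (R k) * mon k)" by (rule normal_form_obtain)
  show ?thesis
    by (simp only: tr_cong [OF rel_eq_free_conj [OF real_ix R]] tr_cong [OF R] free_conj_sum tr_sum base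
        cnj_sum)
qed

text \<open>
  Write \<open>u = e * v * e\<close>. Then \<open>conj u = f * conj v * f\<close>, and moving the leading \<open>e\<close> round the trace gives
  \<open>tr (u * conj u) = tr (v * (e * f) * conj v * (f * e))\<close>. As \<open>e * f = P (h - 1)\<close> and \<open>f * e = P (h + 1)\<close> are
  exchanged by the conjugation, this equals \<open>tr (y * conj y)\<close> with \<open>y = v * P (h - 1)\<close>, and the exponent of
  \<open>e\<close> has dropped by two.
\<close>

lemma tr_square_pos_nat:
  assumes "R \<noteq> 0"
  shows "Re (tr (hpoly R * e ^ k * free_conj (hpoly R * e ^ k))) > 0"
  using assms
proof (induction k arbitrary: R rule: induct_nat_012)
  case 0
  then show ?case by (simp add: free_conj_hpoly tr_hpoly pos flip: hpoly_simps(5))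
next
  case 1
  then show ?case
    using tr_cong [OF rel_eq_square_weight_one [of P R]] pos_shift [of "translate 1 R"]
    by (simp add: tr_uminus tr_hpoly)
next
  case (ge2 k)
  define v where "v = hpoly (translate 2 R) * e ^ k"
  define y where "y = v * hpoly (translate (- 1) P)"
  define S where "S = translate 2 R * translate (- 2 * of_int (int k)) (translate (- 1) P)"
  have "hpoly R * e ^ Suc (Suc k) = hpoly R * e * (e ^ k * e)"
    by (simp add: mult.assoc power_commutes)
  also have "rel_eq P \<dots> (e * hpoly (translate 2 R) * (e ^ k * e))"
    using rel_eq_multr [OF hpoly_weight_commute [OF weight_gen(1), of P R], of "e ^ k * e"] by simp
  also have "\<dots> = e * v * e" by (simp add: v_def mult.assoc)
  finally have u: "rel_eq P (hpoly R * e ^ Suc (Suc k)) (e * v * e)" .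
  have "tr (hpoly R * e ^ Suc (Suc k) * free_conj (hpoly R * e ^ Suc (Suc k)))
      = tr (e * v * e * free_conj (e * v * e))"
    by (intro tr_cong rel_eq_mult u rel_eq_free_conj [OF real_ix])
  also have "\<dots> = tr (e * (v * (e * f) * free_conj v * f))"
    by (simp add: free_conj_mult free_conj_fgen mult.assoc)
  also have "\<dots> = tr (v * (e * f) * free_conj v * (f * e))"
    by (subst tr_commute) (simp add: mult.assoc)
  also have "\<dots> = tr (v * hpoly (translate (- 1) P) * free_conj v * hpoly (translate 1 P))"
    by (intro tr_cong rel_eq_mult rel_eq_relations rel_eq_refl)
  also have "\<dots> = tr (y * free_conj y)"
    by (simp add: y_def free_conj_mult free_conj_hpoly star_real_ix [OF real_ix] mult.assoc)
  also have "rel_eq P y (hpoly S * e ^ k)"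
    using rel_eq_multl [OF weight_hpoly_commute [OF weight_mon, of P "int k" "translate (- 1) P"],
        of "hpoly (translate 2 R)"]
    by (simp add: y_def v_def S_def mon_simps mult.assoc hpoly_simps(5))
  then have "tr (y * free_conj y) = tr (hpoly S * e ^ k * free_conj (hpoly S * e ^ k))"
    by (intro tr_cong rel_eq_mult rel_eq_free_conj [OF real_ix])
  finally show ?case using ge2 nonzero by (simp add: S_def)
qed

text \<open>
  For negative \<open>k\<close> the conjugate has positive weight, and \<open>tr (u * conj u) = tr (conj u * u)\<close>.
\<close>

lemma tr_square_pos_homogeneous:
  assumes "R \<noteq> 0"
  shows "Re (tr (hpoly R * mon k * free_conj (hpoly R * mon k))) > 0"
proof (cases "k \<ge> 0")
  case True
  then show ?thesis using tr_square_pos_nat [OF assms, of "nat k"] by (simp add: mon_def)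
next
  case False
  define u where "u = hpoly R * mon k"
  define n where "n = nat (- k)"
  have "free_conj u = hpoly (star R) * (scal (- 1) * e) ^ n"
    using False by (simp add: u_def n_def mon_def free_conj_mult free_conj_hpoly free_conj_power
        free_conj_fgen scal_simps)
  also have "(scal (- 1) * e) ^ n = scal ((- 1) ^ n) * e ^ n"
    by (induction n) (simp_all add: scal_simps mult.assoc power_commutes scal_left)
  also have "hpoly (star R) * \<dots> = hpoly (Polynomial.smult ((- 1) ^ n) (star R)) * e ^ n"
    by (simp add: hpoly_simps(6) scal_left mult.assoc)
  finally have u': "free_conj u = \<dots>" .
  have "Re (tr (free_conj u * free_conj (free_conj u))) > 0"
    unfolding u' using assms by (intro tr_square_pos_nat) simp
  then have "Re (tr (u * free_conj u)) > 0" by (simp add: free_conj_free_conj tr_commute)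
  then show ?thesis by (simp only: u_def)
qed

text \<open>
  Components of different weights are orthogonal, so the normal form reduces the claim to homogeneous
  elements. An element that is not zero in the quotient has at least one nonzero coefficient there.
\<close>

lemma tr_square_pos:
  assumes "\<not> rel_eq P x 0"
  shows "Re (tr (x * free_conj x)) > 0"
proof -
  obtain R where fin: "finite {k. R k \<noteq> 0}" and R: "rel_eq P x (\<Sum>k | R k \<noteq> 0. hpoly (R k) * mon k)"
    by (rule normal_form_obtain)
  let ?K = "{k. R k \<noteq> 0}"
  define u where "u k = hpoly (R k) * mon k" for k
  have R: "rel_eq P x (sum u ?K)" using R by (simp add: u_def)
  have "?K \<noteq> {}" using R assms by (metis sum.empty)
  have zero: "tr (u j * free_conj (u k)) = 0" if "j \<noteq> k" for j k
    using that tr_weight [OF weight_mult [OF weight_hpoly_mon weight_free_conj [OF real_ix weight_hpoly_mon]]]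
    by (simp add: u_def)
  have "tr (x * free_conj x) = tr (sum u ?K * free_conj (sum u ?K))"
    by (intro tr_cong rel_eq_mult rel_eq_free_conj [OF real_ix] R)
  also have "\<dots> = (\<Sum>j\<in>?K. \<Sum>k\<in>?K. tr (u j * free_conj (u k)))"
    by (simp only: free_conj_sum sum_product tr_sum)
  also have "\<dots> = (\<Sum>j\<in>?K. tr (u j * free_conj (u j)))"
  proof (rule sum.cong [OF refl])
    fix j assume "j \<in> ?K"
    have "(\<Sum>k\<in>?K. tr (u j * free_conj (u k))) = (\<Sum>k\<in>{j}. tr (u j * free_conj (u k)))"
      using fin zero \<open>j \<in> ?K\<close> by (intro sum.mono_neutral_right) auto
    then show "(\<Sum>k\<in>?K. tr (u j * free_conj (u k))) = tr (u j * free_conj (u j))" by simp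
  qed
  finally have "Re (tr (x * free_conj x)) = (\<Sum>j\<in>?K. Re (tr (u j * free_conj (u j))))" by simp
  also have "\<dots> > 0"
    using fin \<open>?K \<noteq> {}\<close> by (intro sum_pos) (auto simp: u_def intro: tr_square_pos_homogeneous)
  finally show ?thesis .
qed

lemma unitarizable: "regular_unitarizable P"
proof -
  define rep where "rep u = (SOME x. u = cls P x)" for u
  have rep: "rel_eq P (rep (cls P x)) x" for x
    unfolding rep_def cls_eq_iff [symmetric] by (rule someI2 [of _ x]) auto
  define B where "B u v = tr (rep u * free_conj (rep v))" for u v
  have B: "B (cls P x) (cls P y) = tr (x * free_conj y)" for x y
    unfolding B_def by (intro tr_cong rel_eq_mult rel_eq_free_conj [OF real_ix] rep)
  have herm: "tr (y * free_conj x) = cnj (tr (x * free_conj y))" for x y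
    using tr_free_conj [of "x * free_conj y"] by (simp add: free_conj_mult free_conj_free_conj tr_commute)
  have real: "tr (x * free_conj x) \<in> \<real>" for x
    using herm [of x x] by (simp add: Reals_cnj_iff)
  have "pos_def_hermitian P B"
    unfolding pos_def_hermitian_def Let_def carrier_deformation
    by (auto simp: deformation_simps B Defs.scale_def distrib_right tr_add mult.assoc tr_scal real cls_eq_iff
        intro: tr_square_pos herm)
  moreover have "tr (x * y * free_conj z) = tr (y * free_conj (z * free_conj x))" for x y z
    using tr_commute [of x "y * free_conj z"] by (simp add: free_conj_mult free_conj_free_conj mult.assoc)
  moreover have "tr (y * x * free_conj z) = tr (y * free_conj (free_conj x * z))" for x y z
    by (simp add: free_conj_mult free_conj_free_conj mult.assoc)
  ultimately show ?thesis
    unfolding regular_unitarizable_def Let_def carrier_deformation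
    by (intro exI [of _ B]) (auto simp: deformation_simps alg_conj_cls [OF real_ix] B)
qed

end

text \<open>
  The functional is \<open>R \<mapsto> (R (h), 1)\<close>. Strict positivity in weight zero needs \<open>R (h)\<close> to be nonzero in the
  quotient, which the polynomial representation shows.
\<close>

lemma trace_of_unitarizable:
  assumes P: "P \<in> real_ix_polys" and "regular_unitarizable P"
  obtains \<tau> :: "complex poly \<Rightarrow> complex" where
    "\<And>R S. \<tau> (R + S) = \<tau> R + \<tau> S"
    "\<And>S. \<tau> (translate (- 1) (S * P)) = \<tau> (translate 1 (S * P))"
    "\<And>R. R \<noteq> 0 \<Longrightarrow> Re (\<tau> (R * star R)) > 0"
    "\<And>R. Re (\<tau> (translate (- 1) (R * star R * P))) \<le> 0"
proof -
  from assms(2) obtain B where herm: "pos_def_hermitian P B" and inv: "\<forall>a\<in>carrier (deformation P).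
      \<forall>u\<in>carrier (deformation P). \<forall>v\<in>carrier (deformation P).
        B (a \<otimes>\<^bsub>deformation P\<^esub> u) v = B u (v \<otimes>\<^bsub>deformation P\<^esub> alg_conj a) \<and>
        B (u \<otimes>\<^bsub>deformation P\<^esub> a) v = B u (alg_conj a \<otimes>\<^bsub>deformation P\<^esub> v)"
    unfolding regular_unitarizable_def Let_def by blast
  define T where "T x = B (cls P x) (cls P 1)" for x
  have inv: "B (cls P (x * y)) (cls P z) = B (cls P y) (cls P (z * free_conj x))"
    "B (cls P (y * x)) (cls P z) = B (cls P y) (cls P (free_conj x * z))" for x y z
    using inv [rule_format, of "cls P x" "cls P y" "cls P z"]
    by (auto simp: carrier_deformation deformation_simps alg_conj_cls [OF P])
  have T_add: "T (x + y) = T x + T y" for x y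
    using herm unfolding pos_def_hermitian_def Let_def carrier_deformation T_def
    by (metis deformation_simps(1) rangeI)
  have T_uminus: "T (- x) = - T x" for x
    using T_add [of 0 0] T_add [of x "- x"] by (simp add: eq_neg_iff_add_eq_0 add.commute)
  have T_cong: "rel_eq P x y \<Longrightarrow> T x = T y" for x y
    by (simp add: T_def flip: cls_eq_iff)
  have T_commute: "T (x * y) = T (y * x)" for x y
    using inv(1) [where x = x and y = y and z = 1] inv(2) [where x = x and y = y and z = 1]
    by (simp add: T_def)
  have T_square: "T (x * free_conj x) = B (cls P x) (cls P x)" for x
    using inv(2) [where x = "free_conj x" and y = x and z = 1] by (simp add: T_def free_conj_free_conj)
  have B_pos: "Re (B u u) > 0" if "u \<in> carrier (deformation P)" "u \<noteq> \<zero>\<^bsub>deformation P\<^esub>" for u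
    using herm that unfolding pos_def_hermitian_def Let_def by blast
  have T_pos: "Re (T (x * free_conj x)) > 0" if "\<not> rel_eq P x 0" for x
    unfolding T_square using that
    by (intro B_pos) (auto simp: carrier_deformation deformation_simps cls_eq_iff)
  have T_nonneg: "Re (T (x * free_conj x)) \<ge> 0" for x
  proof (cases "rel_eq P x 0")
    case True
    then have "T (x * free_conj x) = T 0" using T_cong [OF rel_eq_multr] by fastforce
    then show ?thesis using T_uminus [of 0] by simp
  qed (use T_pos in force)
  show thesis
  proof (rule that [of "\<lambda>R. T (hpoly R)"])
    show "T (hpoly (R + S)) = T (hpoly R) + T (hpoly S)" for R S
      by (simp add: hpoly_simps T_add)
    show "T (hpoly (translate (- 1) (S * P))) = T (hpoly (translate 1 (S * P)))" for S
      using T_cong [OF rel_eq_hpoly_ef(1) [of P "translate 1 S"]]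
        T_cong [OF rel_eq_hpoly_fe(2) [of P "translate 1 S"]] T_commute [of e "hpoly (translate 1 S) * f"]
      by simp
    show "Re (T (hpoly (R * star R))) > 0" if "R \<noteq> 0" for R
    proof -
      have "\<not> rel_eq P (hpoly R) 0"
      proof
        assume "rel_eq P (hpoly R) 0"
        then have "weight_zero_part P (hpoly R) = weight_zero_part P (hpoly 0)" by (simp add: weight_zero_part_cong hpoly_simps(2))
        with that show False by (simp only: weight_zero_part_hpoly)
      qed
      from T_pos [OF this] show ?thesis by (simp add: free_conj_hpoly hpoly_simps)
    qed
    show "Re (T (hpoly (translate (- 1) (R * star R * P)))) \<le> 0" for R
      using T_nonneg [of "hpoly (translate (- 1) R) * e"]
        T_cong [OF rel_eq_square_weight_one [of P "translate (- 1) R"]]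
      by (simp add: T_uminus)
  qed
qed

section \<open>Polynomials with values in a narrow cone on a vertical line\<close>

text \<open>
  The argument \<open>\<phi>\<close> is not normalised, so that the bounds simply add up in products.
\<close>

definition in_cone :: "real \<Rightarrow> complex \<Rightarrow> bool" where
  "in_cone \<theta> z \<longleftrightarrow> (\<exists>\<phi>. \<bar>\<phi>\<bar> \<le> \<theta> \<and> z = of_real (cmod z) * cis \<phi>)"

lemma in_cone_mult: "in_cone \<theta> z \<Longrightarrow> in_cone \<theta>' w \<Longrightarrow> in_cone (\<theta> + \<theta>') (z * w)"
  unfolding in_cone_def
proof (elim exE conjE)
  fix \<phi> \<phi>' assume "\<bar>\<phi>\<bar> \<le> \<theta>" "\<bar>\<phi>'\<bar> \<le> \<theta>'"
    and z: "z = of_real (cmod z) * cis \<phi>" and w: "w = of_real (cmod w) * cis \<phi>'"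
  have "z * w = of_real (cmod (z * w)) * cis (\<phi> + \<phi>')"
    by (subst z, subst w) (simp add: norm_mult cis_mult [symmetric])
  with \<open>\<bar>\<phi>\<bar> \<le> \<theta>\<close> \<open>\<bar>\<phi>'\<bar> \<le> \<theta>'\<close>
  show "\<exists>\<phi>''. \<bar>\<phi>''\<bar> \<le> \<theta> + \<theta>' \<and> z * w = of_real (cmod (z * w)) * cis \<phi>''"
    by (intro exI [of _ "\<phi> + \<phi>'"]) linarith
qed

lemma in_cone_mono: "in_cone \<theta> z \<Longrightarrow> \<theta> \<le> \<theta>' \<Longrightarrow> in_cone \<theta>' z"
  unfolding in_cone_def by force

lemma in_cone_1: "in_cone 0 1"
  by (simp add: in_cone_def)

lemma in_cone_power: "in_cone \<theta> z \<Longrightarrow> in_cone (real n * \<theta>) (z ^ n)"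
proof (induction n)
  case (Suc n)
  from in_cone_mult [OF Suc(2) Suc(1) [OF Suc(2)]] show ?case by (simp add: algebra_simps)
qed (simp add: in_cone_1)

lemma in_cone_prod: "(\<And>i. i \<in> S \<Longrightarrow> in_cone (\<theta> i) (g i)) \<Longrightarrow> in_cone (sum \<theta> S) (prod g S)"
  by (induction S rule: infinite_finite_induct) (auto simp: in_cone_1 intro: in_cone_mult)

lemma in_cone_Re_pos:
  assumes "in_cone \<theta> z" "\<theta> < pi / 2" "z \<noteq> 0"
  shows "Re z > 0"
proof -
  obtain \<phi> where \<phi>: "\<bar>\<phi>\<bar> \<le> \<theta>" and z: "z = of_real (cmod z) * cis \<phi>"
    using assms(1) unfolding in_cone_def by blast
  have "cos \<phi> > 0" using \<phi> assms(2) by (intro cos_gt_zero_pi) auto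
  moreover have "Re z = cmod z * cos \<phi>" by (subst z) simp
  ultimately show ?thesis using assms(3) by simp
qed

lemma in_cone_tan:
  assumes "Re z > 0" "\<bar>Im z\<bar> \<le> \<theta> * Re z"
  shows "in_cone \<theta> z"
  unfolding in_cone_def
proof (intro exI [of _ "arctan (Im z / Re z)"] conjI)
  have "\<bar>arctan (Im z / Re z)\<bar> \<le> \<bar>Im z / Re z\<bar>" by (rule abs_arctan_le)
  also have "\<dots> \<le> \<theta>" using assms by (simp add: abs_divide divide_le_eq)
  finally show "\<bar>arctan (Im z / Re z)\<bar> \<le> \<theta>" .
  have "cmod z = Re z * sqrt (1 + (Im z / Re z)\<^sup>2)"
  proof -
    have "1 + (Im z / Re z)\<^sup>2 = ((Re z)\<^sup>2 + (Im z)\<^sup>2) / (Re z)\<^sup>2"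
      using assms by (simp add: field_simps)
    then show ?thesis using assms by (simp add: cmod_def real_sqrt_divide)
  qed
  moreover have "sqrt (1 + (Im z / Re z)\<^sup>2) > 0" by (simp add: add_pos_nonneg)
  ultimately show "z = of_real (cmod z) * cis (arctan (Im z / Re z))"
    using assms by (simp add: complex_eq_iff cos_arctan sin_arctan)
qed

text \<open>
  Each summand is at most six times \<open>K (2 * x) - K x\<close> with \<open>K x = x / (1 + x)\<close>, where \<open>x\<close> is the current
  dyadic fraction of \<open>y\<close>, and these differences telescope. The point is that the bound does not depend on the
  number of terms.
\<close>

lemma sum_dyadic_bound:
  fixes y :: real
  assumes "y \<ge> 0"
  shows "(\<Sum>j<J. (y / 2 ^ j) / (3 / 4 + (y / 2 ^ j)\<^sup>2)) \<le> 6"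
proof -
  define K where "K x = x / (1 + x)" for x :: real
  have bound: "x / (3 / 4 + x\<^sup>2) \<le> 6 * (K (2 * x) - K x)" if "x \<ge> 0" for x
  proof -
    have "0 \<le> 4 * (x - 3 / 8)\<^sup>2" by simp
    then have le: "(1 + 2 * x) * (1 + x) \<le> 6 * (3 / 4 + x\<^sup>2)" by (simp add: power2_eq_square algebra_simps)
    have "K (2 * x) - K x = x / ((1 + 2 * x) * (1 + x))"
      using that by (simp add: K_def divide_simps) (simp add: algebra_simps)
    moreover have "x / (3 / 4 + x\<^sup>2) = 6 * x / (6 * (3 / 4 + x\<^sup>2))"
      by (rule mult_divide_mult_cancel_left [symmetric]) simp
    moreover have "\<dots> \<le> 6 * x / ((1 + 2 * x) * (1 + x))"
      using le that by (intro divide_left_mono) (auto intro!: mult_pos_pos add_pos_nonneg)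
    ultimately show ?thesis by simp
  qed
  have "(\<Sum>j<J. (y / 2 ^ j) / (3 / 4 + (y / 2 ^ j)\<^sup>2))
      \<le> (\<Sum>j<J. 6 * (K (2 * (y / 2 ^ j)) - K (y / 2 ^ j)))"
    using assms by (intro sum_mono bound) simp
  also have "\<dots> = 6 * (K (2 * y) - K (2 * y / 2 ^ J))"
    by (induction J) (simp_all add: algebra_simps)
  also have "\<dots> \<le> 6"
  proof -
    have "K (2 * y) \<le> 1" using assms by (simp add: K_def divide_le_eq)
    moreover have "K (2 * y / 2 ^ J) \<ge> 0" using assms by (simp add: K_def)
    ultimately show ?thesis by simp
  qed
  finally show ?thesis .
qed

text \<open>
  With \<open>s j = c / 2 ^ j\<close> and \<open>M j = 2 ^ j\<close>, put \<open>G x = (\<Prod>j<J. (1 - (s j * x)\<^sup>2) ^ M j)\<close> and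
  \<open>A x = (\<Prod>j<J. (1 - s j * x) ^ (2 * M j))\<close>, and take \<open>q = G - \<kappa> * (A x + A (- x))\<close>. The quotient
  \<open>Z = A (- x) / G\<close> satisfies \<open>A x / G = 1 / Z\<close>, and each of its factors
  \<open>((1 + s j * x) / (1 - s j * x)) ^ M j\<close> is close to \<open>exp (2 * c * x)\<close> near the origin; so \<open>q / G\<close> behaves like
  \<open>1 - 2 * \<kappa> * cosh (2 * c * J * x)\<close>. The value of \<open>\<kappa>\<close> makes this vanish at \<open>a\<close>. On \<open>Re x = 1\<close>
  the modulus of \<open>Z\<close> is at most its value \<open>E1\<close> at \<open>1\<close>, which is smaller than the value \<open>Ea\<close> at \<open>a\<close> by a factor
  growing geometrically in \<open>J\<close>, so \<open>q / G\<close> is within \<open>\<delta>\<close> of \<open>1\<close>. The argument of \<open>G\<close> is controlled by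
  \<open>sum_dyadic_bound\<close> uniformly in \<open>J\<close>, because \<open>M j * s j = c\<close>.
\<close>

lemma cone_polynomial_real_root:
  fixes a c \<delta> :: real
  assumes a: "a > 1" and c: "c > 0" "c \<le> 1 / 2" "c * a < 1" and \<delta>: "\<delta> > 0" "\<delta> \<le> 1 / 2"
  shows "\<exists>q. poly q (of_real a) = 0 \<and> poly q (- of_real a) = 0 \<and>
    (\<forall>t. poly q (\<i> * of_real t) \<in> \<real> \<and> Re (poly q (\<i> * of_real t)) > 0) \<and>
    (\<forall>t. poly q (1 + \<i> * of_real t) \<noteq> 0 \<and> in_cone (12 * c + 2 * \<delta>) (poly q (1 + \<i> * of_real t)))"
proof -
  \<comment> \<open>Each scale makes the ratio of the values of \<open>Z\<close> at \<open>a\<close> and at \<open>1\<close> larger by the factor \<open>1 + 2 * c * (a - 1)\<close>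
    or more, see \<open>EaE1\<close>.\<close>
  obtain J :: nat where J: "2 / \<delta> < (1 + 2 * c * (a - 1)) ^ J"
    using real_arch_pow [of "1 + 2 * c * (a - 1)" "2 / \<delta>"] a c by auto
  define s where "s j = c / 2 ^ j" for j :: nat
  define M where "M j = (2 ^ j :: nat)" for j :: nat
  have s: "s j > 0" "s j \<le> c" "real (M j) * s j = c" for j
    using c by (simp_all add: s_def M_def divide_le_eq)
  have s1: "s j \<le> 1 / 2" "s j < 1" "s j * a < 1" for j
  proof -
    show "s j \<le> 1 / 2" "s j < 1" using s(2) [of j] c by linarith+
    have "s j * a \<le> c * a" using s(2) [of j] a by (intro mult_right_mono) auto
    then show "s j * a < 1" using c by linarith
  qed
  define E1 where "E1 = (\<Prod>j<J. ((1 + s j) / (1 - s j)) ^ M j)"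
  define Ea where "Ea = (\<Prod>j<J. ((1 + s j * a) / (1 - s j * a)) ^ M j)"
  have E1: "E1 \<ge> 1"
    unfolding E1_def
  proof (intro prod_ge_1 one_le_power)
    fix j show "1 \<le> (1 + s j) / (1 - s j)" using s(1) [of j] s1(2) [of j] by (simp add: le_divide_eq)
  qed
  have EaE1: "(1 + 2 * c * (a - 1)) ^ J * E1 \<le> Ea"
  proof -
    have "(1 + 2 * c * (a - 1)) * ((1 + s j) / (1 - s j)) ^ M j \<le> ((1 + s j * a) / (1 - s j * a)) ^ M j" for j
    proof -
      have pos: "s j > 0" "1 - s j > 0" "1 - s j * a > 0" "a - 1 > 0" using s(1) [of j] s1 [of j] a by auto
      \<comment> \<open>The factor for one scale gains \<open>1 + 2 * s j * (a - 1)\<close> before it is raised to the power \<open>M j\<close>; Bernoulli's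
          inequality turns the power into \<open>1 + 2 * c * (a - 1)\<close>.\<close>
      have "(1 + s j * a) * (1 - s j) - (1 + 2 * s j * (a - 1)) * ((1 + s j) * (1 - s j * a))
          = 2 * s j * (a - 1) * (1 - (1 + s j) * (1 - s j * a))" by (simp add: algebra_simps)
      moreover have "1 - (1 + s j) * (1 - s j * a) = s j * (a - 1) + s j * s j * a" by (simp add: algebra_simps)
      moreover have "\<dots> \<ge> 0" using pos a by (intro add_nonneg_nonneg mult_nonneg_nonneg) auto
      ultimately have "(1 + 2 * s j * (a - 1)) * ((1 + s j) * (1 - s j * a)) \<le> (1 + s j * a) * (1 - s j)"
        using pos by (smt (verit) mult_nonneg_nonneg)
      then have le: "(1 + 2 * s j * (a - 1)) * ((1 + s j) / (1 - s j)) \<le> (1 + s j * a) / (1 - s j * a)"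
        using pos by (simp add: field_simps)
      have "1 + 2 * c * (a - 1) = 1 + real (M j) * (2 * s j * (a - 1))"
        by (simp add: s(3) [of j, symmetric])
      also have "\<dots> \<le> (1 + 2 * s j * (a - 1)) ^ M j"
        using pos by (intro Bernoulli_inequality) (smt (verit) mult_nonneg_nonneg)
      finally have "(1 + 2 * c * (a - 1)) * ((1 + s j) / (1 - s j)) ^ M j
          \<le> (1 + 2 * s j * (a - 1)) ^ M j * ((1 + s j) / (1 - s j)) ^ M j"
        using pos by (intro mult_right_mono) auto
      also have "\<dots> = ((1 + 2 * s j * (a - 1)) * ((1 + s j) / (1 - s j))) ^ M j"
        by (simp only: power_mult_distrib)
      also have "\<dots> \<le> ((1 + s j * a) / (1 - s j * a)) ^ M j"
        using pos by (intro power_mono le) (simp add: mult_nonneg_nonneg)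
      finally show ?thesis .
    qed
    then have "(\<Prod>j<J. (1 + 2 * c * (a - 1)) * ((1 + s j) / (1 - s j)) ^ M j) \<le> Ea"
      unfolding Ea_def using a c s(1) s1(2)
      by (intro prod_mono conjI mult_nonneg_nonneg zero_le_power) (auto simp: less_imp_le)
    then show ?thesis by (simp add: E1_def prod.distrib)
  qed
  have pw: "(1 + 2 * c * (a - 1)) ^ J > 0" using a c by (intro zero_less_power) (smt (verit) mult_nonneg_nonneg)
  have Ea: "Ea > 0" using EaE1 E1 pw by (smt (verit) mult_pos_pos)
  define \<kappa> where "\<kappa> = 1 / (Ea + 1 / Ea)"
  have \<kappa>0: "\<kappa> > 0" using Ea by (simp add: \<kappa>_def add_pos_pos)
  have \<kappa>: "\<kappa> * (1 + E1) \<le> \<delta>"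
  proof -
    have "\<kappa> \<le> 1 / Ea" unfolding \<kappa>_def using Ea by (intro divide_left_mono) (auto intro!: mult_pos_pos add_pos_pos)
    then have "\<kappa> * (1 + E1) \<le> (1 / Ea) * (2 * E1)" using E1 Ea by (intro mult_mono) auto
    also have "\<dots> \<le> \<delta>"
    proof -
      have "2 * E1 \<le> \<delta> * ((1 + 2 * c * (a - 1)) ^ J * E1)"
        using J \<delta> E1 by (simp add: divide_less_eq mult.commute)
      also have "\<dots> \<le> \<delta> * Ea" using EaE1 \<delta> by (intro mult_left_mono) auto
      finally show ?thesis using Ea by (simp add: field_simps)
    qed
    finally show ?thesis .
  qed
  define G where "G x = (\<Prod>j<J. ((1 - of_real (s j) * x) * (1 + of_real (s j) * x)) ^ M j)" for x :: complex
  define A where "A x = (\<Prod>j<J. (1 - of_real (s j) * x) ^ (2 * M j))" for x :: complex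
  define q :: "complex poly" where "q = (\<Prod>j<J. ([:1, - of_real (s j):] * [:1, of_real (s j):]) ^ M j)
    - Polynomial.smult (of_real \<kappa>) ((\<Prod>j<J. [:1, - of_real (s j):] ^ (2 * M j))
        + (\<Prod>j<J. [:1, of_real (s j):] ^ (2 * M j)))"
  have poly_q: "poly q x = G x - of_real \<kappa> * (A x + A (- x))" for x
    by (simp add: q_def G_def A_def poly_prod mult.commute del: mult_pCons_left mult_pCons_right)
  have G_even: "G (- x) = G x" for x by (simp add: G_def mult.commute)
  have root: "poly q (of_real a) = 0"
  proof -
    have pos: "1 - s j * a > 0" "1 + s j * a > 0" for j
      using s(1) [of j] s1(3) [of j] a by (simp_all add: add_pos_pos)
    have "A (of_real a) * of_real Ea = G (of_real a)"
    proof -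
      have "of_real (\<Prod>j<J. (1 - s j * a) ^ (2 * M j)) * of_real Ea
          = (of_real (\<Prod>j<J. ((1 - s j * a) * (1 + s j * a)) ^ M j) :: complex)"
        unfolding Ea_def of_real_mult [symmetric] prod.distrib [symmetric] of_real_eq_iff
      proof (rule prod.cong [OF refl])
        fix j
        show "(1 - s j * a) ^ (2 * M j) * ((1 + s j * a) / (1 - s j * a)) ^ M j
            = ((1 - s j * a) * (1 + s j * a)) ^ M j"
          using pos [of j] by (simp add: power_mult power_mult_distrib [symmetric] power2_eq_square)
      qed
      then show ?thesis by (simp add: A_def G_def)
    qed
    moreover have "A (- of_real a) = G (of_real a) * of_real Ea"
    proof -
      have "(of_real (\<Prod>j<J. (1 + s j * a) ^ (2 * M j)) :: complex)
          = of_real (\<Prod>j<J. ((1 - s j * a) * (1 + s j * a)) ^ M j) * of_real Ea"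
        unfolding Ea_def of_real_mult [symmetric] prod.distrib [symmetric] of_real_eq_iff
      proof (rule prod.cong [OF refl])
        fix j
        show "(1 + s j * a) ^ (2 * M j)
            = ((1 - s j * a) * (1 + s j * a)) ^ M j * ((1 + s j * a) / (1 - s j * a)) ^ M j"
          using pos [of j] by (simp add: power_mult power_mult_distrib [symmetric] power2_eq_square)
      qed
      then show ?thesis by (simp add: A_def G_def)
    qed
    moreover have "A (of_real a) = G (of_real a) / of_real Ea"
      using calculation(1) Ea by (simp add: field_simps)
    ultimately have "poly q (of_real a) = G (of_real a) * (1 - of_real (\<kappa> * (1 / Ea + Ea)))"
      by (simp add: poly_q algebra_simps)
    moreover have "\<kappa> * (1 / Ea + Ea) = 1"
      using Ea by (simp add: \<kappa>_def add.commute) (smt (verit) divide_pos_pos)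
    ultimately show ?thesis by simp
  qed
  moreover have "poly q (- of_real a) = 0"
    using root by (simp add: poly_q G_even add.commute)
  moreover have "poly q (\<i> * of_real t) \<in> \<real> \<and> Re (poly q (\<i> * of_real t)) > 0" for t
  proof -
    define g where "g = (\<Prod>j<J. (1 + (s j * t)\<^sup>2) ^ M j)"
    have g: "G (\<i> * of_real t) = of_real g"
      unfolding G_def g_def of_real_prod by (intro prod.cong refl) (simp add: power2_eq_square algebra_simps)
    have "g > 0" unfolding g_def by (intro prod_pos zero_less_power) (simp add: add_pos_nonneg)
    have "A (- (\<i> * of_real t)) = cnj (A (\<i> * of_real t))" by (simp add: A_def)
    then have sum: "A (\<i> * of_real t) + A (- (\<i> * of_real t)) = of_real (2 * Re (A (\<i> * of_real t)))"
      by (simp add: complex_add_cnj)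
    have "cmod (A (\<i> * of_real t)) = g"
      unfolding A_def g_def prod_norm [symmetric]
    proof (rule prod.cong [OF refl])
      fix j
      have "(cmod (1 - of_real (s j) * (\<i> * of_real t)))\<^sup>2 = 1 + (s j * t)\<^sup>2"
        by (simp add: cmod_power2)
      then show "cmod ((1 - of_real (s j) * (\<i> * of_real t)) ^ (2 * M j)) = (1 + (s j * t)\<^sup>2) ^ M j"
        by (simp add: norm_power power_mult)
    qed
    then have "Re (A (\<i> * of_real t)) \<le> g" using complex_Re_le_cmod by metis
    moreover have "2 * \<kappa> \<le> \<delta>" using \<kappa> mult_left_mono [of 2 "1 + E1" \<kappa>] E1 \<kappa>0 by linarith
    ultimately have "2 * \<kappa> * Re (A (\<i> * of_real t)) \<le> (1 / 2) * g"
      using \<kappa>0 \<delta> \<open>g > 0\<close> by (smt (verit) mult_left_mono mult_right_mono)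
    moreover have "poly q (\<i> * of_real t) = of_real (g - 2 * \<kappa> * Re (A (\<i> * of_real t)))"
      unfolding poly_q sum g by simp
    ultimately show ?thesis using \<open>g > 0\<close> by simp
  qed
  moreover have "poly q (1 + \<i> * of_real t) \<noteq> 0 \<and> in_cone (12 * c + 2 * \<delta>) (poly q (1 + \<i> * of_real t))" for t
  proof -
    define x where "x = 1 + \<i> * complex_of_real t"
    \<comment> \<open>For \<open>s j \<le> 1 / 2\<close> the real part is at least \<open>3 / 4 + (s j * |t|)\<^sup>2\<close>, which bounds the argument of each factor
        by its tangent.\<close>
    have Re: "Re ((1 - of_real (s j) * x) * (1 + of_real (s j) * x)) = 1 - (s j)\<^sup>2 + (s j * t)\<^sup>2"
      and Im: "Im ((1 - of_real (s j) * x) * (1 + of_real (s j) * x)) = - 2 * (s j)\<^sup>2 * t" for j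
      by (simp_all add: x_def power2_eq_square algebra_simps)
    have sq: "(s j)\<^sup>2 \<le> 1 / 4" for j
      using power_mono [of "s j" "1 / 2" 2] s(1) [of j] s1(1) [of j] by (simp add: power2_eq_square)
    have Repos: "1 - (s j)\<^sup>2 + (s j * t)\<^sup>2 \<ge> 3 / 4 + (s j * \<bar>t\<bar>)\<^sup>2" for j
      using sq [of j] by (simp add: power_mult_distrib)
    have pos34: "3 / 4 + (s j * \<bar>t\<bar>)\<^sup>2 > 0" for j by (simp add: add_pos_nonneg)
    have "in_cone (real (M j) * (2 * s j * ((s j * \<bar>t\<bar>) / (3 / 4 + (s j * \<bar>t\<bar>)\<^sup>2))))
        (((1 - of_real (s j) * x) * (1 + of_real (s j) * x)) ^ M j)" for j
    proof (intro in_cone_power in_cone_tan; unfold Re Im)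
      show "0 < 1 - (s j)\<^sup>2 + (s j * t)\<^sup>2" using Repos [of j] pos34 [of j] by linarith
      have "\<bar>- 2 * (s j)\<^sup>2 * t\<bar> = 2 * s j * ((s j * \<bar>t\<bar>) / (3 / 4 + (s j * \<bar>t\<bar>)\<^sup>2)) * (3 / 4 + (s j * \<bar>t\<bar>)\<^sup>2)"
        using pos34 [of j] s(1) [of j] by (simp add: abs_mult power2_eq_square)
      also have "\<dots> \<le> 2 * s j * ((s j * \<bar>t\<bar>) / (3 / 4 + (s j * \<bar>t\<bar>)\<^sup>2)) * (1 - (s j)\<^sup>2 + (s j * t)\<^sup>2)"
        using Repos [of j] pos34 [of j] s(1) [of j] by (intro mult_left_mono) auto
      finally show "\<bar>- 2 * (s j)\<^sup>2 * t\<bar> \<le> \<dots>" .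
    qed
    then have "in_cone (\<Sum>j<J. real (M j) * (2 * s j * ((s j * \<bar>t\<bar>) / (3 / 4 + (s j * \<bar>t\<bar>)\<^sup>2)))) (G x)"
      unfolding G_def by (rule in_cone_prod)
    moreover have "(\<Sum>j<J. real (M j) * (2 * s j * ((s j * \<bar>t\<bar>) / (3 / 4 + (s j * \<bar>t\<bar>)\<^sup>2))))
        = 2 * c * (\<Sum>j<J. (c * \<bar>t\<bar> / 2 ^ j) / (3 / 4 + (c * \<bar>t\<bar> / 2 ^ j)\<^sup>2))"
      unfolding sum_distrib_left
    proof (rule sum.cong [OF refl])
      fix j
      have y: "s j * \<bar>t\<bar> = c * \<bar>t\<bar> / 2 ^ j" by (simp add: s_def)
      have "real (M j) * (2 * s j * ((s j * \<bar>t\<bar>) / (3 / 4 + (s j * \<bar>t\<bar>)\<^sup>2)))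
          = 2 * (real (M j) * s j) * ((s j * \<bar>t\<bar>) / (3 / 4 + (s j * \<bar>t\<bar>)\<^sup>2))"
        by (simp only: mult_ac)
      then show "real (M j) * (2 * s j * ((s j * \<bar>t\<bar>) / (3 / 4 + (s j * \<bar>t\<bar>)\<^sup>2)))
          = 2 * c * ((c * \<bar>t\<bar> / 2 ^ j) / (3 / 4 + (c * \<bar>t\<bar> / 2 ^ j)\<^sup>2))"
        by (simp only: s(3) y)
    qed
    moreover have "\<dots> \<le> 2 * c * 6"
      using c by (intro mult_left_mono sum_dyadic_bound) auto
    ultimately have coneG: "in_cone (12 * c) (G x)" by (auto elim: in_cone_mono)
    have nz: "(1 - of_real (s j) * x) * (1 + of_real (s j) * x) \<noteq> 0" for j
    proof
      assume "(1 - of_real (s j) * x) * (1 + of_real (s j) * x) = 0"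
      then have "Re ((1 - of_real (s j) * x) * (1 + of_real (s j) * x)) = 0"
        by (simp only: zero_complex.sel)
      then show False using Repos [of j] pos34 [of j] unfolding Re by linarith
    qed
    have G0: "G x \<noteq> 0" unfolding G_def using nz by (simp add: prod_zero_iff)
    \<comment> \<open>Bounds for \<open>1 / Z\<close> and \<open>Z\<close> on the line, factor by factor.\<close>
    have n1: "cmod (1 - of_real (s j) * x) \<le> cmod (1 + of_real (s j) * x)" for j
    proof -
      have "(cmod (1 - of_real (s j) * x))\<^sup>2 \<le> (cmod (1 + of_real (s j) * x))\<^sup>2"
        unfolding cmod_power2 using s(1) [of j] by (simp add: x_def power2_eq_square algebra_simps)
      then show ?thesis by (rule power2_le_imp_le) simp
    qed
    have n2: "cmod (1 + of_real (s j) * x) \<le> (1 + s j) / (1 - s j) * cmod (1 - of_real (s j) * x)" for j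
    proof -
      have "(cmod (1 + of_real (s j) * x))\<^sup>2 \<le> ((1 + s j) / (1 - s j) * cmod (1 - of_real (s j) * x))\<^sup>2"
      proof -
        have le: "1 \<le> ((1 + s j) / (1 - s j))\<^sup>2"
          using s(1) [of j] s1(2) [of j] by (intro one_le_power) (simp add: le_divide_eq)
        have "(cmod (1 + of_real (s j) * x))\<^sup>2 = (1 + s j)\<^sup>2 + (s j * t)\<^sup>2"
          by (simp add: cmod_power2 x_def)
        also have "\<dots> \<le> (1 + s j)\<^sup>2 + ((1 + s j) / (1 - s j))\<^sup>2 * (s j * t)\<^sup>2"
          using mult_right_mono [OF le, of "(s j * t)\<^sup>2"] by simp
        also have "(1 + s j)\<^sup>2 = ((1 + s j) / (1 - s j))\<^sup>2 * (1 - s j)\<^sup>2"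
          using s1(2) [of j] by (simp add: power_divide)
        also have "((1 + s j) / (1 - s j))\<^sup>2 * (1 - s j)\<^sup>2 + ((1 + s j) / (1 - s j))\<^sup>2 * (s j * t)\<^sup>2
            = ((1 + s j) / (1 - s j) * cmod (1 - of_real (s j) * x))\<^sup>2"
          unfolding power_mult_distrib cmod_power2 distrib_left by (simp add: x_def power_mult_distrib)
        finally show ?thesis .
      qed
      then show ?thesis by (rule power2_le_imp_le) (use s(1) [of j] s1(2) [of j] in simp)
    qed
    have "cmod (A x) \<le> cmod (G x)"
      unfolding A_def G_def prod_norm [symmetric]
    proof (intro prod_mono conjI)
      fix j
      show "cmod ((1 - of_real (s j) * x) ^ (2 * M j))
          \<le> cmod (((1 - of_real (s j) * x) * (1 + of_real (s j) * x)) ^ M j)"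
        unfolding norm_power power_mult norm_mult
        by (intro power_mono) (auto simp: power2_eq_square intro: mult_left_mono n1)
    qed simp
    moreover have "cmod (A (- x)) \<le> E1 * cmod (G x)"
      unfolding A_def G_def E1_def prod_norm [symmetric] prod.distrib [symmetric]
    proof (intro prod_mono conjI)
      fix j
      have "cmod (1 + of_real (s j) * x) * cmod (1 + of_real (s j) * x)
          \<le> ((1 + s j) / (1 - s j) * cmod (1 - of_real (s j) * x)) * cmod (1 + of_real (s j) * x)"
        by (intro mult_right_mono n2) simp
      then have "(cmod (1 + of_real (s j) * x) * cmod (1 + of_real (s j) * x)) ^ M j
          \<le> ((1 + s j) / (1 - s j) * (cmod (1 - of_real (s j) * x) * cmod (1 + of_real (s j) * x))) ^ M j"
        by (intro power_mono) (auto simp: mult.assoc)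
      then show "cmod ((1 - of_real (s j) * (- x)) ^ (2 * M j))
          \<le> ((1 + s j) / (1 - s j)) ^ M j * cmod (((1 - of_real (s j) * x) * (1 + of_real (s j) * x)) ^ M j)"
        by (simp only: norm_power power_mult norm_mult power2_eq_square power_mult_distrib
            mult_minus_right diff_minus_eq_add)
    qed simp
    ultimately have "cmod (A x + A (- x)) \<le> (1 + E1) * cmod (G x)"
      using norm_triangle_ineq [of "A x" "A (- x)"] by (simp add: distrib_right)
    define w where "w = of_real \<kappa> * (A x + A (- x)) / G x"
    have "cmod w = \<kappa> * (cmod (A x + A (- x)) / cmod (G x))"
      using \<kappa>0 by (simp add: w_def norm_mult norm_divide)
    also have "\<dots> \<le> \<kappa> * (1 + E1)"
      using \<kappa>0 G0 \<open>cmod (A x + A (- x)) \<le> (1 + E1) * cmod (G x)\<close>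
      by (intro mult_left_mono) (simp_all add: divide_le_eq)
    finally have w: "cmod w \<le> \<delta>" using \<kappa> by linarith
    have Re_w: "Re (1 - w) \<ge> 1 / 2" and "\<bar>Im (1 - w)\<bar> \<le> \<delta>"
      using w \<delta> complex_Re_le_cmod [of w] abs_Im_le_cmod [of w] by auto
    moreover have "\<delta> \<le> 2 * \<delta> * Re (1 - w)" using mult_left_mono [OF Re_w, of "2 * \<delta>"] \<delta> by simp
    ultimately have cone: "in_cone (2 * \<delta>) (1 - w)" by (intro in_cone_tan) linarith+
    have "1 - w \<noteq> 0" using Re_w by auto
    have "poly q x = G x * (1 - w)" using G0 by (simp add: poly_q w_def right_diff_distrib)
    then show ?thesis unfolding x_def [symmetric]
      using in_cone_mult [OF coneG cone] G0 \<open>1 - w \<noteq> 0\<close> by simp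
  qed
  ultimately show ?thesis by blast
qed

text \<open>
  The roots \<open>\<plusminus> a\<close> of the polynomial above with \<open>a = |Re \<alpha>|\<close> are moved to \<open>\<alpha>\<close> and \<open>- cnj \<alpha>\<close> by a translation
  along the imaginary axis, which maps the lines \<open>Re x = 0\<close> and \<open>Re x = 1\<close> to themselves.
\<close>

lemma cone_polynomial:
  fixes \<alpha> :: complex
  assumes "\<bar>Re \<alpha>\<bar> > 1" "\<epsilon> > 0"
  obtains q where "poly q \<alpha> = 0"
    "\<And>t. poly q (\<i> * of_real t) \<in> \<real> \<and> Re (poly q (\<i> * of_real t)) > 0"
    "\<And>t. poly q (1 + \<i> * of_real t) \<noteq> 0 \<and> in_cone \<epsilon> (poly q (1 + \<i> * of_real t))"
proof -
  define a where "a = \<bar>Re \<alpha>\<bar>"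
  define c where "c = min (\<epsilon> / 24) (1 / (2 * a))"
  define \<delta> where "\<delta> = min (\<epsilon> / 4) (1 / 2)"
  have a: "a > 1" using assms by (simp add: a_def)
  have "1 / (2 * a) \<le> 1 / 2" using a by (simp add: divide_le_eq)
  moreover have "c \<le> 1 / (2 * a)" by (simp add: c_def)
  ultimately have "c \<le> 1 / 2" by linarith
  moreover have "c > 0" using a assms by (simp add: c_def)
  ultimately have c: "c > 0" "c \<le> 1 / 2" by blast+
  have "c * a \<le> (1 / (2 * a)) * a" using a by (intro mult_right_mono) (auto simp: c_def)
  then have ca: "c * a < 1" using a by simp
  have \<delta>: "\<delta> > 0" "\<delta> \<le> 1 / 2" using assms by (auto simp: \<delta>_def)
  \<comment> \<open>The constants \<open>24\<close> and \<open>4\<close> give each of the two contributions to the angle at most \<open>\<epsilon> / 2\<close>.\<close>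
  have le: "12 * c + 2 * \<delta> \<le> \<epsilon>" unfolding c_def \<delta>_def by linarith
  obtain q where q: "poly q (of_real a) = 0" "poly q (- of_real a) = 0"
    "\<And>t. poly q (\<i> * of_real t) \<in> \<real> \<and> Re (poly q (\<i> * of_real t)) > 0"
    "\<And>t. poly q (1 + \<i> * of_real t) \<noteq> 0 \<and> in_cone (12 * c + 2 * \<delta>) (poly q (1 + \<i> * of_real t))"
    using cone_polynomial_real_root [OF a c ca \<delta>] by blast
  define b where "b = Im \<alpha>"
  have tr: "poly (translate (- \<i> * of_real b) q) (x + \<i> * of_real t) = poly q (x + \<i> * of_real (t - b))" for x t
    by (simp add: poly_pcompose algebra_simps)
  show thesis
  proof (rule that [of "translate (- \<i> * of_real b) q"])
    have "poly (translate (- \<i> * of_real b) q) \<alpha> = poly q (of_real (Re \<alpha>))"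
      by (simp add: poly_pcompose b_def) (metis add.commute complex_eq diff_add_cancel add_diff_cancel_right' uminus_add_conv_diff)
    also have "\<dots> = 0" using q(1,2) by (auto simp: a_def abs_if split: if_splits)
    finally show "poly (translate (- \<i> * of_real b) q) \<alpha> = 0" .
  next
    fix t
    show "poly (translate (- \<i> * of_real b) q) (\<i> * of_real t) \<in> \<real>
        \<and> Re (poly (translate (- \<i> * of_real b) q) (\<i> * of_real t)) > 0"
      using q(3) [of "t - b"] tr [of 0 t] by simp
    show "poly (translate (- \<i> * of_real b) q) (1 + \<i> * of_real t) \<noteq> 0
        \<and> in_cone \<epsilon> (poly (translate (- \<i> * of_real b) q) (1 + \<i> * of_real t))"
      unfolding tr using q(4) [of "t - b"] le by (auto intro: in_cone_mono)
  qed
qed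

lemma cone_multiple:
  fixes M :: "complex multiset" and \<epsilon> :: real
  assumes "\<And>\<alpha>. \<alpha> \<in># M \<Longrightarrow> \<bar>Re \<alpha>\<bar> > 1" "\<epsilon> > 0"
  shows "\<exists>Q. (\<Prod>\<alpha>\<in>#M. [:- \<alpha>, 1:]) dvd Q \<and>
    (\<forall>t. poly Q (\<i> * of_real t) \<in> \<real> \<and> Re (poly Q (\<i> * of_real t)) > 0) \<and>
    (\<forall>t. poly Q (1 + \<i> * of_real t) \<noteq> 0 \<and> in_cone (real (size M) * \<epsilon>) (poly Q (1 + \<i> * of_real t)))"
  using assms(1)
proof (induction M)
  case empty
  show ?case by (intro exI [of _ 1]) (auto simp: in_cone_1)
next
  case (add \<alpha> M)
  then obtain Q where Q: "(\<Prod>\<alpha>\<in>#M. [:- \<alpha>, 1:]) dvd Q"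
    "\<And>t. poly Q (\<i> * of_real t) \<in> \<real> \<and> Re (poly Q (\<i> * of_real t)) > 0"
    "\<And>t. poly Q (1 + \<i> * of_real t) \<noteq> 0 \<and> in_cone (real (size M) * \<epsilon>) (poly Q (1 + \<i> * of_real t))"
    by force
  obtain q where q: "poly q \<alpha> = 0"
    "\<And>t. poly q (\<i> * of_real t) \<in> \<real> \<and> Re (poly q (\<i> * of_real t)) > 0"
    "\<And>t. poly q (1 + \<i> * of_real t) \<noteq> 0 \<and> in_cone \<epsilon> (poly q (1 + \<i> * of_real t))"
    using cone_polynomial [of \<alpha> \<epsilon>] add.prems [of \<alpha>] assms(2) by auto
  show ?case
  proof (intro exI [of _ "q * Q"] conjI allI)
    show "(\<Prod>\<alpha>\<in>#add_mset \<alpha> M. [:- \<alpha>, 1:]) dvd q * Q"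
      using q(1) Q(1) by (simp add: mult_dvd_mono poly_eq_0_iff_dvd del: mult_pCons_left)
    fix t
    show "poly (q * Q) (\<i> * of_real t) \<in> \<real>" "Re (poly (q * Q) (\<i> * of_real t)) > 0"
      using q(2) [of t] Q(2) [of t] by (auto simp: complex_is_Real_iff)
    show "poly (q * Q) (1 + \<i> * of_real t) \<noteq> 0" using q(3) [of t] Q(3) [of t] by simp
    show "in_cone (real (size (add_mset \<alpha> M)) * \<epsilon>) (poly (q * Q) (1 + \<i> * of_real t))"
      using in_cone_mult [of \<epsilon> "poly q (1 + \<i> * of_real t)" "real (size M) * \<epsilon>" "poly Q (1 + \<i> * of_real t)"]
        q(3) [of t] Q(3) [of t] by (simp add: algebra_simps)
  qed
qed

section \<open>Roots outside the closed strip: no positive trace\<close>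

lemma real_poly_pos:
  fixes Q :: "real poly"
  assumes "\<And>x. poly Q x \<noteq> 0" "Polynomial.lead_coeff Q > 0"
  shows "poly Q x > 0"
proof (rule ccontr)
  assume "\<not> poly Q x > 0"
  then have neg: "poly Q x < 0" using assms(1) [of x] by linarith
  obtain b where b: "\<And>y. y \<ge> b \<Longrightarrow> poly Q y \<ge> Polynomial.lead_coeff Q"
    using poly_pinfty_gt_lc [OF assms(2)] by blast
  have "b \<le> max b x + 1" "x < max b x + 1" by linarith+
  then have "poly Q (max b x + 1) > 0" using b [of "max b x + 1"] assms(2) by linarith
  from poly_IVT_pos [OF \<open>x < max b x + 1\<close> neg this] assms(1) show False by auto
qed

lemma real_ix_real_poly:
  assumes "P \<in> real_ix_polys"
  obtains Q :: "real poly" where "\<And>t. poly P (\<i> * of_real t) = of_real (poly Q (- t))"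
    "Polynomial.degree Q = Polynomial.degree P"
    "Polynomial.lead_coeff P = of_real (Polynomial.lead_coeff Q) * \<i> ^ Polynomial.degree P"
proof -
  from assms obtain Q where P: "P = map_poly complex_of_real Q \<circ>\<^sub>p [:0, \<i>:]"
    by (auto simp: real_ix_polys_def)
  have ev: "poly (map_poly complex_of_real Q) (of_real x) = of_real (poly Q x)" for x
    by (induction Q) (auto simp: map_poly_pCons)
  have deg: "Polynomial.degree Q = Polynomial.degree P"
    by (simp add: P degree_pcompose degree_map_poly)
  show thesis
  proof (rule that [of Q])
    show "poly P (\<i> * of_real t) = of_real (poly Q (- t))" for t
    proof -
      have "poly P (\<i> * of_real t) = poly (map_poly complex_of_real Q) (of_real (- t))"
      proof -
        have "\<i> * complex_of_real t * \<i> = of_real (- t)" by (simp add: complex_eq_iff)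
        then show ?thesis by (simp add: P poly_pcompose)
      qed
      then show ?thesis by (simp only: ev)
    qed
    show "Polynomial.lead_coeff P = of_real (Polynomial.lead_coeff Q) * \<i> ^ Polynomial.degree P"
      using lead_coeff_comp [of "[:0, \<i>:]" "map_poly complex_of_real Q"]
      by (simp add: deg degree_map_poly coeff_map_poly flip: P)
  qed (rule deg)
qed

lemma real_ix_monic_real_poly:
  assumes "P \<in> real_ix_polys" "Polynomial.degree P = 2 * m" "Polynomial.lead_coeff P = (- 1) ^ m"
  obtains Q :: "real poly" where "\<And>t. poly P (\<i> * of_real t) = of_real (poly Q (- t))"
    "Polynomial.lead_coeff Q = 1"
proof -
  obtain Q :: "real poly" where Q: "\<And>t. poly P (\<i> * of_real t) = of_real (poly Q (- t))"
    and "Polynomial.lead_coeff P = of_real (Polynomial.lead_coeff Q) * \<i> ^ Polynomial.degree P"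
    using real_ix_real_poly [OF assms(1)] by metis
  then have "of_real (Polynomial.lead_coeff Q) * (- 1 :: complex) ^ m = 1 * (- 1) ^ m"
    using assms by (simp add: power_mult)
  then have "complex_of_real (Polynomial.lead_coeff Q) = 1" by simp
  then show thesis using that Q by simp
qed

text \<open>
  With \<open>Q = P * F\<close> as in \<open>cone_multiple\<close> for an opening angle below \<open>\<pi> / 2\<close>, the polynomial \<open>Q\<close> has positive
  real part on \<open>Re x = 1\<close>, and \<open>Q (x - 1)\<close> is the conjugate of \<open>Q (x + 1)\<close> on the imaginary axis. So
  \<open>D = Q (x - 1) + Q (x + 1)\<close> is positive there, while the trace property gives \<open>\<tau> D = 2 * \<tau> (Q (x - 1)) \<le> 0\<close>.
\<close>

lemma not_unitarizable_of_roots_outside: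
  assumes P: "P \<in> real_ix_polys" and roots: "\<And>\<alpha>. poly P \<alpha> = 0 \<Longrightarrow> \<bar>Re \<alpha>\<bar> > 1"
    and deg: "Polynomial.degree P = 2 * m" and lead: "Polynomial.lead_coeff P = (- 1) ^ m"
  shows "\<not> regular_unitarizable P"
proof
  assume "regular_unitarizable P"
  then obtain \<tau> :: "complex poly \<Rightarrow> complex" where add: "\<And>R S. \<tau> (R + S) = \<tau> R + \<tau> S"
    and shift: "\<And>S. \<tau> (translate (- 1) (S * P)) = \<tau> (translate 1 (S * P))"
    and pos: "\<And>R. R \<noteq> 0 \<Longrightarrow> Re (\<tau> (R * star R)) > 0"
    and neg: "\<And>R. Re (\<tau> (translate (- 1) (R * star R * P))) \<le> 0"
    using trace_of_unitarizable [OF P] by blast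
  have P0: "P \<noteq> 0" using lead by auto
  obtain Qr :: "real poly" where Qr: "\<And>t. poly P (\<i> * of_real t) = of_real (poly Qr (- t))"
    and lc: "Polynomial.lead_coeff Qr = 1"
    using real_ix_monic_real_poly [OF P deg lead] by blast
  have "poly Qr x \<noteq> 0" for x
  proof
    assume "poly Qr x = 0"
    then have "poly P (\<i> * of_real (- x)) = 0" using Qr [of "- x"] by simp
    from roots [OF this] show False by simp
  qed
  then have Ppos: "poly P (\<i> * of_real t) \<in> \<real> \<and> Re (poly P (\<i> * of_real t)) > 0" for t
    using real_poly_pos [of Qr "- t"] lc by (simp add: Qr)
  define N where "N = size (proots P)"
  obtain Q where dvd: "(\<Prod>\<alpha>\<in>#proots P. [:- \<alpha>, 1:]) dvd Q"
    and Qpos: "\<And>t. poly Q (\<i> * of_real t) \<in> \<real> \<and> Re (poly Q (\<i> * of_real t)) > 0"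
    and Qcone: "\<And>t. poly Q (1 + \<i> * of_real t) \<noteq> 0 \<and> in_cone (real N * (1 / (real N + 1))) (poly Q (1 + \<i> * of_real t))"
    using cone_multiple [of "proots P" "1 / (real (size (proots P)) + 1)"] roots P0 unfolding N_def by auto
  have "P dvd Q"
    using dvd complex_poly_decompose_multiset [of P] lead
    by (metis dvd_refl leading_coeff_0_iff P0 smult_dvd_iff)
  then obtain F where F: "Q = P * F" unfolding dvd_def by blast
  have Fpos: "poly F (\<i> * of_real t) \<in> \<real> \<and> Re (poly F (\<i> * of_real t)) > 0" for t
  proof -
    obtain p q where "poly P (\<i> * of_real t) = of_real p" "poly Q (\<i> * of_real t) = of_real q" "p > 0" "q > 0"
      using Ppos [of t] Qpos [of t] by (auto elim!: Reals_cases)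
    moreover from this have "poly F (\<i> * of_real t) = of_real (q / p)"
      by (auto simp: F field_simps)
    ultimately show ?thesis by simp
  qed
  obtain R where R: "F = R * star R" using positive_on_imag_factor [OF Fpos] by blast
  have Qstar: "star Q = Q"
    by (rule poly_imag_eqI) (metis poly_star_imag Qpos Reals_cnj_iff)
  define D where "D = translate (- 1) Q + translate 1 Q"
  have Dpos: "poly D (\<i> * of_real t) \<in> \<real> \<and> Re (poly D (\<i> * of_real t)) > 0" for t
  proof -
    let ?z = "poly Q (1 + \<i> * of_real t)"
    have "poly Q (- 1 + \<i> * of_real t) = cnj ?z"
      using poly_star [of Q "- 1 + \<i> * of_real t"] by (simp add: Qstar)
    then have D: "poly D (\<i> * of_real t) = of_real (2 * Re ?z)"
      by (simp add: D_def poly_pcompose complex_add_cnj add.commute)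
    have "real N * (1 / (real N + 1)) < 1" by (simp add: divide_less_eq)
    then have "real N * (1 / (real N + 1)) < pi / 2" using pi_gt3 by linarith
    then have "Re ?z > 0" using Qcone [of t] in_cone_Re_pos by blast
    then show ?thesis unfolding D by simp
  qed
  obtain S where S: "D = S * star S" using positive_on_imag_factor [OF Dpos] by blast
  have "S \<noteq> 0" using Dpos [of 0] S by auto
  then have "Re (\<tau> D) > 0" using pos S by simp
  moreover have "\<tau> D = 2 * \<tau> (translate (- 1) (R * star R * P))"
    using shift [of F] unfolding D_def add by (simp add: F R mult_ac)
  ultimately show False using neg [of R] by simp
qed

section \<open>Integrals along vertical lines\<close>

lemma prod_mset_norm_mono:
  fixes g :: "'a \<Rightarrow> real" and u :: "'a \<Rightarrow> complex"
  assumes "\<And>x. x \<in># M \<Longrightarrow> 0 \<le> g x \<and> g x \<le> cmod (u x)"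
  shows "0 \<le> (\<Prod>x\<in>#M. g x) \<and> (\<Prod>x\<in>#M. g x) \<le> cmod (\<Prod>x\<in>#M. u x)"
  using assms
proof (induction M)
  case (add x M)
  then show ?case by (auto simp: norm_mult intro!: mult_mono)
qed simp

lemma holomorphic_on_prod_mset:
  assumes "\<And>x. x \<in># M \<Longrightarrow> u x holomorphic_on S"
  shows "(\<lambda>z. \<Prod>x\<in>#M. u x z) holomorphic_on S"
  using assms by (induction M) (auto intro!: holomorphic_intros)

lemma poly_growth:
  fixes p :: "complex poly"
  obtains C k where "C > 0" "\<And>z. cmod (poly p z) \<le> C * (1 + cmod z) ^ k"
proof -
  have "\<exists>C k. C > 0 \<and> (\<forall>z. cmod (poly p z) \<le> C * (1 + cmod z) ^ k)"
  proof (induction p)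
    case 0
    show ?case by (intro exI [of _ 1]) auto
  next
    case (pCons a p)
    then obtain C k where C: "C > 0" "\<And>z. cmod (poly p z) \<le> C * (1 + cmod z) ^ k" by blast
    have "cmod (poly (pCons a p) z) \<le> (cmod a + C) * (1 + cmod z) ^ Suc k" for z
    proof -
      have one: "1 \<le> (1 + cmod z) ^ Suc k" by (rule one_le_power) simp
      have "cmod (poly (pCons a p) z) \<le> cmod a + cmod z * cmod (poly p z)"
        using norm_triangle_ineq [of a "z * poly p z"] by (simp add: norm_mult)
      also have "\<dots> \<le> cmod a * (1 + cmod z) ^ Suc k + (1 + cmod z) * (C * (1 + cmod z) ^ k)"
        using one C mult_left_mono [OF one, of "cmod a"]
        by (intro add_mono mult_mono) auto
      also have "\<dots> = (cmod a + C) * (1 + cmod z) ^ Suc k" by (simp add: algebra_simps)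
      finally show ?thesis .
    qed
    moreover have "cmod a + C > 0" using C(1) norm_ge_zero [of a] by linarith
    ultimately show ?case by blast
  qed
  with that show thesis by blast
qed

lemma power_le_exp: "\<exists>B. \<forall>x\<ge>0. (x :: real) ^ m \<le> B * exp x"
proof (cases "m = 0")
  case True
  then show ?thesis by (intro exI [of _ 1]) auto
next
  case False
  have "x ^ m \<le> real m ^ m * exp x" if "x \<ge> 0" for x :: real
  proof -
    have "(x / m) ^ m \<le> (1 + x / m) ^ m" using that by (intro power_mono) auto
    also have "\<dots> \<le> exp x" using that False by (intro exp_ge_one_plus_x_over_n_power_n) auto
    finally show ?thesis using False by (simp add: power_divide divide_le_eq mult.commute)
  qed
  then show ?thesis by blast
qed

text \<open>
  On the strip \<open>|Re z| \<le> 1\<close> the exponential beats the polynomial growth with room for a factor \<open>1 + (Im z)\<^sup>2\<close>.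
\<close>

lemma poly_strip_decay:
  fixes p :: "complex poly"
  obtains C where "\<And>z. \<bar>Re z\<bar> \<le> 1 \<Longrightarrow> cmod (poly p z) * exp (- pi * \<bar>Im z\<bar>) \<le> C / (1 + (Im z)\<^sup>2)"
proof -
  obtain C k where C: "C > 0" "\<And>z. cmod (poly p z) \<le> C * (1 + cmod z) ^ k"
    using poly_growth by blast
  obtain B where B: "\<And>x. x \<ge> 0 \<Longrightarrow> (x :: real) ^ (k + 2) \<le> B * exp x" using power_le_exp by blast
  show thesis
  proof (rule that [of "C * B * exp 2"])
    fix z :: complex assume z: "\<bar>Re z\<bar> \<le> 1"
    define u where "u = 2 + \<bar>Im z\<bar>"
    have u: "u > 0" "1 + cmod z \<le> u" "1 + (Im z)\<^sup>2 \<le> u\<^sup>2"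
      using z cmod_le [of z] by (auto simp: u_def power2_eq_square algebra_simps)
    have "cmod (poly p z) * (1 + (Im z)\<^sup>2) \<le> (C * u ^ k) * u\<^sup>2"
      using C u by (intro mult_mono order.trans [OF C(2)]) (auto intro!: mult_left_mono power_mono)
    also have "\<dots> = C * u ^ (k + 2)" by (simp add: power_add power2_eq_square)
    also have "\<dots> \<le> C * (B * exp u)" using B [of u] C u by (intro mult_left_mono) auto
    finally have "cmod (poly p z) * (1 + (Im z)\<^sup>2) * exp (- pi * \<bar>Im z\<bar>)
        \<le> C * (B * exp u) * exp (- pi * \<bar>Im z\<bar>)"
      by (rule mult_right_mono) simp
    also have "\<dots> = C * B * exp 2 * exp (- (pi - 1) * \<bar>Im z\<bar>)"
      by (simp add: u_def algebra_simps flip: exp_add)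
    also have "\<dots> \<le> C * B * exp 2 * 1"
    proof (intro mult_left_mono mult_nonneg_nonneg)
      have "(pi - 1) * \<bar>Im z\<bar> \<ge> 0" using pi_gt3 by simp
      then show "exp (- (pi - 1) * \<bar>Im z\<bar>) \<le> 1"
        by (simp only: mult_minus_left exp_le_one_iff neg_le_0_iff_le)
      show "B \<ge> 0" using B [of 1] by (smt (verit) exp_gt_zero mult_neg_pos power_one)
    qed (use C in auto)
    finally show "cmod (poly p z) * exp (- pi * \<bar>Im z\<bar>) \<le> C * B * exp 2 / (1 + (Im z)\<^sup>2)"
      by (simp add: le_divide_eq add_pos_nonneg mult_ac)
  qed
qed

lemma integrable_of_decay:
  fixes u :: "real \<Rightarrow> complex"
  assumes cont: "continuous_on UNIV u" and bound: "\<And>t. \<bar>t\<bar> \<ge> T \<Longrightarrow> cmod (u t) \<le> C / (1 + t\<^sup>2)"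
  shows "integrable lborel u"
proof -
  have "compact (u ` {- T..T})"
    using cont by (intro compact_continuous_image continuous_on_subset [OF cont]) auto
  then have "bounded (u ` {- T..T})" by (rule compact_imp_bounded)
  then obtain B where "\<forall>y\<in>u ` {- T..T}. cmod y \<le> B"
    unfolding bounded_iff by blast
  then have B: "cmod (u t) \<le> B" if "t \<in> {- T..T}" for t
    using that by blast
  define D where "D = \<bar>C\<bar> + \<bar>B\<bar> * (1 + T\<^sup>2)"
  have le: "cmod (u t) \<le> cmod (complex_of_real (D * inverse (1 + t\<^sup>2)))" for t
  proof -
    have pos: "1 + t\<^sup>2 > 0" by (simp add: add_pos_nonneg)
    have "cmod (u t) * (1 + t\<^sup>2) \<le> D"
    proof (cases "\<bar>t\<bar> \<ge> T")
      case True
      then have "cmod (u t) * (1 + t\<^sup>2) \<le> C" using bound [OF True] pos by (simp add: le_divide_eq)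
      moreover have "\<bar>B\<bar> * (1 + T\<^sup>2) \<ge> 0" by simp
      ultimately show ?thesis unfolding D_def by linarith
    next
      case False
      then have "t\<^sup>2 \<le> T\<^sup>2" by (intro power2_le_iff_abs_le [THEN iffD2]) auto
      moreover have "t \<in> {- T..T}" using False by auto
      then have "cmod (u t) \<le> \<bar>B\<bar>" using B [of t] by linarith
      ultimately have "cmod (u t) * (1 + t\<^sup>2) \<le> \<bar>B\<bar> * (1 + T\<^sup>2)" by (intro mult_mono) auto
      then show ?thesis unfolding D_def by linarith
    qed
    moreover have "D \<ge> 0" by (simp add: D_def)
    ultimately have "cmod (u t) \<le> D / (1 + t\<^sup>2)" "D / (1 + t\<^sup>2) \<ge> 0"
      using pos by (simp_all add: pos_le_divide_eq)
    then show ?thesis by (simp only: norm_of_real abs_of_nonneg flip: divide_inverse)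
  qed
  have "integrable lborel (\<lambda>t :: real. inverse (1 + t\<^sup>2))"
    using integrable_inverse_1_plus_square by (simp add: set_integrable_def)
  then have "integrable lborel (\<lambda>t. complex_of_real (D * inverse (1 + t\<^sup>2)))"
    by (intro integrable_of_real integrable_mult_right)
  then show ?thesis
  proof (rule Bochner_Integration.integrable_bound)
    show "u \<in> borel_measurable lborel"
      using cont by (simp add: borel_measurable_continuous_onI)
  qed (use le in auto)
qed

lemma tendsto_integral_symmetric:
  fixes u :: "real \<Rightarrow> complex"
  assumes u: "integrable lborel u"
  shows "(\<lambda>n. \<integral>t. indicator {- real n..real n} t *\<^sub>R u t \<partial>lborel) \<longlonglongrightarrow> integral\<^sup>L lborel u"
proof (rule integral_dominated_convergence)
  show "integrable lborel (\<lambda>x. cmod (u x))" using u by (rule integrable_norm)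
  show "AE x in lborel. (\<lambda>n. indicator {- real n..real n} x *\<^sub>R u x) \<longlonglongrightarrow> u x"
  proof
    fix x :: real
    obtain N :: nat where "\<bar>x\<bar> \<le> real N" using real_arch_simple by blast
    then have "\<forall>n\<ge>N. indicator {- real n..real n} x *\<^sub>R u x = u x"
      by (auto simp: indicator_def)
    then show "(\<lambda>n. indicator {- real n..real n} x *\<^sub>R u x) \<longlonglongrightarrow> u x"
      by (intro tendsto_eventually) (auto simp: eventually_sequentially)
  qed
  have [measurable]: "u \<in> borel_measurable lborel" using u by auto
  show "u \<in> borel_measurable lborel"
    "\<And>n. (\<lambda>x. indicator {- real n..real n} x *\<^sub>R u x) \<in> borel_measurable lborel"
    by measurable
qed (auto simp: indicator_def)

text \<open>
  A holomorphic function on the convex strip has a primitive \<open>\<Phi>\<close>, so the integrals over \<open>[- n, n]\<close> along the two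
  lines are differences of values of \<open>\<Phi>\<close>. They differ by increments of \<open>\<Phi>\<close> along the two horizontal
  segments at heights \<open>n\<close> and \<open>- n\<close>, which tend to zero by the decay of \<open>H\<close>.
\<close>

lemma integral_vertical_line_shift:
  fixes H :: "complex \<Rightarrow> complex"
  assumes hol: "H holomorphic_on {z. Re z > -1 - \<delta> \<and> Re z < 1 + \<delta>}" and \<delta>: "\<delta> > 0"
    and bound: "\<And>z. \<bar>Re z\<bar> \<le> 1 \<Longrightarrow> \<bar>Im z\<bar> \<ge> T \<Longrightarrow> cmod (H z) \<le> C / (1 + (Im z)\<^sup>2)"
    and x: "\<bar>x\<bar> \<le> 1" "\<bar>y\<bar> \<le> 1"
  shows "(\<integral>t. H (of_real x + \<i> * of_real t) \<partial>lborel) = (\<integral>t. H (of_real y + \<i> * of_real t) \<partial>lborel)"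
    "integrable lborel (\<lambda>t. H (of_real x + \<i> * of_real t))"
proof -
  define U where "U = {z. Re z > -1 - \<delta> \<and> Re z < 1 + \<delta>}"
  have U: "U = {z. Re z > -1 - \<delta>} \<inter> {z. Re z < 1 + \<delta>}" by (auto simp: U_def)
  have "convex U" "open U"
    unfolding U by (auto intro!: convex_Int convex_halfspace_Re_gt convex_halfspace_Re_lt
        open_Int open_halfspace_Re_gt open_halfspace_Re_lt)
  moreover have "H holomorphic_on U" using hol by (simp add: U_def)
  ultimately obtain \<Phi> where "\<And>z. z \<in> U \<Longrightarrow> (\<Phi> has_field_derivative H z) (at z within U)"
    using holomorphic_convex_primitive' by blast
  then have \<Phi>: "(\<Phi> has_field_derivative H z) (at z)" if "z \<in> U" for z
    using that \<open>open U\<close> by (metis at_within_open)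
  have mem: "of_real x + \<i> * of_real t \<in> U" if "\<bar>x\<bar> \<le> 1" for x t
    using that \<delta> by (auto simp: U_def)
  have cont: "continuous_on UNIV (\<lambda>t. H (of_real x + \<i> * of_real t))" if "\<bar>x\<bar> \<le> 1" for x
    using mem [OF that] holomorphic_on_imp_continuous_on [OF hol]
    by (intro continuous_on_compose2 [OF holomorphic_on_imp_continuous_on [OF \<open>H holomorphic_on U\<close>]]
        continuous_intros) auto
  have int: "integrable lborel (\<lambda>t. H (of_real x + \<i> * of_real t))" if "\<bar>x\<bar> \<le> 1" for x
    using bound [of "of_real x + \<i> * of_real _"] that
    by (intro integrable_of_decay [OF cont [OF that], of T C]) auto
  then show "integrable lborel (\<lambda>t. H (of_real x + \<i> * of_real t))" using x by blast
  have part: "(\<integral>t. indicator {- real n..real n} t *\<^sub>R H (of_real x + \<i> * of_real t) \<partial>lborel)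
      = (\<Phi> (of_real x + \<i> * of_real (real n)) - \<Phi> (of_real x + \<i> * of_real (- real n))) / \<i>"
    if x: "\<bar>x\<bar> \<le> 1" for x n
  proof -
    have "((\<lambda>t. \<Phi> (of_real x + \<i> * of_real t) / \<i>) has_vector_derivative H (of_real x + \<i> * of_real t))
        (at t within {- real n..real n})" for t
    proof -
      have "((\<lambda>t. of_real x + \<i> * of_real t) has_vector_derivative \<i>) (at t within {- real n..real n})"
        by (auto intro!: derivative_eq_intros)
      from field_vector_diff_chain_within [OF this has_field_derivative_at_within [OF \<Phi> [OF mem [OF x]]]]
      have "((\<lambda>t. \<Phi> (of_real x + \<i> * of_real t)) has_vector_derivative \<i> * H (of_real x + \<i> * of_real t))
          (at t within {- real n..real n})" by (simp add: o_def)
      from has_vector_derivative_divide [OF this, of \<i>] show ?thesis by simp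
    qed
    then have "((\<lambda>t. H (of_real x + \<i> * of_real t)) has_integral
        (\<Phi> (of_real x + \<i> * of_real (real n)) / \<i> - \<Phi> (of_real x + \<i> * of_real (- real n)) / \<i>)) {- real n..real n}"
      using fundamental_theorem_of_calculus [where a = "- real n" and b = "real n"
          and f = "\<lambda>t. \<Phi> (of_real x + \<i> * of_real t) / \<i>"
          and f' = "\<lambda>t. H (of_real x + \<i> * of_real t)"] by simp
    moreover have "(\<lambda>t. indicator {- real n..real n} t *\<^sub>R H (of_real x + \<i> * of_real t))
        = (\<lambda>t. if t \<in> {- real n..real n} then H (of_real x + \<i> * of_real t) else 0)"
      by (auto simp: indicator_def)
    ultimately have A: "((\<lambda>t. indicator {- real n..real n} t *\<^sub>R H (of_real x + \<i> * of_real t)) has_integral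
        (\<Phi> (of_real x + \<i> * of_real (real n)) / \<i> - \<Phi> (of_real x + \<i> * of_real (- real n)) / \<i>)) UNIV"
      by (simp only: has_integral_restrict_UNIV)
    have "integrable lborel (\<lambda>t. indicator {- real n..real n} t *\<^sub>R H (of_real x + \<i> * of_real t))"
      by (intro integrable_mult_indicator int x) auto
    then have "((\<lambda>t. indicator {- real n..real n} t *\<^sub>R H (of_real x + \<i> * of_real t)) has_integral
        (\<integral>t. indicator {- real n..real n} t *\<^sub>R H (of_real x + \<i> * of_real t) \<partial>lborel)) UNIV"
      by (rule has_integral_integral_lborel)
    from has_integral_unique [OF this A] show ?thesis by (simp only: diff_divide_distrib)
  qed
  \<comment> \<open>The sign \<open>s\<close> selects the upper or the lower horizontal segment.\<close>
  have end_diff: "(\<lambda>n. \<Phi> (of_real x + \<i> * of_real (s * real n)) - \<Phi> (of_real y + \<i> * of_real (s * real n))) \<longlonglongrightarrow> 0"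
    if s: "\<bar>s\<bar> = 1" for s
  proof (rule Lim_null_comparison)
    have s2: "s\<^sup>2 = 1" using s by (metis power2_abs one_power2)
    show "\<forall>\<^sub>F n in sequentially. cmod (\<Phi> (of_real x + \<i> * of_real (s * real n)) - \<Phi> (of_real y + \<i> * of_real (s * real n)))
        \<le> (C / (1 + (real n)\<^sup>2)) * 2"
      using eventually_ge_at_top [of "nat \<lceil>T\<rceil>"]
    proof eventually_elim
      case (elim n)
      then have n: "real n \<ge> T" by linarith
      define L where "L = closed_segment (of_real y + \<i> * of_real (s * real n)) (of_real x + \<i> * of_real (s * real n))"
      have L: "\<bar>Re z\<bar> \<le> 1 \<and> Im z = s * real n" if "z \<in> L" for z
      proof -
        obtain u where u: "0 \<le> u" "u \<le> 1" and z: "z = (1 - u) *\<^sub>R (of_real y + \<i> * of_real (s * real n))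
            + u *\<^sub>R (of_real x + \<i> * of_real (s * real n))"
          using \<open>z \<in> L\<close> unfolding L_def in_segment by blast
        have "\<bar>(1 - u) * y + u * x\<bar> \<le> \<bar>(1 - u) * y\<bar> + \<bar>u * x\<bar>" by (rule abs_triangle_ineq)
        also have "\<dots> \<le> (1 - u) * 1 + u * 1"
          using u x unfolding abs_mult by (intro add_mono mult_mono) auto
        finally have "\<bar>(1 - u) * y + u * x\<bar> \<le> 1" by simp
        moreover have "Re z = (1 - u) * y + u * x" "Im z = s * real n"
          unfolding z by (simp_all add: algebra_simps)
        ultimately show ?thesis by simp
      qed
      have "cmod (\<Phi> (of_real x + \<i> * of_real (s * real n)) - \<Phi> (of_real y + \<i> * of_real (s * real n)))
          \<le> (C / (1 + (real n)\<^sup>2)) * cmod ((of_real x + \<i> * of_real (s * real n)) - (of_real y + \<i> * of_real (s * real n)))"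
      proof (rule field_differentiable_bound [where S = L and f = \<Phi> and f' = H])
        show "convex L" by (simp add: L_def)
        show "(\<Phi> has_field_derivative H z) (at z within L)" if "z \<in> L" for z
          using L [OF that] \<delta> by (auto simp: U_def intro!: has_field_derivative_at_within [OF \<Phi>])
        show "cmod (H z) \<le> C / (1 + (real n)\<^sup>2)" if "z \<in> L" for z
          using bound [of z] L [OF that] n s s2 by (simp add: abs_mult power_mult_distrib)
      qed (auto simp: L_def)
      also have "\<dots> = (C / (1 + (real n)\<^sup>2)) * \<bar>x - y\<bar>"
        by (metis add_diff_cancel_right norm_of_real of_real_diff)
      also have "\<dots> \<le> (C / (1 + (real n)\<^sup>2)) * 2"
      proof (rule mult_left_mono)
        have "0 \<le> cmod (H (of_real x + \<i> * of_real (real n)))" by simp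
        also have "\<dots> \<le> C / (1 + (real n)\<^sup>2)" using bound [of "of_real x + \<i> * of_real (real n)"] x n by simp
        finally show "0 \<le> C / (1 + (real n)\<^sup>2)" .
      qed (use x in linarith)
      finally show ?case .
    qed
    show "(\<lambda>n. (C / (1 + (real n)\<^sup>2)) * 2) \<longlonglongrightarrow> 0" by real_asymp
  qed
  have "(\<lambda>n. (\<integral>t. indicator {- real n..real n} t *\<^sub>R H (of_real x + \<i> * of_real t) \<partial>lborel)
      - (\<integral>t. indicator {- real n..real n} t *\<^sub>R H (of_real y + \<i> * of_real t) \<partial>lborel))
    = (\<lambda>n. ((\<Phi> (of_real x + \<i> * of_real (1 * real n)) - \<Phi> (of_real y + \<i> * of_real (1 * real n)))
      - (\<Phi> (of_real x + \<i> * of_real ((- 1) * real n)) - \<Phi> (of_real y + \<i> * of_real ((- 1) * real n)))) / \<i>)"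
    unfolding part [OF x(1)] part [OF x(2)] by (simp add: field_simps)
  moreover have "\<dots> \<longlonglongrightarrow> (0 - 0) / \<i>"
    by (intro tendsto_divide tendsto_diff end_diff tendsto_const) auto
  ultimately have "(\<lambda>n. (\<integral>t. indicator {- real n..real n} t *\<^sub>R H (of_real x + \<i> * of_real t) \<partial>lborel)
      - (\<integral>t. indicator {- real n..real n} t *\<^sub>R H (of_real y + \<i> * of_real t) \<partial>lborel)) \<longlonglongrightarrow> 0" by simp
  moreover have "(\<lambda>n. (\<integral>t. indicator {- real n..real n} t *\<^sub>R H (of_real x + \<i> * of_real t) \<partial>lborel)
      - (\<integral>t. indicator {- real n..real n} t *\<^sub>R H (of_real y + \<i> * of_real t) \<partial>lborel))
    \<longlonglongrightarrow> (\<integral>t. H (of_real x + \<i> * of_real t) \<partial>lborel) - (\<integral>t. H (of_real y + \<i> * of_real t) \<partial>lborel)"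
    using x by (intro tendsto_diff tendsto_integral_symmetric int) 
  ultimately show "(\<integral>t. H (of_real x + \<i> * of_real t) \<partial>lborel) = (\<integral>t. H (of_real y + \<i> * of_real t) \<partial>lborel)"
    using LIMSEQ_unique by fastforce
qed

lemma integral_pos_cofinite:
  fixes u :: "real \<Rightarrow> real"
  assumes "integrable lborel u" "\<And>t. u t \<ge> 0" "finite {t. u t = 0}"
  shows "integral\<^sup>L lborel u > 0"
proof (rule ccontr)
  assume "\<not> ?thesis"
  moreover have "integral\<^sup>L lborel u \<ge> 0" using assms by (intro integral_nonneg_AE) auto
  ultimately have "integral\<^sup>L lborel u = 0" by linarith
  then have "AE t in lborel. u t = 0"
    using assms integral_nonneg_eq_0_iff_AE [of lborel u] by auto
  moreover have "AE t in lborel. t \<notin> {t. u t = 0}"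
    using assms(3) by (intro AE_not_in) (simp add: finite_imp_null_set_lborel)
  ultimately have "AE t :: real in lborel. False" by eventually_elim auto
  then show False by (simp add: AE_iff_measurable [OF _ refl] emeasure_lborel_UNIV)
qed

section \<open>Periodic densities with poles in the open strip\<close>

definition expi :: "complex \<Rightarrow> complex" where "expi z = exp (\<i> * of_real pi * z)"

lemma cmod_expi: "cmod (expi z) = exp (- pi * Im z)"
  by (simp add: expi_def)

lemma expi_nonzero [simp]: "expi z \<noteq> 0"
  by (simp add: expi_def)

lemma expi_imag: "expi (\<i> * of_real t) = of_real (exp (- pi * t))"
proof -
  have "\<i> * of_real pi * (\<i> * of_real t) = (of_real (- pi * t) :: complex)"
    by (simp add: complex_eq_iff)
  then show ?thesis by (simp only: expi_def exp_of_real)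
qed

lemma expi_shift: "expi (z + 1) = - expi z" "expi (z - 1) = - expi z"
proof -
  have "exp (\<i> * complex_of_real pi) = - 1" "exp (- (\<i> * complex_of_real pi)) = - 1"
    by (simp_all add: exp_pi_i' exp_minus)
  then show "expi (z + 1) = - expi z" "expi (z - 1) = - expi z"
    by (simp_all add: expi_def distrib_left right_diff_distrib exp_add exp_diff)
qed

lemma expi_reflect: "expi (- cnj z) = cnj (expi z)"
  by (simp add: expi_def exp_cnj)

text \<open>
  The period of \<open>expi\<close> is \<open>2\<close>.
\<close>

lemma expi_inj:
  assumes "expi z = expi w" "\<bar>Re (z - w)\<bar> < 2"
  shows "z = w"
proof -
  obtain n :: int where n: "\<i> * of_real pi * z = \<i> * of_real pi * w + of_real (of_int (2 * n) * pi) * \<i>"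
    using assms(1) unfolding expi_def exp_eq by blast
  have "z = w + of_int (2 * n)"
  proof -
    have "\<i> * of_real pi * z = \<i> * of_real pi * (w + of_int (2 * n))" using n by (simp add: algebra_simps)
    then show ?thesis by (simp only: mult_cancel_left) simp
  qed
  moreover from this have "\<bar>real_of_int (2 * n)\<bar> < 2" using assms(2) by simp
  then have "n = 0" by linarith
  ultimately show ?thesis by simp
qed

lemma expi_holomorphic: "expi holomorphic_on S"
  unfolding expi_def by (intro holomorphic_intros)

text \<open>
  The entire function \<open>(expi z - expi \<alpha>) / (z - \<alpha>)\<close>, with its removable singularity filled in.
\<close>

definition expi_quot :: "complex \<Rightarrow> complex \<Rightarrow> complex" where
  "expi_quot \<alpha> z = (if z = \<alpha> then deriv expi \<alpha> else (expi z - expi \<alpha>) / (z - \<alpha>))"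

lemma expi_quot_holomorphic: "expi_quot \<alpha> holomorphic_on S"
proof -
  have "expi_quot \<alpha> holomorphic_on UNIV"
    unfolding expi_quot_def by (rule pole_lemma_open [OF expi_holomorphic]) simp
  then show ?thesis by (rule holomorphic_on_subset) simp
qed

lemma expi_quot_mult: "expi_quot \<alpha> z * (z - \<alpha>) = expi z - expi \<alpha>"
  by (simp add: expi_quot_def)

lemma expi_quot_nonzero:
  assumes "\<bar>Re (z - \<alpha>)\<bar> < 2"
  shows "expi_quot \<alpha> z \<noteq> 0"
proof (cases "z = \<alpha>")
  case True
  have "(expi has_field_derivative (expi \<alpha> * (\<i> * of_real pi))) (at \<alpha>)"
    unfolding expi_def by (auto intro!: derivative_eq_intros)
  then have "deriv expi \<alpha> = expi \<alpha> * (\<i> * of_real pi)" by (rule DERIV_imp_deriv)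
  then show ?thesis using True by (simp add: expi_quot_def)
next
  case False
  then show ?thesis using expi_inj [OF _ assms] by (auto simp: expi_quot_def)
qed

lemma symmetric_prod_real:
  fixes B :: "complex multiset"
  assumes "image_mset cnj B = B"
  shows "(\<Prod>\<beta>\<in>#B. of_real u + of_real v * \<beta>) \<in> \<real>"
proof -
  have "cnj (\<Prod>\<beta>\<in>#B. of_real u + of_real v * \<beta>) = (\<Prod>\<beta>\<in>#image_mset cnj B. of_real u + of_real v * \<beta>)"
    by (induction B) simp_all
  also have "\<dots> = (\<Prod>\<beta>\<in>#B. of_real u + of_real v * \<beta>)" by (simp only: assms)
  finally show ?thesis by (simp add: Reals_cnj_iff)
qed

text \<open>
  The product \<open>\<Prod>\<beta>. 1 + y * \<beta>\<close> is real and has no zero for \<open>0 \<le> y \<le> 1 / x\<close>, and it equals \<open>1\<close> at \<open>y = 0\<close>; so it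
  is positive at \<open>y = 1 / x\<close>.
\<close>

lemma symmetric_prod_pos:
  fixes B :: "complex multiset"
  assumes sym: "image_mset cnj B = B" and x: "x > 0"
    and nz: "\<And>\<beta> y. \<beta> \<in># B \<Longrightarrow> y \<ge> x \<Longrightarrow> of_real y + \<beta> \<noteq> 0"
  obtains p where "p > 0" "(\<Prod>\<beta>\<in>#B. of_real x + \<beta>) = of_real p"
proof -
  define g where "g y = Re (\<Prod>\<beta>\<in>#B. 1 + of_real y * \<beta>)" for y :: real
  have g: "(\<Prod>\<beta>\<in>#B. 1 + of_real y * \<beta>) = of_real (g y)" for y
    using symmetric_prod_real [OF sym, of 1 y] by (simp add: g_def)
  have "continuous_on S g" for S
  proof -
    have "(\<Prod>\<beta>\<in>#B. 1 + of_real y * \<beta>) = poly (\<Prod>\<beta>\<in>#B. [:1, \<beta>:]) (of_real y)" for y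
      by (simp add: poly_prod_mset)
    then show ?thesis unfolding g_def by (auto intro!: continuous_intros)
  qed
  have g_nz: "g y \<noteq> 0" if "0 \<le> y" "y \<le> 1 / x" for y
  proof (cases "y = 0")
    case True
    then show ?thesis using g [of 0] by simp
  next
    case False
    then have "y > 0" "1 / y \<ge> x" using that x by (auto simp: field_simps)
    have "1 + of_real y * \<beta> \<noteq> 0" if "\<beta> \<in># B" for \<beta>
    proof
      assume "1 + of_real y * \<beta> = 0"
      then have "of_real (1 / y) + \<beta> = 0" using \<open>y > 0\<close> by (simp add: field_simps)
      with nz [OF that \<open>1 / y \<ge> x\<close>] show False by simp
    qed
    then have "(\<Prod>\<beta>\<in>#B. 1 + of_real y * \<beta>) \<noteq> 0" by auto
    then show ?thesis unfolding g by simp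
  qed
  have "g (1 / x) > 0"
  proof (rule ccontr)
    assume "\<not> g (1 / x) > 0"
    moreover have "g 0 = 1" using g [of 0] by simp
    ultimately obtain y where "0 \<le> y" "y \<le> 1 / x" "g y = 0"
      using IVT2' [of g "1 / x" 0 0] \<open>continuous_on {0..1 / x} g\<close> x by auto
    with g_nz show False by blast
  qed
  have "(\<Prod>\<beta>\<in>#B. of_real x + \<beta>) = (\<Prod>\<beta>\<in>#B. of_real x * (1 + of_real (1 / x) * \<beta>))"
    using x by (intro arg_cong [where f = prod_mset] image_mset_cong) (simp add: field_simps)
  moreover have "\<dots> = of_real x ^ size B * (\<Prod>\<beta>\<in>#B. 1 + of_real (1 / x) * \<beta>)"
    by (simp add: prod_mset.distrib del: of_real_divide)
  ultimately have eq: "(\<Prod>\<beta>\<in>#B. of_real x + \<beta>) = of_real (x ^ size B * g (1 / x))"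
    by (simp only: g of_real_mult of_real_power)
  show thesis by (rule that [OF _ eq]) (use \<open>g (1 / x) > 0\<close> x in simp)
qed

locale symmetric_strip =
  fixes M :: "complex multiset"
  assumes strip: "\<alpha> \<in># M \<Longrightarrow> \<bar>Re \<alpha>\<bar> < 1"
    and sym: "image_mset (\<lambda>\<alpha>. - cnj \<alpha>) M = M"
begin

definition den :: "complex \<Rightarrow> complex" where
  "den z = (\<Prod>\<alpha>\<in>#M. expi z - expi \<alpha>)"

lemma den_expi_quot: "den z = (\<Prod>\<alpha>\<in>#M. expi_quot \<alpha> z) * (\<Prod>\<alpha>\<in>#M. z - \<alpha>)"
  unfolding den_def expi_quot_mult [symmetric] by (rule prod_mset.distrib)

lemma den_nonzero:
  assumes "\<bar>Re z\<bar> \<le> 1" "z \<notin># M"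
  shows "den z \<noteq> 0"
proof -
  have "expi z - expi \<alpha> \<noteq> 0" if "\<alpha> \<in># M" for \<alpha>
  proof
    assume "expi z - expi \<alpha> = 0"
    moreover have "\<bar>Re (z - \<alpha>)\<bar> < 2" using strip [OF that] assms(1) by auto
    ultimately have "z = \<alpha>" using expi_inj [of z \<alpha>] by simp
    with that assms(2) show False by simp
  qed
  then show ?thesis unfolding den_def by auto
qed

lemma Im_bound: obtains T where "T > 0" "\<And>\<alpha>. \<alpha> \<in># M \<Longrightarrow> \<bar>Im \<alpha>\<bar> + 1 \<le> T"
proof -
  have "bdd_above ((\<lambda>\<alpha>. \<bar>Im \<alpha>\<bar>) ` set_mset M)" by (intro bdd_above_finite) simp
  then obtain B where "\<And>\<alpha>. \<alpha> \<in># M \<Longrightarrow> \<bar>Im \<alpha>\<bar> \<le> B" unfolding bdd_above_def by blast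
  then show thesis by (intro that [of "\<bar>B\<bar> + 1"]) force+
qed

text \<open>
  For large \<open>|Im z|\<close> the value \<open>|expi z|\<close> is either tiny or huge compared with all \<open>|expi \<alpha>|\<close>. In the first case
  the denominator is bounded below and \<open>0 < j\<close> gives the decay; in the second the denominator has the
  size of \<open>expi z ^ size M\<close> and \<open>j < size M\<close> gives it.
\<close>

lemma density_tail:
  assumes "0 < j" "j < size M"
  obtains C T where "\<And>z. \<bar>Im z\<bar> \<ge> T \<Longrightarrow> cmod (expi z ^ j / den z) \<le> C * exp (- pi * \<bar>Im z\<bar>)"
proof -
  have exp_pi: "exp (- pi) \<le> 1 / 2"
  proof -
    have "exp pi \<ge> 2" using exp_ge_add_one_self [of pi] pi_gt3 by linarith
    then show ?thesis by (simp add: exp_minus field_simps)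
  qed
  obtain T where T: "T > 0" "\<And>\<alpha>. \<alpha> \<in># M \<Longrightarrow> \<bar>Im \<alpha>\<bar> + 1 \<le> T"
    by (rule Im_bound) blast
  define K where "K = (\<Prod>\<alpha>\<in>#M. cmod (expi \<alpha>) / 2)"
  have K: "K > 0" unfolding K_def by (induction M) simp_all
  show thesis
  proof (rule that [of T "1 / K + 2 ^ size M"])
    fix z assume z: "\<bar>Im z\<bar> \<ge> T"
    define x where "x = cmod (expi z)"
    have x: "x > 0" by (simp add: x_def)
    have half: "exp (- pi * s) \<le> exp (- pi * t) / 2" if "s \<ge> t + 1" for s t
    proof -
      have "- pi * s \<le> - pi * t + - pi" using mult_left_mono [OF that, of pi] by (simp add: distrib_left)
      then have "exp (- pi * s) \<le> exp (- pi * t) * exp (- pi)" by (simp flip: exp_add)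
      also have "\<dots> \<le> exp (- pi * t) * (1 / 2)" using exp_pi by (intro mult_left_mono) auto
      finally show ?thesis by simp
    qed
    have pos: "1 / K * exp (- pi * \<bar>Im z\<bar>) > 0" "2 ^ size M * exp (- pi * \<bar>Im z\<bar>) > 0" using K by simp_all
    show "cmod (expi z ^ j / den z) \<le> (1 / K + 2 ^ size M) * exp (- pi * \<bar>Im z\<bar>)"
    proof (cases "Im z > 0")
      case True
      have "0 \<le> cmod (expi \<alpha>) / 2 \<and> cmod (expi \<alpha>) / 2 \<le> cmod (expi z - expi \<alpha>)" if "\<alpha> \<in># M" for \<alpha>
      proof -
        have "Im z \<ge> Im \<alpha> + 1" using T(2) [OF that] z True by linarith
        from half [OF this] have "cmod (expi z) \<le> cmod (expi \<alpha>) / 2" by (simp add: cmod_expi)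
        then show ?thesis using norm_triangle_ineq2 [of "expi \<alpha>" "expi z"] by (simp add: norm_minus_commute)
      qed
      then have den: "K \<le> cmod (den z)" unfolding K_def den_def
        using prod_mset_norm_mono [of M "\<lambda>\<alpha>. cmod (expi \<alpha>) / 2" "\<lambda>\<alpha>. expi z - expi \<alpha>"] by blast
      have "x \<le> 1" using True by (simp add: x_def cmod_expi)
      then have "x ^ j \<le> x" using x assms(1) power_decreasing [of 1 j x] by simp
      then have "cmod (expi z ^ j / den z) \<le> x / K"
        using den K x by (auto simp: norm_divide norm_power x_def intro!: frac_le)
      also have "\<dots> = 1 / K * exp (- pi * \<bar>Im z\<bar>)" using True by (simp add: x_def cmod_expi)
      finally show ?thesis unfolding distrib_right using pos by linarith
    next
      case False
      have "0 \<le> x / 2 \<and> x / 2 \<le> cmod (expi z - expi \<alpha>)" if "\<alpha> \<in># M" for \<alpha>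
      proof -
        have "Im \<alpha> \<ge> Im z + 1" using T(2) [OF that] z False by linarith
        from half [OF this] have "cmod (expi \<alpha>) \<le> x / 2" by (simp add: x_def cmod_expi)
        then show ?thesis using norm_triangle_ineq2 [of "expi z" "expi \<alpha>"] x by (simp add: x_def)
      qed
      then have "(\<Prod>\<alpha>\<in>#M. x / 2) \<le> cmod (den z)" unfolding den_def
        using prod_mset_norm_mono [of M "\<lambda>_. x / 2" "\<lambda>\<alpha>. expi z - expi \<alpha>"] by blast
      then have den: "(x / 2) ^ size M \<le> cmod (den z)" by simp
      have "x \<ge> 1" using False by (simp add: x_def cmod_expi mult_nonneg_nonpos)
      then have "x ^ Suc j \<le> x ^ size M" using assms(2) by (intro power_increasing) auto
      have "cmod (expi z ^ j / den z) \<le> x ^ j / (x / 2) ^ size M"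
        using den x by (auto simp: norm_divide norm_power x_def intro!: frac_le)
      also have "\<dots> = 2 ^ size M * (x ^ j / x ^ size M)" by (simp add: power_divide)
      also have "\<dots> \<le> 2 ^ size M * (1 / x)"
        using \<open>x ^ Suc j \<le> x ^ size M\<close> x by (intro mult_left_mono) (auto simp: field_simps)
      also have "\<dots> = 2 ^ size M * exp (- pi * \<bar>Im z\<bar>)"
        using False by (simp add: x_def cmod_expi exp_minus field_simps)
      finally show ?thesis unfolding distrib_right using pos by linarith
    qed
  qed
qed

lemma density_poly_tail:
  fixes p :: "complex poly"
  assumes "0 < j" "j < size M"
  obtains C T where "\<And>z. \<bar>Re z\<bar> \<le> 1 \<Longrightarrow> \<bar>Im z\<bar> \<ge> T \<Longrightarrow>
    cmod (poly p z * (expi z ^ j / den z)) \<le> C / (1 + (Im z)\<^sup>2)"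
proof -
  obtain C T where C: "\<And>z. \<bar>Im z\<bar> \<ge> T \<Longrightarrow> cmod (expi z ^ j / den z) \<le> C * exp (- pi * \<bar>Im z\<bar>)"
    using density_tail [OF assms] by blast
  obtain D where D: "\<And>z. \<bar>Re z\<bar> \<le> 1 \<Longrightarrow> cmod (poly p z) * exp (- pi * \<bar>Im z\<bar>) \<le> D / (1 + (Im z)\<^sup>2)"
    using poly_strip_decay by blast
  show thesis
  proof (rule that [of T "\<bar>C\<bar> * D"])
    fix z assume z: "\<bar>Re z\<bar> \<le> 1" "\<bar>Im z\<bar> \<ge> T"
    have "cmod (expi z ^ j / den z) \<le> \<bar>C\<bar> * exp (- pi * \<bar>Im z\<bar>)"
      by (rule order.trans [OF C [OF z(2)]]) (intro mult_right_mono, auto)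
    then have "cmod (poly p z * (expi z ^ j / den z)) \<le> cmod (poly p z) * (\<bar>C\<bar> * exp (- pi * \<bar>Im z\<bar>))"
      unfolding norm_mult by (intro mult_left_mono) auto
    also have "\<dots> = \<bar>C\<bar> * (cmod (poly p z) * exp (- pi * \<bar>Im z\<bar>))" by simp
    also have "\<dots> \<le> \<bar>C\<bar> * (D / (1 + (Im z)\<^sup>2))" using D [OF z(1)] by (intro mult_left_mono) auto
    finally show "cmod (poly p z * (expi z ^ j / den z)) \<le> \<bar>C\<bar> * D / (1 + (Im z)\<^sup>2)" by simp
  qed
qed

text \<open>
  Leaves room for a slightly wider open strip in which \<open>expi_quot \<alpha>\<close> is still without zeros.
\<close>

lemma strip_margin: obtains \<delta> where "\<delta> > 0" "\<And>\<alpha>. \<alpha> \<in># M \<Longrightarrow> \<bar>Re \<alpha>\<bar> < 1 - \<delta>"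
proof -
  have "\<exists>\<delta>>0. \<forall>\<alpha>\<in>S. \<bar>Re \<alpha>\<bar> < 1 - \<delta>" if "finite S" "\<And>\<alpha>. \<alpha> \<in> S \<Longrightarrow> \<bar>Re \<alpha>\<bar> < 1" for S
    using that
  proof (induction S rule: finite_induct)
    case (insert \<alpha> S)
    then obtain \<delta> where "\<delta> > 0" "\<forall>\<alpha>\<in>S. \<bar>Re \<alpha>\<bar> < 1 - \<delta>" by auto
    moreover have "\<bar>Re \<alpha>\<bar> < 1" using insert by simp
    ultimately show ?case
      by (intro exI [of _ "min \<delta> ((1 - \<bar>Re \<alpha>\<bar>) / 2)"]) (auto simp: min_def field_simps)
  qed (auto intro: exI [of _ 1])
  from this [of "set_mset M"] strip that show thesis by blast
qed

end

section \<open>Positive traces given by densities\<close>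

locale strip_factor = symmetric_strip +
  fixes P P1 :: "complex poly"
  assumes real_ix: "P \<in> real_ix_polys"
    and factor: "P = P1 * (\<Prod>\<alpha>\<in>#M. [:- \<alpha>, 1:])"
    and cofactor_nonzero: "poly P1 (\<i> * of_real t) \<noteq> 0"
begin

lemma P_nonzero: "P \<noteq> 0"
proof
  assume "P = 0"
  moreover have "P1 \<noteq> 0" using cofactor_nonzero [of 0] by auto
  ultimately show False using factor by auto
qed

lemma poly_factor: "poly P z = poly P1 z * (\<Prod>\<alpha>\<in>#M. z - \<alpha>)"
  by (simp add: factor poly_prod_mset)

text \<open>
  Up to a positive factor this is \<open>P * W / c\<close> on the imaginary axis, with the singularities at the elements
  of \<open>M\<close> removed; see \<open>sign_fun_eq\<close>.
\<close>

definition sign_fun :: "real \<Rightarrow> complex" where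
  "sign_fun t = poly P1 (\<i> * of_real t) / (\<Prod>\<alpha>\<in>#M. expi_quot \<alpha> (\<i> * of_real t))"

lemma prod_expi_quot_nonzero: "\<bar>Re z\<bar> \<le> 1 \<Longrightarrow> (\<Prod>\<alpha>\<in>#M. expi_quot \<alpha> z) \<noteq> 0"
  using strip expi_quot_nonzero [of z] by force

lemma sign_fun_nonzero: "sign_fun t \<noteq> 0"
  using cofactor_nonzero [of t] prod_expi_quot_nonzero [of "\<i> * of_real t"] by (simp add: sign_fun_def)

lemma sign_fun_continuous: "continuous_on UNIV sign_fun"
proof -
  have "continuous_on UNIV (\<lambda>z. \<Prod>\<alpha>\<in>#M. expi_quot \<alpha> z)"
    by (intro holomorphic_on_imp_continuous_on holomorphic_on_prod_mset expi_quot_holomorphic)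
  then have "continuous_on UNIV (\<lambda>t. \<Prod>\<alpha>\<in>#M. expi_quot \<alpha> (\<i> * of_real t))"
    by (rule continuous_on_compose2) (auto intro!: continuous_intros)
  then show ?thesis
    unfolding sign_fun_def using prod_expi_quot_nonzero
    by (intro continuous_on_divide) (auto intro!: continuous_intros)
qed

lemma sign_fun_eq:
  assumes "\<i> * of_real t \<notin># M"
  shows "sign_fun t = poly P (\<i> * of_real t) / den (\<i> * of_real t)"
proof -
  have "(\<Prod>\<alpha>\<in>#M. \<i> * of_real t - \<alpha>) \<noteq> 0" using assms by auto
  then show ?thesis by (simp add: sign_fun_def poly_factor den_expi_quot)
qed

lemma image_expi_sym: "image_mset cnj (image_mset expi M) = image_mset expi M"
proof -
  have "image_mset cnj (image_mset expi M) = image_mset expi (image_mset (\<lambda>\<alpha>. - cnj \<alpha>) M)"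
    by (simp add: multiset.map_comp comp_def expi_reflect)
  then show ?thesis by (simp only: sym)
qed

lemma den_imag: "den (\<i> * of_real t) = (\<Prod>\<beta>\<in>#image_mset expi M. of_real (exp (- pi * t)) + of_real (- 1) * \<beta>)"
  by (simp add: den_def expi_imag multiset.map_comp comp_def)

lemma finite_imag_roots: "finite {t. \<i> * complex_of_real t \<in># M}"
proof -
  have "finite ((\<lambda>t. \<i> * complex_of_real t) -` set_mset M)"
    by (intro finite_vimageI) (auto simp: inj_def)
  then show ?thesis by (simp add: vimage_def)
qed

text \<open>
  Clear away from the finitely many elements of \<open>M\<close> on the axis, where \<open>P\<close> and \<open>den\<close> are real; the rest follows
  by continuity.
\<close>

lemma sign_fun_real: "sign_fun t \<in> \<real>"
proof (rule ccontr)
  assume t: "sign_fun t \<notin> \<real>"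
  let ?U = "{s. Im (sign_fun s) \<noteq> 0}"
  have "sign_fun s \<in> \<real>" if "\<i> * of_real s \<notin># M" for s
  proof -
    have "den (\<i> * of_real s) \<in> \<real>" unfolding den_imag by (rule symmetric_prod_real [OF image_expi_sym])
    moreover have "poly P (\<i> * of_real s) \<in> \<real>"
      using poly_star_imag [of P s] by (simp add: star_real_ix [OF real_ix] Reals_cnj_iff)
    ultimately show ?thesis unfolding sign_fun_eq [OF that] by (intro Reals_divide)
  qed
  then have "?U \<subseteq> {t. \<i> * complex_of_real t \<in># M}" by (auto simp: complex_is_Real_iff)
  then have "finite ?U" using finite_imag_roots finite_subset by blast
  moreover have "open ?U"
    using sign_fun_continuous by (intro open_Collect_neq continuous_intros)
  moreover have "t \<in> ?U" using t by (simp add: complex_is_Real_iff)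
  ultimately show False using finite_imp_not_open by blast
qed

lemma sign_fun_constant: "(\<forall>t. Re (sign_fun t) > 0) \<or> (\<forall>t. Re (sign_fun t) < 0)"
proof (rule ccontr)
  assume contr: "\<not> ?thesis"
  have nz: "Re (sign_fun t) \<noteq> 0" for t
    using sign_fun_nonzero [of t] sign_fun_real [of t] by (auto simp: complex_is_Real_iff complex_eq_iff)
  let ?I = "range (\<lambda>t. Re (sign_fun t))"
  have "connected ?I"
    using sign_fun_continuous by (intro connected_continuous_image continuous_intros) auto
  moreover obtain a b where "Re (sign_fun a) \<le> 0" "Re (sign_fun b) \<ge> 0"
    using contr by (auto simp: not_less)
  ultimately have "0 \<in> ?I"
    using connected_contains_Icc [of ?I "Re (sign_fun a)" "Re (sign_fun b)"] by (auto simp: subset_iff)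
  with nz show False by auto
qed

text \<open>
  At \<open>1 + \<i> * t\<close> the exponential equals \<open>- x\<close> with \<open>x = exp (- \<pi> * t)\<close>, so the density is
  \<open>c * (- x) ^ j / (\<Prod>\<alpha>. - x - expi \<alpha>)\<close>. Pulling out the signs leaves \<open>\<Prod>\<alpha>. x + expi \<alpha>\<close>, which is positive
  because \<open>|Re \<alpha>| < 1\<close> keeps \<open>expi \<alpha>\<close> off the negative real axis.
\<close>

lemma density_pos:
  assumes "c * (- 1) ^ (j + size M) > 0"
  obtains r where "r > 0" "of_real c * (expi (1 + \<i> * of_real t) ^ j / den (1 + \<i> * of_real t)) = of_real r"
proof -
  define x where "x = exp (- pi * t)"
  have x: "x > 0" by (simp add: x_def)
  have expi: "expi (1 + \<i> * of_real t) = - of_real x"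
    using expi_shift(1) [of "\<i> * of_real t"] by (simp add: expi_imag x_def add.commute)
  obtain p where p: "p > 0" "(\<Prod>\<beta>\<in>#image_mset expi M. of_real x + \<beta>) = of_real p"
  proof (rule symmetric_prod_pos [OF image_expi_sym x])
    fix \<beta> y assume "\<beta> \<in># image_mset expi M" "x \<le> y"
    then obtain \<alpha> where \<alpha>: "\<alpha> \<in># M" "\<beta> = expi \<alpha>" by auto
    have y: "y > 0" using x \<open>x \<le> y\<close> by linarith
    \<comment> \<open>The negative number \<open>- y\<close> is the value of \<open>expi\<close> at a point of the line \<open>Re z = 1\<close>.\<close>
    define s where "s = - ln y / pi"
    have "exp (- pi * s) = y" using y by (simp add: s_def)
    then have "expi (\<i> * of_real s) = of_real y" by (simp only: expi_imag)
    then have "expi (1 + \<i> * of_real s) = - of_real y"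
      using expi_shift(1) [of "\<i> * of_real s"] by (simp add: add.commute)
    moreover have "1 + \<i> * of_real s \<noteq> \<alpha>" using strip [OF \<alpha>(1)] by auto
    moreover have "\<bar>Re (\<alpha> - (1 + \<i> * of_real s))\<bar> < 2" using strip [OF \<alpha>(1)] by auto
    ultimately show "of_real y + \<beta> \<noteq> 0"
      using expi_inj [of \<alpha> "1 + \<i> * of_real s"] \<alpha>(2) by (auto simp: add_eq_0_iff)
  qed blast
  have "den (1 + \<i> * of_real t) = (\<Prod>\<beta>\<in>#image_mset expi M. - 1 * (of_real x + \<beta>))"
    by (simp add: den_def expi multiset.map_comp comp_def)
  also have "\<dots> = (- 1) ^ size M * (\<Prod>\<beta>\<in>#image_mset expi M. of_real x + \<beta>)"
    by (subst prod_mset.distrib) simp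
  finally have den: "den (1 + \<i> * of_real t) = (- 1) ^ size M * of_real p" by (simp only: p)
  show thesis
  proof (rule that [of "c * (- 1) ^ (j + size M) * (x ^ j / p)"])
    show "c * (- 1) ^ (j + size M) * (x ^ j / p) > 0" using assms x p by simp
    have "of_real c * (expi (1 + \<i> * of_real t) ^ j / den (1 + \<i> * of_real t))
        = of_real c * ((- 1) ^ j * (- 1) ^ size M) * (of_real x ^ j / of_real p)"
      unfolding den expi by (cases "even (size M)") (simp_all add: power_minus [of "complex_of_real x"])
    then show "of_real c * (expi (1 + \<i> * of_real t) ^ j / den (1 + \<i> * of_real t))
        = of_real (c * (- 1) ^ (j + size M) * (x ^ j / p))" by (simp add: power_add)
  qed
qed

text \<open>
  The functional integrates over the imaginary axis against \<open>w t = W (1 + \<i> * t)\<close>. For each \<open>S\<close> the function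
  \<open>S * P * W\<close> extends holomorphically as \<open>H S\<close> to a neighbourhood of the closed strip, and because \<open>W\<close> has period
  \<open>2\<close> the two sides of the trace property are its integrals over \<open>Re z = -1\<close> and \<open>Re z = 1\<close>. The integral
  over \<open>Re z = 0\<close> gives the second positivity condition.
\<close>

lemma positive_trace_exists:
  fixes c :: real
  assumes j: "0 < j" "j < size M" and parity: "c * (- 1) ^ (j + size M) > 0"
    and sign: "\<And>t. c * Re (sign_fun t) < 0"
  shows "\<exists>\<tau>. positive_trace P \<tau>"
proof -
  define w where "w t = of_real c * (expi (1 + \<i> * of_real t) ^ j / den (1 + \<i> * of_real t))" for t
  define \<tau> where "\<tau> R = (\<integral>t. poly R (\<i> * of_real t) * w t \<partial>lborel)" for R
  define r where "r t = Re (w t)" for t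
  have r: "r t > 0" "w t = of_real (r t)" for t
    using density_pos [OF parity, of t] unfolding r_def w_def by (metis Re_complex_of_real)+
  have boundary: "1 + \<i> * of_real t \<notin># M" "- 1 + \<i> * of_real t \<notin># M" for t
    using strip [of "1 + \<i> * of_real t"] strip [of "- 1 + \<i> * of_real t"] by auto
  have w_cont: "continuous_on UNIV w"
  proof -
    have expi: "continuous_on UNIV (\<lambda>t. expi (1 + \<i> * complex_of_real t))"
      by (rule continuous_on_compose2 [OF holomorphic_on_imp_continuous_on [OF expi_holomorphic [of UNIV]]])
        (auto intro!: continuous_intros)
    have "den holomorphic_on UNIV"
      unfolding den_def by (intro holomorphic_on_prod_mset holomorphic_intros expi_holomorphic)
    from holomorphic_on_imp_continuous_on [OF this]
    have "continuous_on UNIV (\<lambda>t. den (1 + \<i> * complex_of_real t))"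
      by (rule continuous_on_compose2) (auto intro!: continuous_intros)
    then show ?thesis unfolding w_def using boundary den_nonzero
      by (intro continuous_intros expi) auto
  qed
  have int: "integrable lborel (\<lambda>t. poly R (\<i> * of_real t) * w t)" for R
  proof -
    obtain C T where C: "\<And>z. \<bar>Re z\<bar> \<le> 1 \<Longrightarrow> \<bar>Im z\<bar> \<ge> T \<Longrightarrow>
        cmod (poly (translate (- 1) R) z * (expi z ^ j / den z)) \<le> C / (1 + (Im z)\<^sup>2)"
      using density_poly_tail [OF j] by blast
    show ?thesis
    proof (rule integrable_of_decay)
      show "continuous_on UNIV (\<lambda>t. poly R (\<i> * of_real t) * w t)"
        by (intro continuous_intros w_cont)
      fix t :: real assume t: "\<bar>t\<bar> \<ge> T"
      let ?z = "1 + \<i> * of_real t"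
      have "poly R (\<i> * of_real t) * w t = of_real c * (poly (translate (- 1) R) ?z * (expi ?z ^ j / den ?z))"
        by (simp add: w_def poly_pcompose)
      then have "cmod (poly R (\<i> * of_real t) * w t)
          = \<bar>c\<bar> * cmod (poly (translate (- 1) R) ?z * (expi ?z ^ j / den ?z))" by (simp only: norm_mult norm_of_real)
      also have "\<dots> \<le> \<bar>c\<bar> * (C / (1 + (Im ?z)\<^sup>2))" using t by (intro mult_left_mono C) auto
      finally show "cmod (poly R (\<i> * of_real t) * w t) \<le> (\<bar>c\<bar> * C) / (1 + t\<^sup>2)" by simp
    qed
  qed
  define H where "H S z = poly (S * P1) z * (of_real c * expi z ^ j / (\<Prod>\<alpha>\<in>#M. expi_quot \<alpha> z))" for S z
  have H_eq: "H S z = poly (S * P) z * (of_real c * (expi z ^ j / den z))" if "z \<notin># M" for S z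
  proof -
    have "(\<Prod>\<alpha>\<in>#M. z - \<alpha>) \<noteq> 0" using that by auto
    then show ?thesis by (simp add: H_def poly_factor den_expi_quot)
  qed
  have H_shift: "(\<integral>t. H S (of_real x + \<i> * of_real t) \<partial>lborel) = (\<integral>t. H S (of_real y + \<i> * of_real t) \<partial>lborel)"
    "integrable lborel (\<lambda>t. H S (of_real x + \<i> * of_real t))"
    if xy: "\<bar>x\<bar> \<le> 1" "\<bar>y\<bar> \<le> 1" for S x y
  proof -
    obtain \<delta> where \<delta>: "\<delta> > 0" "\<And>\<alpha>. \<alpha> \<in># M \<Longrightarrow> \<bar>Re \<alpha>\<bar> < 1 - \<delta>" by (rule strip_margin) blast
    obtain C T where C: "\<And>z. \<bar>Re z\<bar> \<le> 1 \<Longrightarrow> \<bar>Im z\<bar> \<ge> T \<Longrightarrow>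
        cmod (poly (S * P) z * (expi z ^ j / den z)) \<le> C / (1 + (Im z)\<^sup>2)"
      using density_poly_tail [OF j] by blast
    obtain T' where T': "\<And>\<alpha>. \<alpha> \<in># M \<Longrightarrow> \<bar>Im \<alpha>\<bar> + 1 \<le> T'" by (rule Im_bound) blast
    have "H S holomorphic_on {z. Re z > -1 - \<delta> \<and> Re z < 1 + \<delta>}"
    proof -
      have "(\<Prod>\<alpha>\<in>#M. expi_quot \<alpha> z) \<noteq> 0" if "Re z > -1 - \<delta>" "Re z < 1 + \<delta>" for z
      proof -
        have "expi_quot \<alpha> z \<noteq> 0" if "\<alpha> \<in># M" for \<alpha>
        proof (rule expi_quot_nonzero)
          have "\<bar>Re z - Re \<alpha>\<bar> < 2"
            using \<delta>(2) [OF that] \<open>Re z > -1 - \<delta>\<close> \<open>Re z < 1 + \<delta>\<close> by linarith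
          then show "\<bar>Re (z - \<alpha>)\<bar> < 2" by simp
        qed
        then show ?thesis by auto
      qed
      then show ?thesis unfolding H_def
        by (intro holomorphic_intros expi_holomorphic holomorphic_on_prod_mset expi_quot_holomorphic) auto
    qed
    moreover have "cmod (H S z) \<le> (\<bar>c\<bar> * C) / (1 + (Im z)\<^sup>2)"
      if "\<bar>Re z\<bar> \<le> 1" "\<bar>Im z\<bar> \<ge> max T T'" for z
    proof -
      have "z \<notin># M" using T' [of z] that by auto
      then have "cmod (H S z) = \<bar>c\<bar> * cmod (poly (S * P) z * (expi z ^ j / den z))"
        unfolding H_eq [OF \<open>z \<notin># M\<close>] norm_mult norm_of_real by (simp only: mult_ac)
      also have "\<dots> \<le> \<bar>c\<bar> * (C / (1 + (Im z)\<^sup>2))" using that by (intro mult_left_mono C) auto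
      finally show ?thesis by simp
    qed
    ultimately show "(\<integral>t. H S (of_real x + \<i> * of_real t) \<partial>lborel) = (\<integral>t. H S (of_real y + \<i> * of_real t) \<partial>lborel)"
      "integrable lborel (\<lambda>t. H S (of_real x + \<i> * of_real t))"
      using integral_vertical_line_shift [OF _ \<delta>(1), of "H S" "max T T'" "\<bar>c\<bar> * C" x y] xy by blast+
  qed
  have \<tau>_left: "\<tau> (translate (- 1) (S * P)) = (\<integral>t. H S (of_real (- 1) + \<i> * of_real t) \<partial>lborel)" for S
    unfolding \<tau>_def
  proof (rule Bochner_Integration.integral_cong [OF refl])
    fix t :: real
    have "expi (1 + \<i> * of_real t) = expi (- 1 + \<i> * of_real t)"
      using expi_shift [of "\<i> * of_real t"] by (simp add: add.commute)
    then have "w t = of_real c * (expi (- 1 + \<i> * of_real t) ^ j / den (- 1 + \<i> * of_real t))"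
      by (simp add: w_def den_def)
    then show "poly (translate (- 1) (S * P)) (\<i> * of_real t) * w t = H S (of_real (- 1) + \<i> * of_real t)"
      using H_eq [OF boundary(2) [of t], of S] by (simp add: poly_pcompose)
  qed
  have \<tau>_right: "\<tau> (translate 1 (S * P)) = (\<integral>t. H S (of_real 1 + \<i> * of_real t) \<partial>lborel)" for S
    unfolding \<tau>_def
  proof (rule Bochner_Integration.integral_cong [OF refl])
    fix t :: real
    show "poly (translate 1 (S * P)) (\<i> * of_real t) * w t = H S (of_real 1 + \<i> * of_real t)"
      using H_eq [OF boundary(1) [of t], of S] by (simp add: poly_pcompose w_def)
  qed
  have finite_zeros: "finite {t. poly R (\<i> * of_real t) = 0}" if "R \<noteq> 0" for R :: "complex poly"
  proof -
    have "finite ((\<lambda>t. \<i> * complex_of_real t) -` {z. poly R z = 0})"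
      using poly_roots_finite [OF that] by (intro finite_vimageI) (auto simp: inj_def)
    then show ?thesis by (simp add: vimage_def)
  qed
  have "positive_trace P \<tau>"
  proof
    show "P \<in> real_ix_polys" by (rule real_ix)
    show "P \<noteq> 0" by (rule P_nonzero)
    show "\<tau> (R + S) = \<tau> R + \<tau> S" for R S
      unfolding \<tau>_def poly_add distrib_right by (rule Bochner_Integration.integral_add [OF int int])
    show "\<tau> (Polynomial.smult d R) = d * \<tau> R" for d R
      by (simp add: \<tau>_def mult.assoc)
    show "\<tau> (translate (- 1) (S * P)) = \<tau> (translate 1 (S * P))" for S
      unfolding \<tau>_left \<tau>_right by (rule H_shift) auto
    show "\<tau> (star R) = cnj (\<tau> R)" for R
    proof -
      have "(\<lambda>t. poly (star R) (\<i> * of_real t) * w t) = (\<lambda>t. cnj (poly R (\<i> * of_real t) * w t))"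
        by (simp add: fun_eq_iff poly_star_imag r(2))
      then show ?thesis by (simp only: \<tau>_def Bochner_Integration.integral_cnj)
    qed
    show "Re (\<tau> (R * star R)) > 0" if "R \<noteq> 0" for R
    proof -
      have eq: "poly (R * star R) (\<i> * of_real t) * w t = of_real ((cmod (poly R (\<i> * of_real t)))\<^sup>2 * r t)" for t
        unfolding star_mult_imag r(2) by simp
      have "integrable lborel (\<lambda>t. (cmod (poly R (\<i> * of_real t)))\<^sup>2 * r t)"
        using integrable_Re [OF int [of "R * star R"]] unfolding eq by simp
      moreover have "{t. (cmod (poly R (\<i> * of_real t)))\<^sup>2 * r t = 0} = {t. poly R (\<i> * of_real t) = 0}"
        using r(1) by (auto simp: less_imp_neq [symmetric])
      ultimately have "(\<integral>t. (cmod (poly R (\<i> * of_real t)))\<^sup>2 * r t \<partial>lborel) > 0"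
        using r(1) finite_zeros [OF that] by (intro integral_pos_cofinite) (auto simp: less_imp_le)
      then show ?thesis unfolding \<tau>_def eq integral_complex_of_real by simp
    qed
    show "Re (\<tau> (translate (- 1) (R * star R * P))) < 0" if "R \<noteq> 0" for R
    proof -
      define q where "q t = exp (- pi * t) ^ j * - (c * Re (sign_fun t))" for t
      define k where "k t = (cmod (poly R (\<i> * of_real t)))\<^sup>2 * q t" for t
      have pos: "q t > 0" for t
        using sign [of t] unfolding q_def by (intro mult_pos_pos) auto
      have eq: "H (R * star R) (of_real 0 + \<i> * of_real t) = of_real (- k t)" for t
      proof -
        have "H (R * star R) (of_real 0 + \<i> * of_real t) = poly (R * star R) (\<i> * of_real t)
            * (of_real c * expi (\<i> * of_real t) ^ j) * sign_fun t"
          by (simp add: H_def sign_fun_def)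
        also have "sign_fun t = of_real (Re (sign_fun t))" using sign_fun_real [of t] by (simp add: of_real_Re)
        finally show ?thesis unfolding star_mult_imag expi_imag k_def q_def by simp
      qed
      have "integrable lborel (\<lambda>t. - k t)"
        using integrable_Re [OF H_shift(2) [of 0 0 "R * star R"]] unfolding eq by simp
      then have "integrable lborel k" using Bochner_Integration.integrable_minus by force
      moreover have "k t \<ge> 0" for t using pos [of t] by (simp add: k_def less_imp_le)
      moreover have "{t. k t = 0} = {t. poly R (\<i> * of_real t) = 0}"
        using pos by (auto simp: k_def less_imp_neq [symmetric])
      ultimately have "(\<integral>t. k t \<partial>lborel) > 0"
        using finite_zeros [OF that] by (intro integral_pos_cofinite) simp_all
      moreover have "\<tau> (translate (- 1) (R * star R * P))
          = (\<integral>t. H (R * star R) (of_real 0 + \<i> * of_real t) \<partial>lborel)"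
        unfolding \<tau>_left by (rule H_shift(1)) auto
      then have "\<tau> (translate (- 1) (R * star R * P)) = of_real (\<integral>t. - k t \<partial>lborel)"
        unfolding eq integral_complex_of_real .
      ultimately show ?thesis by simp
    qed
  qed
  then show ?thesis by blast
qed

end

section \<open>The roots in the strip\<close>

lemma proots_linear_factors: "proots (\<Prod>\<alpha>\<in>#B. [:- \<alpha>, 1:]) = (B :: complex multiset)"
proof (induction B)
  case (add \<alpha> B)
  have "(\<Prod>\<alpha>\<in>#B. [:- \<alpha>, 1:]) \<noteq> 0" by auto
  then show ?case using add by (simp add: proots_mult del: mult_pCons_left)
qed simp

text \<open>
  Conjugating the factorisation of \<open>P\<close> into linear factors gives one of \<open>star P\<close> with mirrored roots.
\<close>

lemma proots_star_symmetric:
  assumes "star P = P"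
  shows "image_mset (\<lambda>\<alpha>. - cnj \<alpha>) (proots P) = proots P"
proof (cases "P = 0")
  case False
  have star_factors: "star (\<Prod>\<alpha>\<in>#B. [:- \<alpha>, 1:])
      = Polynomial.smult ((- 1) ^ size B) (\<Prod>\<alpha>\<in>#image_mset (\<lambda>\<alpha>. - cnj \<alpha>) B. [:- \<alpha>, 1:])" for B
  proof (induction B)
    case (add \<alpha> B)
    have "star [:- \<alpha>, 1:] = - [:cnj \<alpha>, 1:]" by (rule complex_poly_eqI) (simp add: poly_star)
    then show ?case using add by (simp del: mult_pCons_left minus_pCons)
  qed simp
  let ?lc = "Polynomial.lead_coeff P"
  have lc: "?lc \<noteq> 0" using False by simp
  have P: "P = Polynomial.smult ?lc (\<Prod>\<alpha>\<in>#proots P. [:- \<alpha>, 1:])"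
    by (rule complex_poly_decompose_multiset [symmetric])
  have "P = star (Polynomial.smult ?lc (\<Prod>\<alpha>\<in>#proots P. [:- \<alpha>, 1:]))" using assms P by simp
  also have "\<dots> = Polynomial.smult (cnj ?lc * (- 1) ^ size (proots P))
      (\<Prod>\<alpha>\<in>#image_mset (\<lambda>\<alpha>. - cnj \<alpha>) (proots P). [:- \<alpha>, 1:])"
    by (simp only: star_simps star_factors smult_smult)
  finally have "proots P = proots \<dots>" by simp
  also have "\<dots> = image_mset (\<lambda>\<alpha>. - cnj \<alpha>) (proots P)"
    by (subst proots_smult) (use lc in simp, rule proots_linear_factors)
  finally show ?thesis by simp
qed simp

definition strip_roots :: "complex poly \<Rightarrow> complex multiset" where
  "strip_roots P = {#\<alpha> \<in># proots P. \<bar>Re \<alpha>\<bar> < 1#}"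

lemma strip_factor_exists:
  assumes P: "P \<in> real_ix_polys" and "P \<noteq> 0"
  shows "\<exists>P1. strip_factor (strip_roots P) P P1"
proof -
  let ?M = "strip_roots P"
  let ?N = "{#\<alpha> \<in># proots P. \<not> \<bar>Re \<alpha>\<bar> < 1#}"
  define P1 where "P1 = Polynomial.smult (Polynomial.lead_coeff P) (\<Prod>\<alpha>\<in>#?N. [:- \<alpha>, 1:])"
  have split: "proots P = ?N + ?M" 
    unfolding strip_roots_def by (subst add.commute) (rule multiset_partition)
  have "strip_factor ?M P P1"
  proof
    show "\<bar>Re \<alpha>\<bar> < 1" if "\<alpha> \<in># ?M" for \<alpha> using that by (simp add: strip_roots_def)
    show "image_mset (\<lambda>\<alpha>. - cnj \<alpha>) ?M = ?M"
      using filter_mset_image_mset [of "\<lambda>\<alpha>. \<bar>Re \<alpha>\<bar> < 1" "\<lambda>\<alpha>. - cnj \<alpha>" "proots P"]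
        proots_star_symmetric [OF star_real_ix [OF P]] by (simp add: strip_roots_def)
    show "P \<in> real_ix_polys" by (rule P)
    show "P = P1 * (\<Prod>\<alpha>\<in>#?M. [:- \<alpha>, 1:])"
    proof -
      have "P = Polynomial.smult (Polynomial.lead_coeff P) (\<Prod>\<alpha>\<in>#?N + ?M. [:- \<alpha>, 1:])"
        using complex_poly_decompose_multiset [of P] by (simp only: split [symmetric])
      then show ?thesis by (simp only: P1_def image_mset_union prod_mset.union mult_smult_left)
    qed
    show "poly P1 (\<i> * of_real t) \<noteq> 0" for t
      using assms(2) by (auto simp: P1_def poly_prod_mset)
  qed
  then show ?thesis by blast
qed

context strip_factor
begin

text \<open>
  The sign of \<open>c\<close> is dictated by \<open>sign_fun\<close>, and one of \<open>j = 1\<close>, \<open>j = 2\<close> has the parity required by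
  \<open>density_pos\<close>.
\<close>

lemma unitarizable_of_three:
  assumes "size M \<ge> 3"
  shows "regular_unitarizable P"
proof -
  obtain c :: real where c: "c = 1 \<or> c = - 1" "\<And>t. c * Re (sign_fun t) < 0"
  proof (cases "\<forall>t. Re (sign_fun t) > 0")
    case True
    then show thesis by (intro that [of "- 1"]) auto
  next
    case False
    then show thesis using sign_fun_constant by (intro that [of 1]) auto
  qed
  obtain j where "j = 1 \<or> j = 2" "c * (- 1) ^ (j + size M) > 0"
  proof (cases "c * (- 1) ^ (1 + size M) > 0")
    case False
    then show thesis using c(1) by (intro that [of 2]) (cases "even (size M)"; auto)+
  qed (use that in blast)
  then have "\<exists>\<tau>. positive_trace P \<tau>"
    using assms by (intro positive_trace_exists [of j c] c(2)) auto
  then show ?thesis using positive_trace.unitarizable by blast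
qed

text \<open>
  Only \<open>j = 1\<close> is possible, so \<open>c\<close> must be negative, that is, \<open>sign_fun\<close> must be positive. It suffices to see this far
  down on the imaginary axis: there \<open>P\<close> is positive by the choice of leading coefficient, and \<open>den\<close> is positive
  since \<open>expi\<close> is large and positive compared with the \<open>expi \<alpha>\<close>.
\<close>

lemma unitarizable_of_two:
  assumes "size M = 2" and deg: "Polynomial.degree P = 2 * m" and lead: "Polynomial.lead_coeff P = (- 1) ^ m"
  shows "regular_unitarizable P"
proof -
  obtain Q :: "real poly" where Q: "\<And>t. poly P (\<i> * of_real t) = of_real (poly Q (- t))"
    and lc: "Polynomial.lead_coeff Q = 1"
    using real_ix_monic_real_poly [OF real_ix deg lead] by blast
  obtain b where b: "\<And>y. y \<ge> b \<Longrightarrow> poly Q y \<ge> 1"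
    using poly_pinfty_gt_lc [of Q] lc by auto
  obtain T where T: "T > 0" "\<And>\<alpha>. \<alpha> \<in># M \<Longrightarrow> \<bar>Im \<alpha>\<bar> + 1 \<le> T" by (rule Im_bound) blast
  \<comment> \<open>Low enough for \<open>Q (- t)\<close> to be positive and for \<open>exp (- \<pi> * t)\<close> to exceed every \<open>|expi \<alpha>|\<close>.\<close>
  define t where "t = - max b T"
  have t: "- t \<ge> b" "t \<le> - T" by (auto simp: t_def)
  define x where "x = exp (- pi * t)"
  have notin: "\<i> * of_real t \<notin># M" using T(2) [of "\<i> * of_real t"] t T(1) by auto
  have minus: "image_mset cnj (image_mset uminus (image_mset expi M)) = image_mset uminus (image_mset expi M)"
  proof -
    have "image_mset cnj (image_mset uminus (image_mset expi M)) = image_mset uminus (image_mset cnj (image_mset expi M))"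
      by (simp add: multiset.map_comp comp_def)
    then show ?thesis by (simp only: image_expi_sym)
  qed
  have x: "x > 0" by (simp add: x_def)
  obtain p where p: "p > 0" "(\<Prod>\<beta>\<in>#image_mset uminus (image_mset expi M). of_real x + \<beta>) = of_real p"
  proof (rule symmetric_prod_pos [OF minus x])
    fix \<beta> y assume "\<beta> \<in># image_mset uminus (image_mset expi M)" "x \<le> y"
    then obtain \<alpha> where \<alpha>: "\<alpha> \<in># M" "\<beta> = - expi \<alpha>" by auto
    have "cmod (expi \<alpha>) < x" using T(2) [OF \<alpha>(1)] t by (simp add: cmod_expi x_def)
    then have "cmod (expi \<alpha>) < cmod (of_real y)" using \<open>x \<le> y\<close> x by simp
    show "of_real y + \<beta> \<noteq> 0"
    proof
      assume "of_real y + \<beta> = 0"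
      then have "expi \<alpha> = of_real y" using \<alpha>(2) by simp
      with \<open>cmod (expi \<alpha>) < cmod (of_real y)\<close> show False by simp
    qed
  qed blast
  then have "den (\<i> * of_real t) = of_real p"
    by (simp add: den_imag x_def multiset.map_comp comp_def)
  then have "sign_fun t = of_real (poly Q (- t) / p)" by (simp add: sign_fun_eq [OF notin] Q)
  moreover have "poly Q (- t) > 0" using b [OF t(1)] by linarith
  ultimately have "Re (sign_fun t) > 0" using p(1) by simp
  then have "\<forall>t. Re (sign_fun t) > 0" using sign_fun_constant by (meson order.asym)
  then have "\<exists>\<tau>. positive_trace P \<tau>"
    using assms(1) by (intro positive_trace_exists [of 1 "- 1"]) auto
  then show ?thesis using positive_trace.unitarizable by blast
qed

end

text \<open>
  Reflection in the imaginary axis matches the roots with \<open>Re \<alpha> \<ge> 1\<close> with those with \<open>Re \<alpha> \<le> -1\<close>.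
\<close>

lemma even_strip_roots:
  assumes P: "P \<in> real_ix_polys" and "even (Polynomial.degree P)"
  shows "even (size (strip_roots P))"
proof -
  let ?A = "{#\<alpha> \<in># proots P. Re \<alpha> \<ge> 1#}" and ?B = "{#\<alpha> \<in># proots P. Re \<alpha> \<le> - 1#}"
  have "size B = size {#\<alpha> \<in># B. \<bar>Re \<alpha>\<bar> < 1#} + size {#\<alpha> \<in># B. Re \<alpha> \<ge> 1#} + size {#\<alpha> \<in># B. Re \<alpha> \<le> - 1#}"
    for B :: "complex multiset"
    by (induction B) auto
  then have split: "size (proots P) = size (strip_roots P) + size ?A + size ?B"
    unfolding strip_roots_def .
  have "?A = filter_mset (\<lambda>\<alpha>. Re \<alpha> \<ge> 1) (image_mset (\<lambda>\<alpha>. - cnj \<alpha>) (proots P))"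
    by (simp only: proots_star_symmetric [OF star_real_ix [OF P]])
  also have "\<dots> = image_mset (\<lambda>\<alpha>. - cnj \<alpha>) (filter_mset (\<lambda>\<alpha>. Re (- cnj \<alpha>) \<ge> 1) (proots P))"
    by (rule filter_mset_image_mset)
  also have "(\<lambda>\<alpha>. Re (- cnj \<alpha>) \<ge> 1) = (\<lambda>\<alpha>. Re \<alpha> \<le> - 1)" by auto
  finally have "size ?A = size ?B" by simp
  with split have "Polynomial.degree P = size (strip_roots P) + 2 * size ?B"
    by (simp add: size_proots_complex)
  with assms(2) show ?thesis by simp
qed

theorem theorem1p10:
  fixes P :: "complex poly" and n :: nat
  assumes "n \<ge> 1" and "P \<in> real_ix_polys" and "Polynomial.degree P = n"
  shows "(size {#\<alpha> \<in># proots P. \<bar>Re \<alpha>\<bar> < 1#} \<ge> 3 \<longrightarrow> regular_unitarizable P) \<and>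
    (\<forall>m. n = 2 * m \<and> Polynomial.lead_coeff P = (- 1) ^ m \<longrightarrow>
      ((\<exists>\<alpha>. poly P \<alpha> = 0 \<and> \<bar>Re \<alpha>\<bar> < 1) \<longrightarrow> regular_unitarizable P) \<and>
      ((\<forall>\<alpha>. poly P \<alpha> = 0 \<longrightarrow> \<bar>Re \<alpha>\<bar> > 1) \<longrightarrow> \<not> regular_unitarizable P))"
proof -
  have P0: "P \<noteq> 0" using assms by auto
  obtain P1 where "strip_factor (strip_roots P) P P1" using strip_factor_exists [OF assms(2) P0] by blast
  then interpret strip_factor "strip_roots P" P P1 .
  have three: "regular_unitarizable P" if "size {#\<alpha> \<in># proots P. \<bar>Re \<alpha>\<bar> < 1#} \<ge> 3"
    using unitarizable_of_three that by (simp add: strip_roots_def)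
  show ?thesis
  proof (intro conjI allI impI)
    show "regular_unitarizable P" if "size {#\<alpha> \<in># proots P. \<bar>Re \<alpha>\<bar> < 1#} \<ge> 3"
      using that by (rule three)
  next
    fix m assume m: "n = 2 * m \<and> Polynomial.lead_coeff P = (- 1) ^ m"
      and "\<exists>\<alpha>. poly P \<alpha> = 0 \<and> \<bar>Re \<alpha>\<bar> < 1"
    then obtain \<alpha> where "\<alpha> \<in># strip_roots P" using P0 by (auto simp: strip_roots_def)
    then have "size (strip_roots P) \<noteq> 0" by auto
    moreover have "even (size (strip_roots P))" using even_strip_roots assms m by simp
    ultimately have "size (strip_roots P) = 2 \<or> size (strip_roots P) \<ge> 3" by presburger
    then show "regular_unitarizable P"
      using unitarizable_of_two [of m] unitarizable_of_three assms m by auto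
  next
    fix m assume m: "n = 2 * m \<and> Polynomial.lead_coeff P = (- 1) ^ m"
      and "\<forall>\<alpha>. poly P \<alpha> = 0 \<longrightarrow> \<bar>Re \<alpha>\<bar> > 1"
    then show "\<not> regular_unitarizable P"
      using not_unitarizable_of_roots_outside [OF assms(2), of m] assms by auto
  qed
qed

end
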